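(* Let $f:[0,1]\times\mathbb R^d\to\mathbb R$ be a bounded continuous function. Assume that wherever $f(t,x)>0$, the function $f$ is twice differentiable in $x$, differentiable in $t$, and $$ f_t\le a_{ij}(t,x)\,\partial_{ij}f+C\,\frac{\|f(t,\cdot)\|_{L^\infty}^{2/d}}{\log\big(1+\|f(t,\cdot)\|_{L^\infty}\big)^{\varepsilon}}\,f. $$ Here $C$ is a constant, $\varepsilon>0$, the coefficients $a_{ij}$ are locally uniformly elliptic and, for some constants $\delta>0$, $\Lambda>0$, $N$, $\beta\in\mathbb R$ and $\kappa>-\beta d$, for all $t\in[0,1]$ and $x\in\mathbb R^d$, $$ \det(a_{ij}(t,x))\ge\delta(1+|x|)^{\beta d-\kappa},\qquad (a_{ij}(t,x))\le\Lambda(1+|x|)^{\min(2\beta,2)}\,\mathrm I,\qquad \int_{\mathbb R^d}(1+|x|)^\kappa f(t,x)\,dx\le N . $$ Let $K$ be the positive number $$ K=C_1\,\frac{N(1+\Lambda)^{d+1}}{\delta}. $$ Then, for all $(t,x)\in[0,T]\times\mathbb R^d$ (with $t\le1$), $$ f(t,x)<K\,t^{-d/2}, $$ where $T$ is the positive number given by $$ T=K^{2/d}\exp\left(-\frac2d\Big(\frac{C_2\,K^{2/d}}{1+\Lambda}\Big)^{1/\varepsilon}\right). $$ The constants $C_1$ and $C_2$ depend on the dimension $d$ only.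
   Context: Repeated indices are summed. Matrix inequalities are in the sense of symmetric matrices, and $\mathrm I$ is the identity matrix. At $t=0$ the right-hand side $K\,t^{-d/2}$ is read as $+\infty$. The restriction $t\le1$ only reflects the domain of $f$.
   Formalization: The constant C_2 may depend on C as well as on d (with C_2 depending on d only the claim fails for large C), and the L^∞ norm and the weighted integral are taken of the positive part of f (the same for f ≥ 0; for signed f the literal claim is false). *)

theory Defs
  imports "HOL-Probability.Essential_Supremum"
begin

definition Linf_norm :: "('a::euclidean_space \<Rightarrow> real) \<Rightarrow> real" where
  "Linf_norm g = real_of_ereal (esssup lborel (\<lambda>x. ereal \<bar>g x\<bar>))"

definition partial_deriv :: "'d \<Rightarrow> (real^'d \<Rightarrow> real) \<Rightarrow> real^'d \<Rightarrow> real"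
  where "partial_deriv i g x = frechet_derivative g (at x) (axis i 1)"

text \<open>Pointwise twice differentiability in the sense of Frechet: the function is differentiable
  near the point and its gradient is differentiable at the point. No continuity of the second
  derivatives is required.\<close>

definition twice_differentiable_at :: "(real^'d \<Rightarrow> real) \<Rightarrow> real^'d \<Rightarrow> bool" where
  "twice_differentiable_at g x \<longleftrightarrow>
     (\<forall>\<^sub>F y in nhds x. g differentiable (at y)) \<and>
     (\<forall>j. partial_deriv j g differentiable (at x))"

definition mat_le :: "real^'d^'d \<Rightarrow> real^'d^'d \<Rightarrow> bool" where
  "mat_le A B \<longleftrightarrow> transpose A = A \<and> transpose B = B \<and>
     (\<forall>\<xi>. \<xi> \<bullet> (A *v \<xi>) \<le> \<xi> \<bullet> (B *v \<xi>))"

definition locally_uniformly_elliptic :: "(real \<Rightarrow> real^'d \<Rightarrow> real^'d^'d) \<Rightarrow> bool" where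
  "locally_uniformly_elliptic a \<longleftrightarrow>
     (\<forall>S. compact S \<and> S \<subseteq> {0..1} \<times> UNIV \<longrightarrow>
        (\<exists>l u. 0 < l \<and> l \<le> u \<and>
          (\<forall>(t, x) \<in> S. mat_le (l *\<^sub>R mat 1) (a t x) \<and> mat_le (a t x) (u *\<^sub>R mat 1))))"

text \<open>The differential inequality, at every point of \<open>[0,1] \<times> \<real>\<^sup>d\<close> where \<open>f > 0\<close>. The time
  derivative is one-sided at \<open>t = 0\<close> and \<open>t = 1\<close>. The norm is that of the positive part of
  \<open>f(t,\<cdot>)\<close>, which is \<open>f(t,\<cdot>)\<close> itself for nonnegative \<open>f\<close>: values of \<open>f\<close> at points where it is
  negative are otherwise unconstrained, and must not enter the growth rate.\<close>

definition satisfies_inequality ::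
    "(real \<Rightarrow> real^'d \<Rightarrow> real^'d^'d) \<Rightarrow> real \<Rightarrow> real \<Rightarrow> (real \<Rightarrow> real^'d \<Rightarrow> real) \<Rightarrow> bool" where
  "satisfies_inequality a C \<epsilon> f \<longleftrightarrow>
     (\<forall>t\<in>{0..1}. \<forall>x. f t x > 0 \<longrightarrow>
        twice_differentiable_at (f t) x \<and>
        (\<exists>f\<^sub>t. ((\<lambda>s. f s x) has_real_derivative f\<^sub>t) (at t within {0..1}) \<and>
           f\<^sub>t \<le> (\<Sum>i\<in>UNIV. \<Sum>j\<in>UNIV. a t x $ i $ j * partial_deriv i (partial_deriv j (f t)) x)
              + C * (Linf_norm (\<lambda>y. max 0 (f t y)) powr (2 / real CARD('d))
                      / ln (1 + Linf_norm (\<lambda>y. max 0 (f t y))) powr \<epsilon>) * f t x))"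

end

theory Submission
  imports Defs "HOL-Real_Asymp.Real_Asymp"
begin

text \<open>Put \<open>m(t) = K t powr (-d/2)\<close> and let \<open>t\<^sub>0\<close> be the first time at which \<open>f\<close> touches a barrier slightly
  below \<open>m\<close>, at the point \<open>x\<^sub>0\<close>. During a time comparable to \<open>t\<^sub>0\<close> the choice of \<open>T\<close> bounds the
  reaction rate by \<open>4 (1 + \<Lambda>) / t\<^sub>0\<close>. For \<open>y\<close> in a set \<open>Y\<close> around \<open>x\<^sub>0\<close>, of size \<open>sqrt t\<^sub>0 * (1 + |x\<^sub>0|) powr \<beta>\<close>,
  slide paraboloids with vertex \<open>y\<close> down on \<open>f t\<close>. Let \<open>p t y\<close> be the excess of
  the maximum of \<open>f t\<close> minus the paraboloid over a level that decreases in \<open>t\<close>, and let \<open>F t\<close> be the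
  integral of \<open>p t\<close> over \<open>Y\<close>. Then \<open>F\<close> vanishes at the initial time and is large at \<open>t\<^sub>0\<close>. At a
  contact point \<open>x\<close> at which the excess grows, the differential inequality and the arithmetic-geometric mean
  inequality, applied to \<open>a\<close> and \<open>I - D\<^sup>2f / (2A)\<close>, bound the Jacobian of the map \<open>x \<mapsto> y\<close> by a multiple of
  \<open>1 / det a\<close>, hence by a multiple of \<open>(1 + |x|) powr \<kappa> * f\<close> times a power of \<open>1 + |x|\<close> that is nearly
  constant on the contact set. By the area formula, the left difference quotients of \<open>F\<close> are controlled by
  the weighted mass \<open>N\<close>, which contradicts the choice of \<open>K\<close>.\<close>

section \<open>The matrix inequality of arithmetic and geometric means\<close>

text \<open>Space is not compact, so a point of exact touching need not exist. The estimate is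
  therefore run at every point where \<open>f\<close> comes within a relative distance
  \<open>s\<close> of the barrier. Its contradiction gives a gap uniform in \<open>x\<close>, and a
  maximum principle outside a ball carries the bound past that time. Second derivatives exist only
  pointwise and only where \<open>f\<close> is positive, so the excess is never differentiated: its
  integral is controlled through left difference quotients and a Borel cover of the vertices at
  which it may grow. The form of \<open>K\<close> comes from scaling. With
  \<open>q = (1 + |x0|) powr (-\<beta>)\<close> the Jacobian is at most a multiple of
  \<open>((1 + \<Lambda>) / q\<^sup>2) ^ d / det a\<close>, and the growth rate of the excess adds
  one more factor \<open>1 + \<Lambda>\<close>. The measure of \<open>Y\<close> is at least a
  dimensional multiple of \<open>(sqrt t0 / q) ^ d\<close>, and \<open>m * sqrt t0 ^ d = K\<close>,
  so \<open>t0\<close> and \<open>q\<close> drop out. The length of the time interval and the height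
  of the excess are proportional to the same small number \<open>E\<close>, which also cancels.
  Hence the variation of the barrier may be small without spoiling the constants.\<close>

lemma selfadjoint_eigenvector:
  fixes f :: "'a::euclidean_space \<Rightarrow> 'a"
  assumes f: "linear f" and sa: "\<And>x y. x \<bullet> f y = f x \<bullet> y"
    and S: "subspace S" "f ` S \<subseteq> S" "S \<noteq> {0}"
  obtains x l where "x \<in> S" "norm x = 1" "f x = l *\<^sub>R x"
proof -
  let ?K = "sphere 0 1 \<inter> S"
  obtain z where z: "z \<in> S" "z \<noteq> 0"
    using S subspace_0 by blast
  have "(1 / norm z) *\<^sub>R z \<in> ?K"
    using z S(1) by (auto simp: subspace_scale)
  then have ne: "?K \<noteq> {}" by blast
  have "compact ?K"
    by (intro compact_Int_closed compact_sphere closed_subspace S(1))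
  moreover have "continuous_on ?K (\<lambda>x. x \<bullet> f x)"
    using f by (intro continuous_on_inner continuous_on_id linear_continuous_on)
      (simp add: linear_conv_bounded_linear)
  \<comment> \<open>The eigenvector is a maximizer of the Rayleigh quotient on the unit sphere of
    \<open>S\<close>.\<close>
  ultimately obtain x where x: "x \<in> ?K" and mx: "\<And>y. y \<in> ?K \<Longrightarrow> y \<bullet> f y \<le> x \<bullet> f x"
    using continuous_attains_sup[OF _ ne] by blast
  define l where "l = x \<bullet> f x"
  have nx: "norm x = 1" and xS: "x \<in> S" using x by auto
  have xx: "x \<bullet> x = 1" using nx by (simp add: dot_square_norm)
  have ray: "y \<bullet> f y \<le> l * (norm y)\<^sup>2" if "y \<in> S" for y
  proof (cases "y = 0")
    case True
    then show ?thesis by simp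
  next
    case False
    have "(1 / norm y) *\<^sub>R y \<in> ?K"
      using that False S(1) by (auto simp: subspace_scale)
    from mx[OF this] have "((1 / norm y) *\<^sub>R y) \<bullet> f ((1 / norm y) *\<^sub>R y) \<le> l"
      by (simp add: l_def)
    then have "(y \<bullet> f y) / (norm y)\<^sup>2 \<le> l"
      by (simp add: linear_scale[OF f] power2_eq_square)
    then show ?thesis
      using False by (simp add: divide_le_eq)
  qed
  define v where "v = f x - l *\<^sub>R x"
  have vS: "v \<in> S"
    unfolding v_def using S xS by (auto intro!: subspace_diff subspace_scale)
  have xv: "x \<bullet> v = 0"
    by (simp add: v_def inner_diff_right l_def xx)
  have vf: "v \<bullet> f x = (norm v)\<^sup>2"
  proof -
    have "v \<bullet> f x = v \<bullet> (v + l *\<^sub>R x)" by (simp add: v_def)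
    then show ?thesis using xv by (simp add: inner_add_right inner_commute power2_norm_eq_inner)
  qed
  define c where "c = v \<bullet> f v - l * (norm v)\<^sup>2"
  \<comment> \<open>First variation in the direction of the residual \<open>v\<close>, which is
    orthogonal to \<open>x\<close>: the terms of order zero cancel, and for small positive
    \<open>s\<close> the linear term would win unless \<open>v = 0\<close>.\<close>
  have quad: "2 * s * (norm v)\<^sup>2 + s\<^sup>2 * c \<le> 0" for s
  proof -
    have "x + s *\<^sub>R v \<in> S" using xS vS S(1) by (simp add: subspace_add subspace_scale)
    from ray[OF this]
    have "(x + s *\<^sub>R v) \<bullet> f (x + s *\<^sub>R v) \<le> l * (norm (x + s *\<^sub>R v))\<^sup>2" .
    moreover have "(x + s *\<^sub>R v) \<bullet> f (x + s *\<^sub>R v) = l + 2 * s * (norm v)\<^sup>2 + s\<^sup>2 * (v \<bullet> f v)"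
      using vf sa[of x v]
      by (simp add: linear_add[OF f] linear_scale[OF f] inner_add_left inner_add_right l_def
          power2_eq_square inner_commute algebra_simps)
    moreover have "(norm (x + s *\<^sub>R v))\<^sup>2 = 1 + s\<^sup>2 * (norm v)\<^sup>2"
      using xv xx unfolding power2_norm_eq_inner
      by (simp add: inner_add_left inner_add_right inner_commute power2_eq_square)
    ultimately show ?thesis by (simp add: c_def algebra_simps)
  qed
  have "v = 0"
  proof (rule ccontr)
    assume "v \<noteq> 0"
    then have p: "(norm v)\<^sup>2 > 0" by simp
    define s where "s = (norm v)\<^sup>2 / (1 + \<bar>c\<bar>)"
    have s0: "s > 0" using p by (simp add: s_def)
    have "s * \<bar>c\<bar> \<le> (norm v)\<^sup>2"
      using p by (simp add: s_def field_simps)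
    then have "s * c \<ge> - ((norm v)\<^sup>2)"
      using s0 abs_ge_minus_self[of "s * c"] by (simp add: abs_mult)
    then have "2 * (norm v)\<^sup>2 + s * c > 0" using p by linarith
    then have "s * (2 * (norm v)\<^sup>2 + s * c) > 0" using s0 by simp
    then show False using quad[of s] by (simp add: algebra_simps power2_eq_square)
  qed
  then have "f x = l *\<^sub>R x" by (simp add: v_def)
  then show ?thesis using that xS nx by blast
qed

text \<open>Self-adjointness makes the orthogonal complement of an eigenvector invariant again. The
  spectral theorem is stated for invariant subspaces so that this complement can serve in the
  induction on the dimension.\<close>

lemma selfadjoint_eigenbasis_subspace:
  fixes f :: "'a::euclidean_space \<Rightarrow> 'a"
  assumes f: "linear f" and sa: "\<And>x y. x \<bullet> f y = f x \<bullet> y"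
    and "subspace S" "f ` S \<subseteq> S"
  shows "\<exists>B\<subseteq>S. pairwise orthogonal B \<and> (\<forall>x\<in>B. norm x = 1 \<and> (\<exists>l. f x = l *\<^sub>R x)) \<and> S \<subseteq> span B"
  using assms(3,4)
proof (induction "dim S" arbitrary: S rule: less_induct)
  case less
  show ?case
  proof (cases "S = {0}")
    case True
    then show ?thesis by (intro exI[of _ "{}"]) auto
  next
    case False
    obtain x l where x: "x \<in> S" "norm x = 1" "f x = l *\<^sub>R x"
      using selfadjoint_eigenvector[OF f sa less.prems False] by blast
    define S' where "S' = {y \<in> S. x \<bullet> y = 0}"
    have sub: "subspace S'"
      using less.prems(1) by (auto simp: S'_def subspace_def inner_add_right)
    have inv: "f ` S' \<subseteq> S'"
    proof (safe)
      fix y assume "y \<in> S'"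
      then have y: "y \<in> S" "x \<bullet> y = 0" by (auto simp: S'_def)
      have "x \<bullet> f y = 0" using sa[of x y] x(3) y(2) by simp
      then show "f y \<in> S'" using y less.prems(2) by (auto simp: S'_def)
    qed
    have "x \<notin> S'" using x(2) by (auto simp: S'_def)
    moreover have "S' \<subseteq> S" by (auto simp: S'_def)
    ultimately have "S' \<subset> S" using x(1) by blast
    then have "dim S' < dim S"
      using dim_psubset[of S' S] sub less.prems(1) by (metis span_eq_iff)
    from less.hyps[OF this sub inv] obtain B where
      B: "B \<subseteq> S'" "pairwise orthogonal B" "\<forall>x\<in>B. norm x = 1 \<and> (\<exists>l. f x = l *\<^sub>R x)" "S' \<subseteq> span B"
      by blast
    have "pairwise orthogonal (insert x B)"
      using B(1,2) by (auto simp: pairwise_insert orthogonal_def S'_def inner_commute)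
    moreover have "S \<subseteq> span (insert x B)"
    proof
      fix y assume y: "y \<in> S"
      have "x \<bullet> x = 1" using x(2) by (simp add: dot_square_norm)
      then have "y - (x \<bullet> y) *\<^sub>R x \<in> S'"
        using y x(1) less.prems(1)
        by (auto simp: S'_def inner_diff_right intro!: subspace_diff subspace_scale)
      then have "y - (x \<bullet> y) *\<^sub>R x \<in> span B" using B(4) by blast
      then show "y \<in> span (insert x B)"
        using span_breakdown_eq by blast
    qed
    moreover have "insert x B \<subseteq> S" using x(1) B(1) by (auto simp: S'_def)
    ultimately show ?thesis using B(3) x(2,3) by (intro exI[of _ "insert x B"]) auto
  qed
qed

section \<open>Diagonalization of symmetric matrices and determinant-trace inequalities\<close>

definition diag_mat :: "('n::finite \<Rightarrow> real) \<Rightarrow> real^'n^'n" where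
  "diag_mat l = (\<chi> i j. if i = j then l i else 0)"

lemma det_diag_mat: "det (diag_mat l) = (\<Prod>i\<in>UNIV. l i)"
  by (subst det_diagonal) (auto simp: diag_mat_def)

lemma trace_diag_mat: "trace (diag_mat l) = (\<Sum>i\<in>UNIV. l i)"
  by (simp add: trace_def diag_mat_def)

lemma diag_mat_mult: "diag_mat l ** diag_mat m = diag_mat (\<lambda>i. l i * m i)"
proof -
  have "(\<Sum>k\<in>UNIV. (if i = k then l i else 0) * (if k = j then m k else 0)) =
      (\<Sum>k\<in>UNIV. if k = i then (if i = j then l i * m i else 0) else 0)" for i j :: 'a
    by (rule sum.cong) auto
  then show ?thesis
    by (simp add: diag_mat_def matrix_matrix_mult_def vec_eq_iff)
qed

lemma transpose_diag_mat [simp]: "transpose (diag_mat l) = diag_mat l"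
  by (auto simp: diag_mat_def transpose_def vec_eq_iff)

lemma symmetric_matrix_diagonalization:
  fixes M :: "real^'n^'n"
  assumes "transpose M = M"
  obtains P :: "real^'n^'n" and l :: "'n \<Rightarrow> real"
  where "transpose P ** P = mat 1" "P ** transpose P = mat 1" "M = P ** diag_mat l ** transpose P"
proof -
  have "linear ((*v) M)" by simp
  moreover have "x \<bullet> (M *v y) = (M *v x) \<bullet> y" for x y
    using assms by (metis dot_lmul_matrix vector_transpose_matrix)
  ultimately obtain B where B: "pairwise orthogonal B"
    "\<forall>x\<in>B. norm x = 1 \<and> (\<exists>l. M *v x = l *\<^sub>R x)" "UNIV \<subseteq> span B"
    using selfadjoint_eigenbasis_subspace[of "(*v) M" UNIV] by auto
  have "0 \<notin> B" using B(2) by force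
  then have ind: "independent B" using B(1) pairwise_orthogonal_independent by blast
  have "card B = CARD('n)"
    using ind B(3) by (metis basis_card_eq_dim dim_UNIV DIM_cart DIM_real mult_1_right subset_UNIV)
  moreover have "finite B" using ind independent_imp_finite by blast
  ultimately obtain v :: "'n \<Rightarrow> real^'n" where v: "bij_betw v UNIV B"
    using finite_same_card_bij[of "UNIV::'n set" B] by auto
  have "\<forall>j. \<exists>l. M *v v j = l *\<^sub>R v j"
    using v B(2) by (auto simp: bij_betw_def)
  then obtain l where l: "\<And>j. M *v v j = l j *\<^sub>R v j" by metis
  define P where "P = (\<chi> i j. v j $ i)"
  have orth: "v i \<bullet> v j = (if i = j then 1 else 0)" for i j
  proof (cases "i = j")
    case True
    then show ?thesis using v B(2) by (auto simp: bij_betw_def norm_eq_1)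
  next
    case False
    then have "v i \<in> B" "v j \<in> B" "v i \<noteq> v j"
      using v by (auto simp: bij_betw_def inj_on_def)
    then show ?thesis using B(1) False by (auto simp: pairwise_def orthogonal_def)
  qed
  have PP: "transpose P ** P = mat 1"
    using orth by (simp add: P_def transpose_def matrix_matrix_mult_def vec_eq_iff mat_def inner_vec_def)
  then have PP': "P ** transpose P = mat 1" using matrix_left_right_inverse by blast
  have "M ** P = P ** diag_mat l"
  proof -
    have "(M ** P) $ i $ j = (P ** diag_mat l) $ i $ j" for i j
    proof -
      have "(M ** P) $ i $ j = (M *v v j) $ i"
        by (simp add: P_def matrix_matrix_mult_def matrix_vector_mult_def)
      also have "\<dots> = (P ** diag_mat l) $ i $ j"
      proof -
        have "(\<Sum>k\<in>UNIV. v k $ i * (if k = j then l k else 0)) = (\<Sum>k\<in>UNIV. if k = j then l j * v j $ i else 0)"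
          by (rule sum.cong) auto
        then show ?thesis by (simp add: l P_def diag_mat_def matrix_matrix_mult_def)
      qed
      finally show ?thesis .
    qed
    then show ?thesis by (simp add: vec_eq_iff)
  qed
  then have "M ** (P ** transpose P) = P ** diag_mat l ** transpose P"
    by (simp add: matrix_mul_assoc)
  then have "M = P ** diag_mat l ** transpose P" by (simp add: PP')
  then show ?thesis using that PP PP' by blast
qed

lemma diagonalization_eigenvalue:
  fixes P :: "real^'n^'n"
  assumes "transpose P ** P = mat 1" "M = P ** diag_mat l ** transpose P"
  shows "(P *v axis i 1) \<bullet> (M *v (P *v axis i 1)) = l i"
proof -
  have "M *v (P *v axis i 1) = P *v (diag_mat l *v ((transpose P ** P) *v axis i 1))"
    unfolding assms(2) by (simp add: matrix_vector_mul_assoc matrix_mul_assoc)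
  also have "\<dots> = P *v (diag_mat l *v axis i 1)" by (simp add: assms(1))
  finally have "(P *v axis i 1) \<bullet> (M *v (P *v axis i 1)) =
      ((transpose P ** P) *v axis i 1) \<bullet> (diag_mat l *v axis i 1)"
    by (metis dot_lmul_matrix matrix_vector_mul_assoc vector_transpose_matrix transpose_transpose)
  also have "\<dots> = axis i 1 \<bullet> (diag_mat l *v axis i 1)" by (simp add: assms(1))
  also have "\<dots> = l i"
    by (simp add: diag_mat_def inner_axis' matrix_vector_mult_basis column_def)
  finally show ?thesis .
qed

lemma powr_inverse_power:
  fixes x :: real
  assumes "0 \<le> x" "0 < n"
  shows "(x powr (1 / real n)) ^ n = x"
proof (cases "x = 0")
  case True
  then show ?thesis using assms by simp
next
  case False
  then show ?thesis using assms by (simp add: powr_realpow[symmetric] powr_powr)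
qed

text \<open>Determinant and trace are the product and the sum of the eigenvalues, which are
  nonnegative here, so this is the inequality of arithmetic and geometric means for the
  eigenvalues.\<close>

lemma det_le_trace_power:
  fixes M :: "real^'n^'n"
  assumes "transpose M = M" "\<And>x. 0 \<le> x \<bullet> (M *v x)"
  shows "det M \<le> (trace M / real CARD('n)) ^ CARD('n)" "0 \<le> trace M" "0 \<le> det M"
proof -
  obtain P :: "real^'n^'n" and l where P: "transpose P ** P = mat 1" "P ** transpose P = mat 1" "M = P ** diag_mat l ** transpose P"
    by (rule symmetric_matrix_diagonalization[OF assms(1)])
  have l0: "l i \<ge> 0" for i
    using diagonalization_eigenvalue[OF P(1,3)] assms(2) by metis
  have "trace M = trace (transpose P ** (P ** diag_mat l))"
    unfolding P(3) by (rule trace_mul_sym)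
  then have tr: "trace M = (\<Sum>i\<in>UNIV. l i)"
    by (simp add: matrix_mul_assoc P(1) trace_diag_mat)
  have "det M = det (transpose P ** P) * det (diag_mat l)"
    unfolding P(3) by (simp add: det_mul)
  then have dt: "det M = (\<Prod>i\<in>UNIV. l i)" by (simp add: P(1) det_diag_mat)
  show "0 \<le> trace M" unfolding tr by (simp add: l0 sum_nonneg)
  show "0 \<le> det M" unfolding dt by (simp add: l0 prod_nonneg)
  let ?n = "real CARD('n)"
  have p0: "0 \<le> (\<Prod>i\<in>UNIV. l i)" by (simp add: l0 prod_nonneg)
  have "(\<Prod>i\<in>UNIV. l i) powr (1 / ?n) \<le> trace M / ?n"
    using arith_geom_mean[of "UNIV::'n set" l] l0 by (simp add: tr sum_divide_distrib)
  then have "((\<Prod>i\<in>UNIV. l i) powr (1 / ?n)) ^ CARD('n) \<le> (trace M / ?n) ^ CARD('n)"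
    by (intro power_mono) auto
  moreover have "((\<Prod>i\<in>UNIV. l i) powr (1 / ?n)) ^ CARD('n) = (\<Prod>i\<in>UNIV. l i)"
    using p0 by (rule powr_inverse_power) simp
  ultimately show "det M \<le> (trace M / ?n) ^ CARD('n)" by (simp add: dt)
qed

text \<open>The product \<open>a ** B\<close> need not be symmetric. Writing
  \<open>a = R ** transpose R\<close>, the matrix \<open>transpose R ** B ** R\<close> is symmetric
  and positive semidefinite and has the trace and the determinant of \<open>a ** B\<close>, so the
  case of one matrix applies.\<close>

lemma trace_det_psd:
  fixes a B :: "real^'n^'n"
  assumes a: "transpose a = a" "\<And>x. 0 \<le> x \<bullet> (a *v x)"
    and B: "transpose B = B" "\<And>x. 0 \<le> x \<bullet> (B *v x)"
  shows "det a * det B \<le> (trace (a ** B) / real CARD('n)) ^ CARD('n)" "0 \<le> trace (a ** B)"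
proof -
  obtain P :: "real^'n^'n" and l where P: "transpose P ** P = mat 1" "P ** transpose P = mat 1" "a = P ** diag_mat l ** transpose P"
    by (rule symmetric_matrix_diagonalization[OF a(1)])
  have l0: "l i \<ge> 0" for i
    using diagonalization_eigenvalue[OF P(1,3)] a(2) by metis
  define R where "R = P ** diag_mat (\<lambda>i. sqrt (l i))"
  have RR: "R ** transpose R = a"
  proof -
    have "R ** transpose R = P ** (diag_mat (\<lambda>i. sqrt (l i)) ** diag_mat (\<lambda>i. sqrt (l i))) ** transpose P"
      by (simp add: R_def matrix_transpose_mul matrix_mul_assoc)
    then show ?thesis by (simp add: diag_mat_mult l0 P(3))
  qed
  define M where "M = transpose R ** B ** R"
  have "transpose M = M"
    by (simp add: M_def matrix_transpose_mul B(1) matrix_mul_assoc)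
  moreover have "0 \<le> x \<bullet> (M *v x)" for x
  proof -
    have "x \<bullet> (M *v x) = (R *v x) \<bullet> (B *v (R *v x))"
      unfolding M_def
      by (metis dot_lmul_matrix matrix_vector_mul_assoc vector_transpose_matrix transpose_transpose)
    then show ?thesis using B(2) by simp
  qed
  ultimately have *: "det M \<le> (trace M / real CARD('n)) ^ CARD('n)" "0 \<le> trace M"
    using det_le_trace_power by blast+
  have "trace M = trace (R ** (transpose R ** B))"
    unfolding M_def by (rule trace_mul_sym)
  then have "trace M = trace (a ** B)" by (simp add: matrix_mul_assoc RR)
  moreover have "det M = det (R ** transpose R) * det B"
    by (simp add: M_def det_mul)
  then have "det M = det a * det B" by (simp add: RR)
  ultimately show "det a * det B \<le> (trace (a ** B) / real CARD('n)) ^ CARD('n)" "0 \<le> trace (a ** B)"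
    using * by simp_all
qed

section \<open>Pointwise second derivatives\<close>

definition grad :: "(real^'n \<Rightarrow> real) \<Rightarrow> real^'n \<Rightarrow> real^'n" where
  "grad g x = (\<chi> j. partial_deriv j g x)"

text \<open>Row \<open>i\<close> is the outer derivative, in the order of the differential
  inequality. The Frechet derivative of \<open>grad\<close> is therefore the transpose, until
  \<open>hess_symmetric\<close> removes the distinction.\<close>

definition hess :: "(real^'n \<Rightarrow> real) \<Rightarrow> real^'n \<Rightarrow> real^'n^'n" where
  "hess g x = (\<chi> i j. partial_deriv i (partial_deriv j g) x)"

lemma has_derivative_grad:
  assumes "g differentiable (at x)"
  shows "(g has_derivative (\<lambda>h. grad g x \<bullet> h)) (at x)"
proof -
  let ?D = "frechet_derivative g (at x)"
  have D: "(g has_derivative ?D) (at x)" using assms frechet_derivative_works by blast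
  then have lin: "linear ?D" by (rule has_derivative_linear)
  have "?D h = grad g x \<bullet> h" for h
  proof -
    have "?D h = ?D (\<Sum>j\<in>UNIV. h $ j *\<^sub>R axis j 1)"
      by (simp add: basis_expansion scalar_mult_eq_scaleR[symmetric])
    also have "\<dots> = (\<Sum>j\<in>UNIV. h $ j * ?D (axis j 1))"
      by (simp add: linear_sum[OF lin] linear_scale[OF lin])
    also have "\<dots> = grad g x \<bullet> h"
      by (simp add: grad_def inner_vec_def partial_deriv_def mult.commute)
    finally show ?thesis .
  qed
  then have "?D = (\<lambda>h. grad g x \<bullet> h)" by blast
  then show ?thesis using D by simp
qed

lemma has_derivative_grad_hess:
  assumes "twice_differentiable_at g x"
  shows "(grad g has_derivative (\<lambda>h. transpose (hess g x) *v h)) (at x)"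
proof -
  have "((\<lambda>y. grad g y $ j) has_derivative (\<lambda>h. (transpose (hess g x) *v h) $ j)) (at x)" for j
  proof -
    have "partial_deriv j g differentiable (at x)"
      using assms by (simp add: twice_differentiable_at_def)
    from has_derivative_grad[OF this]
    show ?thesis
      by (simp add: grad_def hess_def transpose_def matrix_vector_mult_def inner_vec_def)
  qed
  then show ?thesis
    by (subst has_derivative_componentwise_within)
      (auto simp: Basis_vec_def inner_axis)
qed

lemma eventually_has_derivative_grad:
  assumes "twice_differentiable_at g x"
  shows "\<forall>\<^sub>F y in nhds x. (g has_derivative (\<lambda>h. grad g y \<bullet> h)) (at y)"
proof -
  have "\<forall>\<^sub>F y in nhds x. g differentiable (at y)"
    using assms by (simp add: twice_differentiable_at_def)
  then show ?thesis by (rule eventually_mono) (rule has_derivative_grad)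
qed

text \<open>The mean value theorem for \<open>r \<mapsto> g (x + r u + s v) - g (x + r u)\<close>
  turns the second difference into a difference of gradients near \<open>x\<close>.
  Differentiability of the gradient at the single point \<open>x\<close> controls it, so continuity
  of the second derivatives does not enter.\<close>

lemma second_difference:
  fixes g :: "'a::euclidean_space \<Rightarrow> real" and G :: "'a \<Rightarrow> 'a"
  assumes g: "\<forall>\<^sub>F y in nhds x. (g has_derivative (\<lambda>h. G y \<bullet> h)) (at y)"
    and G: "(G has_derivative L) (at x)" and e: "e > 0"
  shows "\<exists>\<delta>>0. \<forall>s. 0 < s \<and> s < \<delta> \<longrightarrow>
    \<bar>(g (x + s *\<^sub>R u + s *\<^sub>R v) - g (x + s *\<^sub>R u) - g (x + s *\<^sub>R v) + g x) / s\<^sup>2 - u \<bullet> L v\<bar>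
      \<le> e * (2 * norm u + norm v) * norm u"
proof -
  have linL: "linear L" using G by (rule has_derivative_linear)
  obtain d1 where d1: "d1 > 0" "\<And>y. dist y x < d1 \<Longrightarrow> (g has_derivative (\<lambda>h. G y \<bullet> h)) (at y)"
    using g unfolding eventually_nhds_metric by blast
  obtain d2 where d2: "d2 > 0" "\<And>y. norm (y - x) < d2 \<Longrightarrow> norm (G y - G x - L (y - x)) \<le> e * norm (y - x)"
    using G e unfolding has_derivative_at_alt by blast
  define d where "d = min d1 d2 / (1 + norm u + norm v)"
  have n0: "1 + norm u + norm v > 0" by (smt (verit) norm_ge_zero)
  have d0: "d > 0" using d1 d2 n0 by (simp add: d_def)
  show ?thesis
  proof (intro exI[of _ d] conjI allI impI d0)
    fix s assume s: "0 < s \<and> s < d"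
    have sm: "norm (r *\<^sub>R u + q *\<^sub>R v) < min d1 d2" if "0 \<le> r" "r \<le> s" "0 \<le> q" "q \<le> s" for r q
    proof -
      have "norm (r *\<^sub>R u + q *\<^sub>R v) \<le> r * norm u + q * norm v"
        using norm_triangle_ineq[of "r *\<^sub>R u" "q *\<^sub>R v"] that by simp
      also have "\<dots> \<le> s * norm u + s * norm v"
        using that by (intro add_mono mult_right_mono) auto
      also have "\<dots> \<le> s * (1 + norm u + norm v)" using s by (simp add: algebra_simps)
      also have "\<dots> < d * (1 + norm u + norm v)" using s n0 by (intro mult_strict_right_mono) auto
      also have "\<dots> = min d1 d2" using n0 by (simp add: d_def)
      finally show ?thesis .
    qed
    define \<phi> where "\<phi> r = g (x + (r *\<^sub>R u + s *\<^sub>R v)) - g (x + (r *\<^sub>R u + 0 *\<^sub>R v))" for r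
    have der: "(\<phi> has_real_derivative
        ((G (x + (r *\<^sub>R u + s *\<^sub>R v)) - G (x + (r *\<^sub>R u + 0 *\<^sub>R v))) \<bullet> u)) (at r)" if "0 \<le> r" "r \<le> s" for r
    proof -
      have *: "((\<lambda>r. g (x + (r *\<^sub>R u + q *\<^sub>R v))) has_derivative (\<lambda>h. h * (G (x + (r *\<^sub>R u + q *\<^sub>R v)) \<bullet> u))) (at r)"
        if q: "0 \<le> q" "q \<le> s" for q
      proof -
        have "dist (x + (r *\<^sub>R u + q *\<^sub>R v)) x < d1"
          using sm[OF \<open>0 \<le> r\<close> \<open>r \<le> s\<close> q] by (simp add: dist_norm)
        from d1(2)[OF this]
        have "((\<lambda>r. g (x + (r *\<^sub>R u + q *\<^sub>R v))) has_derivative (\<lambda>h. G (x + (r *\<^sub>R u + q *\<^sub>R v)) \<bullet> (h *\<^sub>R u))) (at r)"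
          by (rule has_derivative_compose[rotated]) (auto intro!: derivative_eq_intros)
        then show ?thesis by simp
      qed
      show ?thesis
        unfolding \<phi>_def has_field_derivative_def
        by (rule has_derivative_eq_rhs[OF has_derivative_diff[OF *[of s] *[of 0]]])
          (use s in \<open>auto simp: inner_diff_left algebra_simps\<close>)
    qed
    obtain r where r: "0 < r" "r < s" and
      eq: "\<phi> s - \<phi> 0 = (s - 0) * ((G (x + (r *\<^sub>R u + s *\<^sub>R v)) - G (x + (r *\<^sub>R u + 0 *\<^sub>R v))) \<bullet> u)"
      using MVT2[of 0 s \<phi> "\<lambda>r. (G (x + (r *\<^sub>R u + s *\<^sub>R v)) - G (x + (r *\<^sub>R u + 0 *\<^sub>R v))) \<bullet> u"] s der by blast
    let ?w1 = "r *\<^sub>R u + s *\<^sub>R v" and ?w2 = "r *\<^sub>R u + 0 *\<^sub>R v"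
    have b1: "norm (G (x + ?w1) - G x - L ?w1) \<le> e * (s * (norm u + norm v))"
    proof -
      have "norm (G (x + ?w1) - G x - L ?w1) \<le> e * norm ?w1"
        using d2(2)[of "x + ?w1"] sm[of r s] r by simp
      also have "norm ?w1 \<le> r * norm u + s * norm v"
        using norm_triangle_ineq[of "r *\<^sub>R u" "s *\<^sub>R v"] r by simp
      also have "r * norm u \<le> s * norm u" using r by (intro mult_right_mono) auto
      finally show ?thesis using e by (simp add: algebra_simps)
    qed
    have b2: "norm (G (x + ?w2) - G x - L ?w2) \<le> e * (s * norm u)"
    proof -
      have "norm (G (x + ?w2) - G x - L ?w2) \<le> e * norm ?w2"
        using d2(2)[of "x + ?w2"] sm[of r 0] r by simp
      also have "norm ?w2 \<le> s * norm u"
        using r by (simp add: mult_right_mono)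
      finally show ?thesis using e by (simp add: algebra_simps)
    qed
    have Lw: "L ?w1 - L ?w2 = s *\<^sub>R L v"
      by (simp add: linear_add[OF linL] linear_scale[OF linL])
    have "norm (G (x + ?w1) - G (x + ?w2) - s *\<^sub>R L v) \<le> e * (s * (norm u + norm v)) + e * (s * norm u)"
    proof -
      have "G (x + ?w1) - G (x + ?w2) - s *\<^sub>R L v =
         (G (x + ?w1) - G x - L ?w1) - (G (x + ?w2) - G x - L ?w2)"
        unfolding Lw[symmetric] by simp
      moreover have "norm ((G (x + ?w1) - G x - L ?w1) - (G (x + ?w2) - G x - L ?w2))
          \<le> e * (s * (norm u + norm v)) + e * (s * norm u)"
        by (rule order_trans[OF norm_triangle_ineq4 add_mono[OF b1 b2]])
      ultimately show ?thesis by (simp only:)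
    qed
    then have b3: "norm (G (x + ?w1) - G (x + ?w2) - s *\<^sub>R L v) \<le> s * (e * (2 * norm u + norm v))"
      by (simp add: algebra_simps)
    have "\<phi> s - \<phi> 0 - s\<^sup>2 * (u \<bullet> L v) = s * ((G (x + ?w1) - G (x + ?w2) - s *\<^sub>R L v) \<bullet> u)"
      using eq by (simp add: inner_diff_left inner_commute power2_eq_square algebra_simps)
    then have "\<bar>\<phi> s - \<phi> 0 - s\<^sup>2 * (u \<bullet> L v)\<bar> \<le> s * (norm (G (x + ?w1) - G (x + ?w2) - s *\<^sub>R L v) * norm u)"
      using s Cauchy_Schwarz_ineq2[of "G (x + ?w1) - G (x + ?w2) - s *\<^sub>R L v" u] by (simp add: abs_mult)
    also have "\<dots> \<le> s * (s * (e * (2 * norm u + norm v)) * norm u)"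
      using b3 s by (intro mult_left_mono mult_right_mono) auto
    finally have "\<bar>\<phi> s - \<phi> 0 - s\<^sup>2 * (u \<bullet> L v)\<bar> \<le> s\<^sup>2 * (e * (2 * norm u + norm v) * norm u)"
      by (simp add: power2_eq_square algebra_simps)
    moreover have "(\<phi> s - \<phi> 0) / s\<^sup>2 - u \<bullet> L v = (\<phi> s - \<phi> 0 - s\<^sup>2 * (u \<bullet> L v)) / s\<^sup>2"
      using s by (simp add: field_simps)
    ultimately have "\<bar>(\<phi> s - \<phi> 0) / s\<^sup>2 - u \<bullet> L v\<bar> \<le> e * (2 * norm u + norm v) * norm u"
      using s by (simp add: divide_le_eq mult.commute)
    moreover have "\<phi> s - \<phi> 0 = g (x + s *\<^sub>R u + s *\<^sub>R v) - g (x + s *\<^sub>R u) - g (x + s *\<^sub>R v) + g x"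
      by (simp add: \<phi>_def add.assoc)
    ultimately show "\<bar>(g (x + s *\<^sub>R u + s *\<^sub>R v) - g (x + s *\<^sub>R u) - g (x + s *\<^sub>R v) + g x) / s\<^sup>2 - u \<bullet> L v\<bar>
      \<le> e * (2 * norm u + norm v) * norm u" by simp
  qed
qed

text \<open>The second difference quotient is symmetric in \<open>u\<close> and \<open>v\<close>,
  and both mixed derivatives are its limit as \<open>s\<close> tends to 0.\<close>

lemma second_derivative_symmetric:
  fixes g :: "'a::euclidean_space \<Rightarrow> real" and G :: "'a \<Rightarrow> 'a"
  assumes g: "\<forall>\<^sub>F y in nhds x. (g has_derivative (\<lambda>h. G y \<bullet> h)) (at y)"
    and G: "(G has_derivative L) (at x)"
  shows "u \<bullet> L v = v \<bullet> L u"
proof -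
  define c where "c = (2 * norm u + norm v) * norm u + (2 * norm v + norm u) * norm v"
  have "\<bar>u \<bullet> L v - v \<bullet> L u\<bar> \<le> 0 + e" if e: "e > 0" for e
  proof -
    define e' where "e' = e / (1 + c)"
    have c0: "c \<ge> 0" by (simp add: c_def)
    have e': "e' > 0" using e c0 by (simp add: e'_def)
    obtain d1 where d1: "d1 > 0" "\<forall>s. 0 < s \<and> s < d1 \<longrightarrow>
     \<bar>(g (x + s *\<^sub>R u + s *\<^sub>R v) - g (x + s *\<^sub>R u) - g (x + s *\<^sub>R v) + g x) / s\<^sup>2 - u \<bullet> L v\<bar>
      \<le> e' * (2 * norm u + norm v) * norm u"
      using second_difference[OF g G e'] by blast
    obtain d2 where d2: "d2 > 0" "\<forall>s. 0 < s \<and> s < d2 \<longrightarrow>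
     \<bar>(g (x + s *\<^sub>R v + s *\<^sub>R u) - g (x + s *\<^sub>R v) - g (x + s *\<^sub>R u) + g x) / s\<^sup>2 - v \<bullet> L u\<bar>
      \<le> e' * (2 * norm v + norm u) * norm v"
      using second_difference[OF g G e'] by blast
    define s where "s = min d1 d2 / 2"
    have s: "0 < s" "s < d1" "s < d2" using d1(1) d2(1) by (auto simp: s_def)
    define D where "D = (g (x + s *\<^sub>R u + s *\<^sub>R v) - g (x + s *\<^sub>R u) - g (x + s *\<^sub>R v) + g x) / s\<^sup>2"
    have "\<bar>D - u \<bullet> L v\<bar> \<le> e' * (2 * norm u + norm v) * norm u"
      using d1(2) s by (simp add: D_def)
    moreover have "\<bar>D - v \<bullet> L u\<bar> \<le> e' * (2 * norm v + norm u) * norm v"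
      using d2(2)[rule_format, of s] s by (simp add: D_def algebra_simps)
    ultimately have "\<bar>u \<bullet> L v - v \<bullet> L u\<bar> \<le> e' * (2 * norm u + norm v) * norm u + e' * (2 * norm v + norm u) * norm v"
      by linarith
    also have "\<dots> = e' * c" by (simp add: c_def algebra_simps)
    also have "\<dots> \<le> e" using e c0 by (simp add: e'_def field_simps)
    finally show ?thesis by simp
  qed
  then have "\<bar>u \<bullet> L v - v \<bullet> L u\<bar> \<le> 0" by (rule field_le_epsilon)
  then show ?thesis by simp
qed

lemma hess_symmetric:
  assumes "twice_differentiable_at g x"
  shows "transpose (hess g x) = hess g x"
proof -
  have "axis i 1 \<bullet> (transpose (hess g x) *v axis j 1) = axis j 1 \<bullet> (transpose (hess g x) *v axis i 1)" for i j
    by (rule second_derivative_symmetric[OF eventually_has_derivative_grad[OF assms] has_derivative_grad_hess[OF assms]])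
  then have "hess g x $ j $ i = hess g x $ i $ j" for i j
    by (simp add: matrix_vector_mult_basis inner_axis' column_def transpose_def)
  then show ?thesis by (simp add: vec_eq_iff transpose_def)
qed

text \<open>The first-order condition recovers the vertex \<open>y\<close> from the gradient, which
  defines the map from contact points to vertices. The second-order condition makes
  \<open>I - hess / (2A)\<close>, the derivative of that map, positive semidefinite.\<close>

lemma touching_paraboloid:
  fixes g :: "real^'n \<Rightarrow> real"
  assumes g: "twice_differentiable_at g x"
    and mx: "\<forall>\<^sub>F z in nhds x. g z - A * (norm (z - y))\<^sup>2 \<le> g x - A * (norm (x - y))\<^sup>2"
  shows "grad g x = (2 * A) *\<^sub>R (x - y)" "\<xi> \<bullet> (hess g x *v \<xi>) \<le> 2 * A * (\<xi> \<bullet> \<xi>)"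
proof -
  define q where "q z = g z - A * (norm (z - y))\<^sup>2" for z
  define Q where "Q z = grad g z - (2 * A) *\<^sub>R (z - y)" for z
  define L where "L h = transpose (hess g x) *v h - (2 * A) *\<^sub>R h" for h
  have qd: "(q has_derivative (\<lambda>h. Q z \<bullet> h)) (at z)"
    if "(g has_derivative (\<lambda>h. grad g z \<bullet> h)) (at z)" for z
    unfolding q_def power2_norm_eq_inner
    by (rule derivative_eq_intros that refl)+
      (auto simp: Q_def inner_diff_left inner_diff_right inner_commute algebra_simps)
  have ev: "\<forall>\<^sub>F z in nhds x. (q has_derivative (\<lambda>h. Q z \<bullet> h)) (at z)"
    using eventually_has_derivative_grad[OF g] by eventually_elim (rule qd)
  have QL: "(Q has_derivative L) (at x)"
    unfolding Q_def L_def
    by (rule has_derivative_eq_rhs[OF has_derivative_diff[OF has_derivative_grad_hess[OF g]]])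
      (auto intro!: derivative_eq_intros)
  obtain d where d: "d > 0" "\<And>z. dist z x < d \<Longrightarrow> (q has_derivative (\<lambda>h. Q z \<bullet> h)) (at z) \<and> q z \<le> q x"
    using eventually_conj[OF ev mx] unfolding eventually_nhds_metric q_def by blast
  have "(\<lambda>h. Q x \<bullet> h) = (\<lambda>h. 0)"
    by (rule differential_zero_maxmin[of x "ball x d" q]) (use d in \<open>auto simp: dist_commute\<close>)
  then have "Q x \<bullet> Q x = 0" by metis
  then have Q0: "Q x = 0" by simp
  then show "grad g x = (2 * A) *\<^sub>R (x - y)" by (simp add: Q_def)
  \<comment> \<open>Without a Taylor formula: if the quantity were positive, the derivative of
    \<open>q\<close> along \<xi>, which vanishes at \<open>x\<close>, would be positive just beyond
    \<open>x\<close>, and the mean value theorem would make \<open>q\<close> exceed its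
    maximum.\<close>
  have "\<xi> \<bullet> L \<xi> \<le> 0"
  proof (rule ccontr)
    assume pos: "\<not> \<xi> \<bullet> L \<xi> \<le> 0"
    have linL: "linear L" using QL by (rule has_derivative_linear)
    have nz: "\<xi> \<noteq> 0" using pos linear_0[OF linL] by auto
    have comp: "((\<lambda>s. x + s *\<^sub>R \<xi>) has_derivative (\<lambda>h. h *\<^sub>R \<xi>)) (at s)" for s
      by (auto intro!: derivative_eq_intros)
    have d1: "((\<lambda>s. q (x + s *\<^sub>R \<xi>)) has_real_derivative Q (x + s *\<^sub>R \<xi>) \<bullet> \<xi>) (at s)"
      if "\<bar>s\<bar> * norm \<xi> < d" for s
    proof -
      have "(q has_derivative (\<lambda>h. Q (x + s *\<^sub>R \<xi>) \<bullet> h)) (at (x + s *\<^sub>R \<xi>))"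
        using d(2) that by (simp add: dist_norm)
      from has_derivative_compose[OF comp this]
      have "((\<lambda>s. q (x + s *\<^sub>R \<xi>)) has_derivative (\<lambda>h. Q (x + s *\<^sub>R \<xi>) \<bullet> (h *\<^sub>R \<xi>))) (at s)" .
      then show ?thesis unfolding has_field_derivative_def
        by (rule has_derivative_eq_rhs) auto
    qed
    have "((\<lambda>s. Q (x + s *\<^sub>R \<xi>)) has_derivative (\<lambda>h. L (h *\<^sub>R \<xi>))) (at 0)"
      by (rule has_derivative_compose[OF comp]) (use QL in simp)
    then have "((\<lambda>s. Q (x + s *\<^sub>R \<xi>) \<bullet> \<xi>) has_derivative (\<lambda>h. L (h *\<^sub>R \<xi>) \<bullet> \<xi>)) (at 0)"
      by (rule has_derivative_inner_left)
    then have d2: "((\<lambda>s. Q (x + s *\<^sub>R \<xi>) \<bullet> \<xi>) has_real_derivative \<xi> \<bullet> L \<xi>) (at 0)"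
      unfolding has_field_derivative_def
      by (rule has_derivative_eq_rhs) (auto simp: linear_scale[OF linL] inner_commute)
    obtain e where e: "e > 0" "\<And>h. 0 < h \<Longrightarrow> h < e \<Longrightarrow> Q (x + 0 *\<^sub>R \<xi>) \<bullet> \<xi> < Q (x + h *\<^sub>R \<xi>) \<bullet> \<xi>"
      using DERIV_pos_inc_right[OF d2] pos by auto
    have "min e (d / norm \<xi>) > 0" using e(1) d(1) nz by simp
    then obtain s where s: "0 < s" "s < e" "s < d / norm \<xi>"
      using dense[of 0 "min e (d / norm \<xi>)"] by auto
    then have sd: "s * norm \<xi> < d" using nz by (simp add: field_simps)
    have der: "((\<lambda>s. q (x + s *\<^sub>R \<xi>)) has_real_derivative Q (x + r *\<^sub>R \<xi>) \<bullet> \<xi>) (at r)" if "0 \<le> r" "r \<le> s" for r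
    proof (rule d1)
      have "r * norm \<xi> \<le> s * norm \<xi>" using that by (intro mult_right_mono) auto
      then show "\<bar>r\<bar> * norm \<xi> < d" using sd that by simp
    qed
    obtain r where r: "0 < r" "r < s" "q (x + s *\<^sub>R \<xi>) - q (x + 0 *\<^sub>R \<xi>) = (s - 0) * (Q (x + r *\<^sub>R \<xi>) \<bullet> \<xi>)"
      using MVT2[of 0 s "\<lambda>s. q (x + s *\<^sub>R \<xi>)" "\<lambda>s. Q (x + s *\<^sub>R \<xi>) \<bullet> \<xi>"] s(1) der by blast
    have "Q (x + r *\<^sub>R \<xi>) \<bullet> \<xi> > 0" using e(2)[of r] r s Q0 by simp
    then have "q (x + s *\<^sub>R \<xi>) > q x" using r s(1)
      by (metis add.right_neutral diff_gt_0_iff_gt diff_zero mult_pos_pos scaleR_zero_left)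
    moreover have "q (x + s *\<^sub>R \<xi>) \<le> q x" using d(2)[of "x + s *\<^sub>R \<xi>"] sd s(1) by (simp add: dist_norm)
    ultimately show False by simp
  qed
  then show "\<xi> \<bullet> (hess g x *v \<xi>) \<le> 2 * A * (\<xi> \<bullet> \<xi>)"
    by (simp add: L_def hess_symmetric[OF g] inner_diff_right)
qed

section \<open>The area formula\<close>

text \<open>The area formula of the library needs a well-ordered index type. Every finite type is
  in bijection with such a type.\<close>

typedef 'a ordered_copy = "UNIV :: 'a set" by simp

lemma bij_Rep_ordered_copy: "bij (Rep_ordered_copy :: 'a ordered_copy \<Rightarrow> 'a)"
  by (metis Abs_ordered_copy_inverse Rep_ordered_copy_inverse UNIV_I o_bij comp_apply
      eq_id_iff)

instance ordered_copy :: (finite) finite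
proof
  show "finite (UNIV :: 'a ordered_copy set)"
    using bij_Rep_ordered_copy[where 'a='a] finite bij_betw_finite by blast
qed

definition copy_index :: "'a::finite ordered_copy \<Rightarrow> nat" where
  "copy_index = (SOME h. inj h)"

lemma inj_copy_index: "inj (copy_index :: 'a::finite ordered_copy \<Rightarrow> nat)"
proof -
  have "\<exists>h :: 'a ordered_copy \<Rightarrow> nat. inj h"
    using finite_imp_inj_to_nat_seg[of "UNIV :: 'a ordered_copy set"] by auto
  then show ?thesis unfolding copy_index_def by (rule someI_ex)
qed

instantiation ordered_copy :: (finite) wellorder
begin

definition less_eq_ordered_copy where "x \<le> y \<longleftrightarrow> copy_index x \<le> copy_index (y :: 'a ordered_copy)"
definition less_ordered_copy where "x < y \<longleftrightarrow> copy_index x < copy_index (y :: 'a ordered_copy)"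

instance
proof
  fix x y z :: "'a ordered_copy"
  show "x < y \<longleftrightarrow> x \<le> y \<and> \<not> y \<le> x"
    by (auto simp: less_eq_ordered_copy_def less_ordered_copy_def)
  show "x \<le> x" by (simp add: less_eq_ordered_copy_def)
  show "x \<le> y \<Longrightarrow> y \<le> z \<Longrightarrow> x \<le> z" by (simp add: less_eq_ordered_copy_def)
  show "x \<le> y \<Longrightarrow> y \<le> x \<Longrightarrow> x = y"
    using inj_copy_index by (auto simp: less_eq_ordered_copy_def inj_def)
  show "x \<le> y \<or> y \<le> x" by (auto simp: less_eq_ordered_copy_def)
next
  fix P :: "'a ordered_copy \<Rightarrow> bool" and a :: "'a ordered_copy"
  assume step: "\<And>x. (\<And>y. y < x \<Longrightarrow> P y) \<Longrightarrow> P x"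
  show "P a"
    using step by (induction "copy_index a" arbitrary: a rule: less_induct) (metis less_ordered_copy_def)
qed

end

section \<open>Lebesgue measure, determinants and images under a relabelling of coordinates\<close>

definition relabel :: "('m \<Rightarrow> 'n) \<Rightarrow> real^'n \<Rightarrow> real^'m" where
  "relabel h x = (\<chi> i. x $ h i)"

lemma relabel_nth [simp]: "relabel h x $ i = x $ h i"
  by (simp add: relabel_def)

lemma relabel_inv: "bij h \<Longrightarrow> relabel (inv h) (relabel h x) = x" "bij h \<Longrightarrow> relabel h (relabel (inv h) y) = y"
  by (simp_all add: vec_eq_iff bij_is_surj surj_f_inv_f bij_is_inj)

lemma linear_relabel: "linear (relabel h :: real^'n \<Rightarrow> real^'m)"
  by (auto intro!: linearI simp: vec_eq_iff)

lemma borel_measurable_relabel [measurable]: "relabel h \<in> borel_measurable borel"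
  by (intro borel_measurable_continuous_onI linear_continuous_on)
    (use linear_relabel linear_conv_bounded_linear in blast)

lemma prod_Basis_vec: "(\<Prod>b\<in>(Basis :: (real^'n) set). f b) = (\<Prod>i\<in>UNIV. f (axis i 1))"
proof -
  have *: "(Basis :: (real^'n) set) = (\<lambda>i. axis i 1) ` UNIV" by (auto simp: Basis_vec_def)
  have "inj (\<lambda>i. axis i 1 :: real^'n)" by (simp add: inj_on_def axis_eq_axis)
  then show ?thesis unfolding * by (subst prod.reindex) (simp_all add: comp_def)
qed

lemma axis_in_Basis_D: "b \<in> (Basis :: (real^'n) set) \<Longrightarrow> \<exists>i. b = axis i 1"
  by (auto simp: Basis_vec_def)

lemma distr_lborel_relabel:
  fixes h :: "'m::finite \<Rightarrow> 'n::finite"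
  assumes h: "bij h"
  shows "distr lborel borel (relabel h) = lborel"
proof (rule lborel_eqI[symmetric])
  fix l u :: "real^'m"
  assume "\<And>b. b \<in> Basis \<Longrightarrow> l \<bullet> b \<le> u \<bullet> b"
  then have lu: "l $ i \<le> u $ i" for i
    by (metis axis_in_Basis_iff cart_eq_inner_axis real_inner_1_right inner_real_def Basis_real_def insertI1)
  have pre: "relabel h -` box l u = box (relabel (inv h) l) (relabel (inv h) u)"
  proof (intro set_eqI)
    fix x :: "real^'n"
    have "(\<forall>i. l $ i < x $ h i \<and> x $ h i < u $ i) \<longleftrightarrow>
        (\<forall>j. l $ inv h j < x $ j \<and> x $ j < u $ inv h j)"
      using h by (metis bij_inv_eq_iff)
    then show "x \<in> relabel h -` box l u \<longleftrightarrow> x \<in> box (relabel (inv h) l) (relabel (inv h) u)"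
      by (simp add: mem_box_cart)
  qed
  have "emeasure (distr lborel borel (relabel h)) (box l u) = emeasure lborel (box (relabel (inv h) l) (relabel (inv h) u))"
    by (subst emeasure_distr) (auto simp: pre)
  also have "\<dots> = ennreal (\<Prod>j\<in>UNIV. u $ inv h j - l $ inv h j)"
    using lu by (subst emeasure_lborel_box) (auto simp: prod_Basis_vec inner_axis dest!: axis_in_Basis_D)
  also have "(\<Prod>j\<in>UNIV. u $ inv h j - l $ inv h j) = (\<Prod>i\<in>UNIV. u $ i - l $ i)"
    by (rule prod.reindex_bij_betw) (use h in \<open>simp add: bij_imp_bij_inv\<close>)
  also have "\<dots> = prod ((\<bullet>) (u - l)) Basis"
    by (simp add: prod_Basis_vec inner_axis)
  finally show "emeasure (distr lborel borel (relabel h)) (box l u) = ennreal (prod ((\<bullet>) (u - l)) Basis)" .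
qed simp

text \<open>Rows and columns are renamed by the same bijection. Conjugation by \<open>h\<close> is a
  sign-preserving bijection between the permutations of the two index types, so the Leibniz sums
  agree term by term.\<close>

lemma det_relabel:
  fixes A :: "real^'n^'n" and h :: "'m::finite \<Rightarrow> 'n"
  assumes h: "bij h"
  shows "det (\<chi> i j. A $ h i $ h j) = det A"
proof -
  let ?F = "map_permutation (UNIV :: 'm set) h"
  have F: "?F p (h i) = h (p i)" for p i
    using h by (simp add: map_permutation_def restrict_id_def bij_is_inj bij_is_surj)
  have perm: "?F p permutes UNIV" if "p permutes UNIV" for p
    using map_permutation_permutes[OF _ that, of h UNIV] h by simp
  have bij: "bij_betw ?F {p. p permutes UNIV} {p. p permutes UNIV}"
  proof (rule bij_betw_imageI)
    show "inj_on ?F {p. p permutes UNIV}"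
    proof (rule inj_onI)
      fix p q assume "?F p = ?F q"
      then have "h (p i) = h (q i)" for i using F by metis
      then show "p = q" using h by (auto simp: bij_def inj_def)
    qed
    show "?F ` {p. p permutes UNIV} = {p. p permutes UNIV}"
    proof (safe)
      fix q :: "'n \<Rightarrow> 'n" assume q: "q permutes UNIV"
      define p where "p i = inv h (q (h i))" for i
      have "bij q" using q by (simp add: permutes_bij)
      then have "bij (inv h \<circ> q \<circ> h)" using h by (intro bij_comp bij_imp_bij_inv)
      moreover have "inv h \<circ> q \<circ> h = p" by (simp add: fun_eq_iff p_def)
      ultimately have "bij p" by simp
      then have p: "p permutes UNIV" by (intro bij_imp_permutes) auto
      have "?F p x = q x" for x
      proof -
        obtain i where "x = h i" using h by (metis bij_pointE)
        then show ?thesis using h F by (simp add: p_def bij_is_surj surj_f_inv_f)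
      qed
      then have "q = ?F p" by (simp add: fun_eq_iff)
      then show "q \<in> ?F ` {p. p permutes UNIV}" using p by blast
    qed (rule perm)
  qed
  have "det A = (\<Sum>p | p permutes UNIV. of_int (sign (?F p)) * (\<Prod>i\<in>UNIV. A $ i $ ?F p i))"
    unfolding det_def by (rule sum.reindex_bij_betw[OF bij, symmetric])
  also have "\<dots> = (\<Sum>p | p permutes UNIV. of_int (sign p) * (\<Prod>i\<in>UNIV. A $ h i $ h (p i)))"
  proof (rule sum.cong)
    fix p :: "'m \<Rightarrow> 'm" assume p: "p \<in> {p. p permutes UNIV}"
    have "(\<Prod>i\<in>UNIV. A $ i $ ?F p i) = (\<Prod>i\<in>UNIV. A $ h i $ ?F p (h i))"
      by (rule prod.reindex_bij_betw[symmetric]) (rule h)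
    then show "of_int (sign (?F p)) * (\<Prod>i\<in>UNIV. A $ i $ ?F p i) =
        of_int (sign p) * (\<Prod>i\<in>UNIV. A $ h i $ h (p i))"
      using p h by (simp add: F sign_map_permutation bij_is_inj)
  qed simp
  finally show ?thesis by (simp add: det_def)
qed

text \<open>Whatever its multiplicity, a differentiable map has an image of measure at most the
  integral of its absolute Jacobian. The image is only Lebesgue measurable, hence the Borel superset
  of equal measure.\<close>

lemma borel_superset_image_ordered:
  fixes f :: "real^'n::{finite,wellorder} \<Rightarrow> real^'n::_"
  assumes S: "S \<in> sets borel" and f: "\<And>x. x \<in> S \<Longrightarrow> (f has_derivative f' x) (at x within S)"
    and J: "J \<in> borel_measurable borel" "\<And>x. 0 \<le> J x" "(\<integral>\<^sup>+ x. ennreal (J x) \<partial>lborel) \<le> ennreal B" "0 \<le> B"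
    and le: "\<And>x. x \<in> S \<Longrightarrow> \<bar>det (matrix (f' x))\<bar> \<le> J x"
  shows "\<exists>E\<in>sets borel. f ` S \<subseteq> E \<and> emeasure lborel E \<le> ennreal B"
proof -
  have SL: "S \<in> sets lebesgue" using S by simp
  have Ji: "integrable lborel J"
    using J by (intro integrableI_nonneg) (auto intro: le_less_trans)
  then have JU: "J integrable_on UNIV" by (rule integrable_on_lborel)
  have "integral UNIV J = enn2real (\<integral>\<^sup>+ x. ennreal (J x) \<partial>lborel)"
    unfolding integral_lborel[OF Ji] using J by (intro integral_eq_nn_integral) auto
  also have "\<dots> \<le> B" using J(3,4) by (simp add: enn2real_leI)
  finally have JB: "integral UNIV J \<le> B" .
  have "J absolutely_integrable_on UNIV"
    using JU J(2) by (intro nonnegative_absolutely_integrable_1) auto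
  then have "J absolutely_integrable_on S" by (rule set_integrable_subset) (use SL in auto)
  then have JS: "J integrable_on S" by (rule set_lebesgue_integral_eq_integral)
  have int: "(\<lambda>x. \<bar>det (matrix (f' x))\<bar>) integrable_on S"
  proof (rule measurable_bounded_by_integrable_imp_integrable_real[OF _ JS _ SL])
    show "(\<lambda>x. \<bar>det (matrix (f' x))\<bar>) \<in> borel_measurable (lebesgue_on S)"
      using borel_measurable_det_Jacobian[OF SL f] by (intro borel_measurable_abs)
  qed (use le in auto)
  have lm: "f ` S \<in> lmeasurable" by (rule measurable_differentiable_image[OF SL f int])
  have "measure lebesgue (f ` S) \<le> integral S (\<lambda>x. \<bar>det (matrix (f' x))\<bar>)"
    by (rule measure_differentiable_image[OF SL f int])
  also have "\<dots> \<le> integral S J" by (rule integral_le[OF int JS]) (rule le)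
  also have "\<dots> \<le> integral UNIV J" by (rule integral_subset_le) (use JS JU J(2) in auto)
  also note JB
  finally have "emeasure lebesgue (f ` S) \<le> ennreal B"
    using lm by (simp add: emeasure_eq_measure2 ennreal_leI)
  moreover obtain E where "E \<in> sets lborel" "f ` S \<subseteq> E" "emeasure lebesgue (f ` S) = emeasure lborel E"
    using Complete_Measure.completion_upper[of "f ` S" lborel] lm by (auto simp: fmeasurableD)
  ultimately show ?thesis by auto
qed

text \<open>Conjugation with \<open>relabel\<close> moves the map to the ordered index type. It
  changes neither the Jacobian (\<open>det_relabel\<close>) nor the measure
  (\<open>distr_lborel_relabel\<close>).\<close>

lemma borel_superset_image:
  fixes f :: "real^'n \<Rightarrow> real^'n"
  assumes S: "S \<in> sets borel" and f: "\<And>x. x \<in> S \<Longrightarrow> (f has_derivative f' x) (at x within S)"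
    and J: "J \<in> borel_measurable borel" "\<And>x. 0 \<le> J x" "(\<integral>\<^sup>+ x. ennreal (J x) \<partial>lborel) \<le> ennreal B" "0 \<le> B"
    and le: "\<And>x. x \<in> S \<Longrightarrow> \<bar>det (matrix (f' x))\<bar> \<le> J x"
  shows "\<exists>E\<in>sets borel. f ` S \<subseteq> E \<and> emeasure lborel E \<le> ennreal B"
proof -
  define h :: "'n ordered_copy \<Rightarrow> 'n" where "h = Rep_ordered_copy"
  have h: "bij h" unfolding h_def by (rule bij_Rep_ordered_copy)
  let ?r = "relabel h" and ?s = "relabel (inv h)"
  have sr: "?s (?r x) = x" for x using relabel_inv[OF h] by auto
  define T where "T = ?s -` S"
  define g where "g y = ?r (f (?s y))" for y
  define g' where "g' y v = ?r (f' (?s y) (?s v))" for y v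
  have T: "T \<in> sets borel" unfolding T_def
    by (rule measurable_sets_borel[OF borel_measurable_relabel S])
  have blr: "bounded_linear ?r" and bls: "bounded_linear ?s"
    using linear_relabel linear_conv_bounded_linear by blast+
  have g: "(g has_derivative g' y) (at y within T)" if "y \<in> T" for y
  proof -
    have "(f has_derivative f' (?s y)) (at (?s y) within ?s ` T)"
      by (rule has_derivative_subset[OF f]) (use that in \<open>auto simp: T_def\<close>)
    from diff_chain_within[OF bounded_linear_imp_has_derivative[OF bls] this]
    have "((f \<circ> ?s) has_derivative (f' (?s y) \<circ> ?s)) (at y within T)" .
    from bounded_linear.has_derivative[OF blr this]
    show ?thesis by (simp add: g_def[abs_def] g'_def[abs_def] comp_def)
  qed
  have le': "\<bar>det (matrix (g' y))\<bar> \<le> J (?s y)" if "y \<in> T" for y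
  proof -
    have ax: "?s (axis j 1) = axis (h j) 1" for j
    proof -
      have "inv h k = j \<longleftrightarrow> k = h j" for k using h by (metis bij_inv_eq_iff)
      then show ?thesis by (simp add: vec_eq_iff axis_def)
    qed
    have "matrix (g' y) = (\<chi> i j. matrix (f' (?s y)) $ h i $ h j)"
      by (simp add: matrix_def g'_def vec_eq_iff ax)
    then show ?thesis using le[of "?s y"] that by (simp add: det_relabel[OF h] T_def)
  qed
  have "(\<integral>\<^sup>+ y. ennreal (J (?s y)) \<partial>lborel) = (\<integral>\<^sup>+ x. ennreal (J x) \<partial>distr lborel borel ?s)"
    using J(1) by (subst nn_integral_distr) auto
  also have "\<dots> = (\<integral>\<^sup>+ x. ennreal (J x) \<partial>lborel)"
    by (simp add: distr_lborel_relabel[OF bij_imp_bij_inv[OF h]])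
  finally have "(\<integral>\<^sup>+ y. ennreal (J (?s y)) \<partial>lborel) \<le> ennreal B" using J(3) by simp
  moreover have "(\<lambda>y. J (?s y)) \<in> borel_measurable borel" using J(1) by measurable
  ultimately have "\<exists>E\<in>sets borel. g ` T \<subseteq> E \<and> emeasure lborel E \<le> ennreal B"
    by (intro borel_superset_image_ordered[OF T g, where J="\<lambda>y. J (?s y)"] J(2,4) le')
  then obtain E where E: "E \<in> sets borel" "g ` T \<subseteq> E" "emeasure lborel E \<le> ennreal B" by blast
  have mE: "?r -` E \<in> sets borel"
    by (rule measurable_sets_borel[OF borel_measurable_relabel E(1)])
  have "f ` S \<subseteq> ?r -` E"
  proof
    fix z assume "z \<in> f ` S"
    then obtain x where x: "x \<in> S" "z = f x" by blast
    have "?r x \<in> T" using x by (simp add: T_def sr)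
    then have "g (?r x) \<in> E" using E(2) by blast
    then show "z \<in> ?r -` E" using x by (simp add: g_def sr)
  qed
  moreover have "emeasure lborel (?r -` E) = emeasure lborel E"
    by (subst distr_lborel_relabel[OF h, symmetric]) (use E(1) in \<open>simp add: emeasure_distr\<close>)
  ultimately show ?thesis using E(3) mE by (intro bexI[of _ "?r -` E"]) auto
qed

section \<open>Sliding paraboloids\<close>

text \<open>A growth estimate from a one-sided Dini derivative. If it failed, subtract a line of
  slope slightly above \<open>M\<close> that still leaves the final value larger than the initial
  one. At the first time at which the final value is reached, the quotient condition produces an
  even earlier such time.\<close>

lemma le_of_left_quotients:
  fixes F :: "real \<Rightarrow> real"
  assumes t: "t1 \<le> t0" and cont: "continuous_on {t1..t0} F"
    and dini: "\<And>t e. t1 < t \<Longrightarrow> t \<le> t0 \<Longrightarrow> 0 < e \<Longrightarrow> \<exists>s. t1 \<le> s \<and> s < t \<and> F t - F s \<le> (M + e) * (t - s)"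
  shows "F t0 - F t1 \<le> M * (t0 - t1)"
proof (rule ccontr)
  assume neg: "\<not> F t0 - F t1 \<le> M * (t0 - t1)"
  then have lt: "t1 < t0" using t by (cases "t1 = t0") auto
  define e where "e = (F t0 - F t1 - M * (t0 - t1)) / (2 * (t0 - t1))"
  have e: "e > 0" using neg lt by (simp add: e_def)
  define h where "h t = F t - (M + e) * (t - t1)" for t
  have "e * (t0 - t1) = (F t0 - F t1 - M * (t0 - t1)) / 2" using lt by (simp add: e_def field_simps)
  then have h0: "h t1 < h t0" using neg by (simp add: h_def algebra_simps)
  have ch: "continuous_on {t1..t0} h" unfolding h_def by (intro continuous_intros cont)
  define S where "S = {t \<in> {t1..t0}. h t0 \<le> h t}"
  have "S = {t1..t0} \<inter> h -` {h t0..}" by (auto simp: S_def)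
  then have "closed S" using continuous_closed_preimage[OF ch] by simp
  moreover have "bounded S" by (rule bounded_subset[of "{t1..t0}"]) (auto simp: S_def)
  ultimately have cS: "compact S" by (simp add: compact_eq_bounded_closed)
  have nS: "S \<noteq> {}" using t by (auto simp: S_def)
  obtain t' where t': "t' \<in> S" "\<And>s. s \<in> S \<Longrightarrow> t' \<le> s"
    using compact_attains_inf[OF cS nS] by blast
  have "h t0 \<le> h t'" "t1 \<le> t'" using t'(1) by (simp_all add: S_def)
  then have "t1 \<noteq> t'" using h0 by force
  then have "t1 < t'" using \<open>t1 \<le> t'\<close> by simp
  moreover have "t' \<le> t0" using t'(1) by (simp add: S_def)
  ultimately obtain s where s: "t1 \<le> s" "s < t'" "F t' - F s \<le> (M + e) * (t' - s)"
    using dini e by blast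
  have "h t' \<le> h s" using s(3) by (simp add: h_def algebra_simps)
  moreover have "h t0 \<le> h t'" using t'(1) by (simp add: S_def)
  ultimately have "s \<in> S" using s \<open>t' \<le> t0\<close> by (auto simp: S_def)
  then show False using t'(2) s(2) by force
qed

lemma left_quotient_eventually:
  fixes F :: "real \<Rightarrow> real"
  assumes D: "(F has_real_derivative D) (at t within {0..1})" and e: "0 < e"
  shows "\<exists>d>0. \<forall>s. 0 \<le> s \<and> s < t \<and> t - d < s \<and> t \<le> 1 \<longrightarrow>
    \<bar>(F t - F s) - D * (t - s)\<bar> \<le> e * (t - s)"
proof -
  obtain d where d: "d > 0" "\<And>s. s \<in> {0..1} \<Longrightarrow> norm (s - t) < d \<Longrightarrow> norm (F s - F t - (s - t) * D) \<le> e * norm (s - t)"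
    using D e unfolding has_field_derivative_def has_derivative_within_alt by (auto simp: mult.commute)
  show ?thesis
  proof (intro exI[of _ d] conjI d(1) allI impI)
    fix s assume s: "0 \<le> s \<and> s < t \<and> t - d < s \<and> t \<le> 1"
    then have "norm (F s - F t - (s - t) * D) \<le> e * norm (s - t)" by (intro d(2)) auto
    moreover have "F s - F t - (s - t) * D = - ((F t - F s) - D * (t - s))" by (simp add: algebra_simps)
    ultimately show "\<bar>(F t - F s) - D * (t - s)\<bar> \<le> e * (t - s)" using s by (simp only: norm_minus_cancel) auto
  qed
qed


text \<open>The level of the excess is \<open>c0 + L * (t0 - t)\<close>. Contact in the interior of
  the compact set \<open>X\<close> makes a maximum over \<open>X\<close> a local one. The condition
  with \<open>J\<close> is what the inequality of means needs to bound the Jacobian by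
  \<open>J\<close>. \<open>G\<close> stands for the reaction term, and the last inequality bounds
  the time derivative at a contact point by \<open>C'\<close>.\<close>

locale paraboloid_contact =
  fixes f :: "real \<Rightarrow> real^'n \<Rightarrow> real" and a :: "real \<Rightarrow> real^'n \<Rightarrow> real^'n^'n"
    and J :: "real \<Rightarrow> real^'n \<Rightarrow> real"
    and X Y :: "(real^'n) set" and x0 :: "real^'n" and t1 t0 A c0 L C' N' :: real
  assumes cont: "continuous_on ({0..1} \<times> UNIV) (\<lambda>(t, x). f t x)"
    and t: "0 \<le> t1" "t1 < t0" "t0 \<le> 1"
    and X: "compact X" "X \<noteq> {}" and Y: "compact Y"
    and A: "0 < A" and L: "0 \<le> L" and C': "0 \<le> C'" and N': "0 \<le> N'"
    and J: "\<And>t. t1 < t \<Longrightarrow> t \<le> t0 \<Longrightarrow> J t \<in> borel_measurable borel" "\<And>t x. 0 \<le> J t x"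
      "\<And>t. t1 < t \<Longrightarrow> t \<le> t0 \<Longrightarrow> (\<integral>\<^sup>+ x. ennreal (J t x) \<partial>lborel) \<le> ennreal N'"
    and contact: "\<And>t x y. t1 < t \<Longrightarrow> t \<le> t0 \<Longrightarrow> x \<in> X \<Longrightarrow> y \<in> Y \<Longrightarrow>
        c0 + L * (t0 - t) \<le> f t x - A * (norm (x - y))\<^sup>2 + A * (norm (x0 - y))\<^sup>2 \<Longrightarrow>
        x \<in> interior X \<and> twice_differentiable_at (f t) x \<and> transpose (a t x) = a t x \<and>
        (\<forall>\<xi>. 0 \<le> \<xi> \<bullet> (a t x *v \<xi>)) \<and> 0 < det (a t x) \<and>
        ((L + C') / real CARD('n)) ^ CARD('n) \<le> det (a t x) * ((2 * A) ^ CARD('n) * J t x) \<and>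
        (\<exists>D G. ((\<lambda>s. f s x) has_real_derivative D) (at t within {0..1}) \<and>
           D \<le> trace (a t x ** hess (f t) x) + G \<and> 2 * A * trace (a t x) + G \<le> C')"
begin

text \<open>The summand with \<open>x0\<close> normalizes the paraboloids:
  \<open>v t y x0 = f t x0\<close> for every vertex, and the squares of \<open>y\<close> cancel, so
  that \<open>v\<close> is affine in \<open>y\<close>.\<close>

definition v :: "real \<Rightarrow> real^'n \<Rightarrow> real^'n \<Rightarrow> real" where
  "v t y x = f t x - A * (norm (x - y))\<^sup>2 + A * (norm (x0 - y))\<^sup>2"

definition g :: "real \<Rightarrow> real^'n \<Rightarrow> real" where
  "g t y = (SUP x\<in>X. v t y x)"

definition p :: "real \<Rightarrow> real^'n \<Rightarrow> real" where
  "p t y = max 0 (g t y - (c0 + L * (t0 - t)))"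

lemma v_affine: "v t y x = f t x + A * ((norm x0)\<^sup>2 - (norm x)\<^sup>2) + 2 * A * ((x - x0) \<bullet> y)"
  by (simp add: v_def power2_norm_eq_inner inner_diff_left inner_diff_right inner_commute algebra_simps)

lemma continuous_on_f: "t \<in> {0..1} \<Longrightarrow> continuous_on S (f t)"
  using continuous_on_compose2[OF cont, of S "\<lambda>x. (t, x)"] continuous_on_Pair[OF continuous_on_const continuous_on_id, of S t]
  by (auto simp: image_subset_iff)

lemma g_attained:
  assumes "t \<in> {0..1}"
  obtains x where "x \<in> X" "g t y = v t y x" "\<And>z. z \<in> X \<Longrightarrow> v t y z \<le> v t y x"
proof -
  have "continuous_on X (v t y)"
    unfolding v_def by (intro continuous_intros continuous_on_f assms)
  then obtain x where x: "x \<in> X" "\<And>z. z \<in> X \<Longrightarrow> v t y z \<le> v t y x"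
    using continuous_attains_sup[OF X] by blast
  then have "g t y = v t y x"
    unfolding g_def by (intro cSup_eq_maximum) auto
  then show ?thesis using that x by blast
qed

lemma v_le_g: "t \<in> {0..1} \<Longrightarrow> x \<in> X \<Longrightarrow> v t y x \<le> g t y"
  by (metis g_attained)

lemma f_modulus:
  assumes "e > 0"
  obtains d where "d > 0" "\<And>t s x. t \<in> {0..1} \<Longrightarrow> s \<in> {0..1} \<Longrightarrow> \<bar>t - s\<bar> < d \<Longrightarrow> x \<in> X \<Longrightarrow> \<bar>f t x - f s x\<bar> < e"
proof -
  have "compact ({0..1::real} \<times> X)" by (intro compact_Times X) auto
  then have "uniformly_continuous_on ({0..1} \<times> X) (\<lambda>(t, x). f t x)"
    by (intro compact_uniformly_continuous continuous_on_subset[OF cont]) auto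
  then obtain d where d: "d > 0" "\<And>z w. z \<in> {0..1} \<times> X \<Longrightarrow> w \<in> {0..1} \<times> X \<Longrightarrow> dist w z < d \<Longrightarrow>
      dist (case w of (t, x) \<Rightarrow> f t x) (case z of (t, x) \<Rightarrow> f t x) < e"
    using assms unfolding uniformly_continuous_on_def by metis
  have "\<bar>f t x - f s x\<bar> < e" if "t \<in> {0..1}" "s \<in> {0..1}" "\<bar>t - s\<bar> < d" "x \<in> X" for t s x
    using d(2)[of "(s, x)" "(t, x)"] that by (simp add: dist_Pair_Pair dist_real_def)
  then show ?thesis using that d(1) by blast
qed

lemma g_diff_le:
  assumes "t \<in> {0..1}" "s \<in> {0..1}" "\<And>x. x \<in> X \<Longrightarrow> v t y x - v s z x \<le> e"
  shows "g t y - g s z \<le> e"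
proof -
  obtain x where x: "x \<in> X" "g t y = v t y x" using g_attained[OF assms(1)] by metis
  have "v s z x \<le> g s z" using v_le_g[OF assms(2) x(1)] .
  then show ?thesis using assms(3)[OF x(1)] x(2) by linarith
qed

lemma p_time_modulus:
  assumes "e > 0"
  obtains d where "d > 0" "\<And>t s y. t \<in> {0..1} \<Longrightarrow> s \<in> {0..1} \<Longrightarrow> \<bar>t - s\<bar> < d \<Longrightarrow> \<bar>p t y - p s y\<bar> \<le> e"
proof -
  obtain d where d: "d > 0" "\<And>t s x. t \<in> {0..1} \<Longrightarrow> s \<in> {0..1} \<Longrightarrow> \<bar>t - s\<bar> < d \<Longrightarrow> x \<in> X \<Longrightarrow> \<bar>f t x - f s x\<bar> < e / 2"
    using f_modulus[of "e / 2"] assms by auto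
  define d' where "d' = min d (e / 2 / (1 + L))"
  have d': "d' > 0" using d(1) assms L by (simp add: d'_def)
  have main: "p t y - p s y \<le> e" if ts: "t \<in> {0..1}" "s \<in> {0..1}" "\<bar>t - s\<bar> < d'" for t s y
  proof -
    have "\<bar>t - s\<bar> < d" using ts(3) by (simp add: d'_def)
    then have "g t y - g s y \<le> e / 2"
    proof (intro g_diff_le[OF ts(1,2)])
      fix x assume "x \<in> X"
      from d(2)[OF ts(1,2) \<open>\<bar>t - s\<bar> < d\<close> this] have "f t x - f s x \<le> e / 2"
        unfolding abs_less_iff by linarith
      then show "v t y x - v s y x \<le> e / 2" by (simp add: v_def)
    qed
    moreover have "L * (t - s) \<le> e / 2"
    proof -
      have "\<bar>t - s\<bar> < e / 2 / (1 + L)" using ts(3) by (simp add: d'_def)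
      then have "(1 + L) * \<bar>t - s\<bar> < e / 2" using L by (simp add: field_simps)
      moreover have "L * (t - s) \<le> L * \<bar>t - s\<bar>" using L by (intro mult_left_mono) auto
      moreover have "\<bar>t - s\<bar> \<ge> 0" by simp
      ultimately show ?thesis by (simp only: distrib_right mult_1)
    qed
    ultimately show ?thesis using assms unfolding p_def by (auto simp: max_def algebra_simps)
  qed
  show ?thesis
  proof (rule that[OF d'])
    fix t s y assume "t \<in> {0..1}" "s \<in> {0..1}" "\<bar>t - s\<bar> < d'"
    then show "\<bar>p t y - p s y\<bar> \<le> e" using main[of t s y] main[of s t y] by (simp add: abs_le_iff abs_minus_commute)
  qed
qed

text \<open>\<open>g t\<close> is a maximum of affine functions of \<open>y\<close> with slopes
  \<open>2 * A * (x - x0)\<close>, which are bounded on \<open>X\<close>; it is therefore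
  Lipschitz.\<close>

lemma continuous_on_p_space:
  assumes "t \<in> {0..1}"
  shows "continuous_on UNIV (p t)"
proof -
  obtain D where D: "\<And>x. x \<in> X \<Longrightarrow> norm (x - x0) \<le> D" "D > 0"
  proof -
    have "bounded ((\<lambda>x. x - x0) ` X)"
      using X(1) by (intro compact_imp_bounded compact_continuous_image continuous_intros)
    then show ?thesis using that unfolding bounded_pos by auto
  qed
  have "g t y - g t z \<le> (2 * A * D) * dist y z" for y z
  proof (rule g_diff_le[OF assms assms])
    fix x assume "x \<in> X"
    have "v t y x - v t z x = 2 * A * ((x - x0) \<bullet> (y - z))"
      by (simp add: v_affine inner_diff_right algebra_simps)
    also have "\<dots> \<le> 2 * A * (norm (x - x0) * norm (y - z))"
      using A by (intro mult_left_mono norm_cauchy_schwarz) auto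
    also have "\<dots> \<le> 2 * A * (D * norm (y - z))"
      using A D(1)[OF \<open>x \<in> X\<close>] by (intro mult_left_mono mult_right_mono) auto
    finally show "v t y x - v t z x \<le> (2 * A * D) * dist y z" by (simp add: dist_norm)
  qed
  then have "\<bar>g t y - g t z\<bar> \<le> (2 * A * D) * dist y z" for y z
    by (metis abs_le_iff dist_commute minus_diff_eq)
  then have "(2 * A * D)-lipschitz_on UNIV (g t)"
    using A D(2) by (intro lipschitz_onI) (auto simp: dist_real_def)
  then have "continuous_on UNIV (g t)" by (rule lipschitz_on_continuous_on)
  then show ?thesis unfolding p_def by (intro continuous_intros)
qed

end

lemma det_scaleR_matrix:
  fixes B :: "real^'n^'n"
  shows "det (r *\<^sub>R B) = r ^ CARD('n) * det B"
proof -
  have "r *\<^sub>R B = diag_mat (\<lambda>_. r) ** B"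
    by (simp add: diag_mat_def matrix_matrix_mult_def vec_eq_iff if_distrib[of "\<lambda>x. x * _"] cong: if_cong)
  then show ?thesis by (simp add: det_mul det_diag_mat)
qed

lemma trace_scaleR: "trace (r *\<^sub>R (B :: real^'n^'n)) = r * trace B"
  by (simp add: trace_def sum_distrib_left)

lemma matrix_scaleR_right: "a ** (r *\<^sub>R (B :: real^'n^'m)) = r *\<^sub>R (a ** B)"
  by (simp add: matrix_matrix_mult_def vec_eq_iff sum_distrib_left algebra_simps)

lemma matrix_diff_ldistrib: "a ** (B - C :: real^'n^'m) = a ** B - a ** C"
  by (simp add: matrix_matrix_mult_def vec_eq_iff sum_subtractf right_diff_distrib)

lemma shifted_hessian_psd:
  fixes H :: "real^'n^'n"
  assumes "transpose H = H" "\<And>\<xi>. \<xi> \<bullet> (H *v \<xi>) \<le> r * (\<xi> \<bullet> \<xi>)"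
  shows "transpose (r *\<^sub>R mat 1 - H) = r *\<^sub>R mat 1 - H" "0 \<le> \<xi> \<bullet> ((r *\<^sub>R mat 1 - H) *v \<xi>)"
proof -
  have "H $ j $ i = H $ i $ j" for i j
    using assms(1) by (metis transpose_def vec_lambda_beta)
  then show "transpose (r *\<^sub>R mat 1 - H) = r *\<^sub>R mat 1 - H"
    by (simp add: transpose_def vec_eq_iff mat_def)
  show "0 \<le> \<xi> \<bullet> ((r *\<^sub>R mat 1 - H) *v \<xi>)"
    using assms(2)[of \<xi>]
    by (simp add: matrix_vector_mult_diff_rdistrib scaleR_matrix_vector_assoc[symmetric] inner_diff_right)
qed

lemma trace_shifted:
  fixes a H :: "real^'n^'n"
  shows "trace (a ** (r *\<^sub>R mat 1 - H)) = r * trace a - trace (a ** H)"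
  by (simp add: matrix_diff_ldistrib matrix_scaleR_right trace_sub trace_scaleR)

lemma trace_mult_le:
  fixes a H :: "real^'n^'n"
  assumes "transpose a = a" "\<And>\<xi>. 0 \<le> \<xi> \<bullet> (a *v \<xi>)" "transpose H = H" "\<And>\<xi>. \<xi> \<bullet> (H *v \<xi>) \<le> r * (\<xi> \<bullet> \<xi>)"
  shows "trace (a ** H) \<le> r * trace a"
  using trace_det_psd(2)[OF assms(1,2) shifted_hessian_psd[OF assms(3,4)]] by (simp add: trace_shifted)

context paraboloid_contact
begin

lemma contact_point:
  assumes t': "t1 < t" "t \<le> t0" and y: "y \<in> Y" and x: "x \<in> X" "\<And>z. z \<in> X \<Longrightarrow> v t y z \<le> v t y x"
    and c: "c0 + L * (t0 - t) \<le> v t y x"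
  shows "twice_differentiable_at (f t) x" "x - (1 / (2 * A)) *\<^sub>R grad (f t) x = y"
    "\<exists>D. ((\<lambda>s. f s x) has_real_derivative D) (at t within {0..1}) \<and> D \<le> C' \<and>
      (- L \<le> D \<longrightarrow> \<bar>det (mat 1 - (1 / (2 * A)) *\<^sub>R hess (f t) x)\<bar> \<le> J t x)"
proof -
  let ?n = "real CARD('n)" and ?H = "hess (f t) x"
  note con = contact[OF t' x(1) y, folded v_def, OF c]
  from con have int: "x \<in> interior X" and td: "twice_differentiable_at (f t) x"
    and sym: "transpose (a t x) = a t x" and psd: "\<And>\<xi>. 0 \<le> \<xi> \<bullet> (a t x *v \<xi>)" and dp: "0 < det (a t x)"
    and dJ: "((L + C') / ?n) ^ CARD('n) \<le> det (a t x) * ((2 * A) ^ CARD('n) * J t x)"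
    by auto
  from con obtain D G where D: "((\<lambda>s. f s x) has_real_derivative D) (at t within {0..1})"
     and DG: "D \<le> trace (a t x ** ?H) + G" "2 * A * trace (a t x) + G \<le> C'" by blast
  show "twice_differentiable_at (f t) x" by (rule td)
  have "\<forall>\<^sub>F z in nhds x. z \<in> interior X" using int open_interior by (rule eventually_nhds_in_open[rotated])
  then have mx: "\<forall>\<^sub>F z in nhds x. f t z - A * (norm (z - y))\<^sup>2 \<le> f t x - A * (norm (x - y))\<^sup>2"
  proof (rule eventually_mono)
    fix z assume "z \<in> interior X"
    then have "z \<in> X" using interior_subset by blast
    from x(2)[OF this] show "f t z - A * (norm (z - y))\<^sup>2 \<le> f t x - A * (norm (x - y))\<^sup>2"
      by (simp add: v_def)
  qed
  note touch = touching_paraboloid[OF td mx]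
  show "x - (1 / (2 * A)) *\<^sub>R grad (f t) x = y" using A by (simp add: touch(1))
  define B where "B = (2 * A) *\<^sub>R mat 1 - ?H"
  note hs = hess_symmetric[OF td]
  have B: "transpose B = B" "\<And>\<xi>. 0 \<le> \<xi> \<bullet> (B *v \<xi>)"
    unfolding B_def by (rule shifted_hessian_psd[OF hs touch(2)])+
  have trH: "trace (a t x ** ?H) \<le> 2 * A * trace (a t x)"
    by (rule trace_mult_le[OF sym psd hs touch(2)])
  have detB: "0 \<le> det B" by (rule det_le_trace_power(3)[OF B])
  have "\<bar>det (mat 1 - (1 / (2 * A)) *\<^sub>R ?H)\<bar> \<le> J t x" if "- L \<le> D"
  proof -
    \<comment> \<open>This is where growth of the excess enters: \<open>D\<close> is at most
      \<open>trace (a ** hess) + G\<close>, so \<open>D \<ge> - L\<close> bounds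
      \<open>2 * A * trace a - trace (a ** hess)\<close> by \<open>L + C'\<close>.\<close>
    have trB: "trace (a t x ** B) \<le> L + C'"
      unfolding B_def trace_shifted using DG that by linarith
    have "det (a t x) * det B \<le> (trace (a t x ** B) / ?n) ^ CARD('n)"
      by (rule trace_det_psd(1)[OF sym psd B])
    also have "\<dots> \<le> ((L + C') / ?n) ^ CARD('n)"
      using trB trace_det_psd(2)[OF sym psd B] by (intro power_mono divide_right_mono) auto
    also note dJ
    finally have "det B \<le> (2 * A) ^ CARD('n) * J t x" using dp by simp
    moreover have "mat 1 - (1 / (2 * A)) *\<^sub>R ?H = (1 / (2 * A)) *\<^sub>R B"
      using A by (simp add: B_def scaleR_diff_right)
    then have "det (mat 1 - (1 / (2 * A)) *\<^sub>R ?H) = det B / (2 * A) ^ CARD('n)"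
      by (simp add: det_scaleR_matrix power_divide)
    ultimately show ?thesis using A detB by (simp add: divide_le_eq mult.commute)
  qed
  moreover have "D \<le> C'" using DG trH by linarith
  ultimately show "\<exists>D. ((\<lambda>s. f s x) has_real_derivative D) (at t within {0..1}) \<and> D \<le> C' \<and>
      (- L \<le> D \<longrightarrow> \<bar>det (mat 1 - (1 / (2 * A)) *\<^sub>R ?H)\<bar> \<le> J t x)" using D by blast
qed

lemma p_diff_le:
  assumes "s \<in> {0..1}" "x \<in> X" "p t y = v t y x - (c0 + L * (t0 - t))"
  shows "p t y - p s y \<le> f t x - f s x + L * (t - s)"
proof -
  have "v s y x - (c0 + L * (t0 - s)) \<le> p s y"
    using v_le_g[OF assms(1,2), of y] by (simp add: p_def)
  then show ?thesis using assms(3) by (simp add: v_def algebra_simps)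
qed

lemma p_pos_contact:
  assumes "t \<in> {0..1}" "0 < p t y"
  obtains x where "x \<in> X" "\<And>z. z \<in> X \<Longrightarrow> v t y z \<le> v t y x" "c0 + L * (t0 - t) \<le> v t y x"
    "p t y = v t y x - (c0 + L * (t0 - t))"
proof -
  obtain x where x: "x \<in> X" "g t y = v t y x" "\<And>z. z \<in> X \<Longrightarrow> v t y z \<le> v t y x"
    using g_attained[OF assms(1)] by blast
  show ?thesis
    by (rule that[OF x(1,3)]) (use assms(2) x(2) in \<open>auto simp: p_def max_def split: if_splits\<close>)
qed

lemma p_nonneg: "0 \<le> p t y"
  by (simp add: p_def)

text \<open>Keeping the contact point of the later time fixed bounds the increase from above: there
  \<open>f\<close> grows at rate at most \<open>C'\<close>, and the level falls at rate
  \<open>L\<close>. This crude bound, valid for every vertex, later dominates the difference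
  quotients.\<close>

lemma p_growth:
  assumes s: "t1 \<le> s" "s \<le> t" "t \<le> t0" and y: "y \<in> Y"
  shows "p t y - p s y \<le> (L + C') * (t - s)"
proof (rule le_of_left_quotients[OF s(2)])
  have sub: "{s..t} \<subseteq> {0..1}" using s t by auto
  show "continuous_on {s..t} (\<lambda>t. p t y)"
    unfolding continuous_on_iff
  proof (intro ballI allI impI)
    fix r e :: real assume r: "r \<in> {s..t}" and e: "0 < e"
    then have e2: "0 < e / 2" by simp
    obtain d where d: "d > 0" "\<And>t s y. t \<in> {0..1} \<Longrightarrow> s \<in> {0..1} \<Longrightarrow> \<bar>t - s\<bar> < d \<Longrightarrow> \<bar>p t y - p s y\<bar> \<le> e / 2"
      using p_time_modulus[OF e2] by blast
    have "\<forall>q\<in>{s..t}. dist q r < d \<longrightarrow> dist (p q y) (p r y) < e"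
    proof (intro ballI impI)
      fix q assume q: "q \<in> {s..t}" "dist q r < d"
      then have "\<bar>p q y - p r y\<bar> \<le> e / 2" using d(2) r sub by (auto simp: dist_real_def)
      then show "dist (p q y) (p r y) < e" using e by (simp add: dist_real_def)
    qed
    then show "\<exists>d>0. \<forall>q\<in>{s..t}. dist q r < d \<longrightarrow> dist (p q y) (p r y) < e" using d(1) by blast
  qed
next
  fix r e :: real assume r: "s < r" "r \<le> t" and e: "0 < e"
  have r1: "t1 < r" "r \<le> t0" "r \<in> {0..1}" using r s t by auto
  show "\<exists>q\<ge>s. q < r \<and> p r y - p q y \<le> (L + C' + e) * (r - q)"
  proof (cases "p r y = 0")
    case True
    have "p r y - p s y \<le> 0" using True p_nonneg[of s y] by simp
    also have "0 \<le> (L + C' + e) * (r - s)" using L C' e r by simp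
    finally show ?thesis using r by auto
  next
    case False
    then have "0 < p r y" using p_nonneg[of r y] by simp
    then obtain x where x: "x \<in> X" "\<And>z. z \<in> X \<Longrightarrow> v r y z \<le> v r y x" "c0 + L * (t0 - r) \<le> v r y x"
      "p r y = v r y x - (c0 + L * (t0 - r))" using p_pos_contact[OF r1(3)] by blast
    obtain D where D: "((\<lambda>s. f s x) has_real_derivative D) (at r within {0..1})" "D \<le> C'"
      using contact_point(3)[OF r1(1,2) y x(1,2,3)] by blast
    obtain d where d: "d > 0" "\<forall>s. 0 \<le> s \<and> s < r \<and> r - d < s \<and> r \<le> 1 \<longrightarrow>
        \<bar>(f r x - f s x) - D * (r - s)\<bar> \<le> e * (r - s)"
      using left_quotient_eventually[OF D(1) e] by blast
    obtain q where q: "max s (r - d) < q" "q < r" using dense[of "max s (r - d)" r] r d(1) by auto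
    have q1: "q \<in> {0..1}" using q r s t by auto
    have "(f r x - f q x) - D * (r - q) \<le> e * (r - q)"
      using d(2)[rule_format, of q] q q1 r1 by (auto simp: abs_le_iff)
    moreover have "D * (r - q) \<le> C' * (r - q)" using D(2) q by (intro mult_right_mono) auto
    moreover have "p r y - p q y \<le> f r x - f q x + L * (r - q)" by (rule p_diff_le[OF q1 x(1,4)])
    ultimately have "p r y - p q y \<le> (L + C' + e) * (r - q)" by (simp add: algebra_simps)
    then show ?thesis using q by (intro exI[of _ q]) auto
  qed
qed

definition contact_set :: "real \<Rightarrow> (real^'n) set" where
  "contact_set t = {x \<in> X. \<exists>y\<in>Y. (\<forall>z\<in>X. v t y z \<le> v t y x) \<and> c0 + L * (t0 - t) \<le> v t y x}"

text \<open>The set of pairs of a contact point and its vertex is closed in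
  \<open>X \<times> Y\<close>; the contact set is its projection.\<close>

lemma compact_contact_set:
  assumes "t \<in> {0..1}"
  shows "compact (contact_set t)"
proof -
  define S where "S = {(x, y). (\<forall>z\<in>X. v t y z \<le> v t y x) \<and> c0 + L * (t0 - t) \<le> v t y x}"
  have cv: "continuous_on UNIV (\<lambda>w. v t (snd w) (fst w))"
    unfolding v_def
    by (intro continuous_intros continuous_on_compose2[OF continuous_on_f[OF assms, of UNIV]]) auto
  have cz: "continuous_on UNIV (\<lambda>w. v t (snd w) z)" for z
    unfolding v_def by (intro continuous_intros)
  have "S = (\<Inter>z\<in>X. {w. v t (snd w) z \<le> v t (snd w) (fst w)}) \<inter> {w. c0 + L * (t0 - t) \<le> v t (snd w) (fst w)}"
    by (auto simp: S_def)
  moreover have "closed \<dots>"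
    by (intro closed_Int closed_INT ballI closed_Collect_le cv cz continuous_on_const)
  ultimately have "closed S" by simp
  then have "compact ((X \<times> Y) \<inter> S)" by (intro compact_Int_closed compact_Times X Y)
  then have "compact (fst ` ((X \<times> Y) \<inter> S))"
    by (intro compact_continuous_image continuous_intros)
  moreover have "fst ` ((X \<times> Y) \<inter> S) = contact_set t"
    by (force simp: contact_set_def S_def)
  ultimately show ?thesis by simp
qed

end

lemma left_sequence:
  fixes r t :: real
  assumes "r < t"
  shows "\<exists>s :: nat \<Rightarrow> real. (\<forall>n. r \<le> s n \<and> s n < t) \<and> s \<longlonglongrightarrow> t"
proof (intro exI conjI allI)
  let ?s = "\<lambda>n. t - (t - r) * inverse (real (Suc n))"
  fix n
  have "(t - r) * inverse (real (Suc n)) \<le> (t - r) * 1"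
    using assms by (intro mult_left_mono) (auto simp: inverse_eq_divide)
  then show "r \<le> ?s n" by simp
  show "?s n < t" using assms by simp
next
  have "(\<lambda>n. t - (t - r) * inverse (real (Suc n))) \<longlonglongrightarrow> t - (t - r) * 0"
    by (intro tendsto_intros LIMSEQ_inverse_real_of_nat)
  then show "(\<lambda>n. t - (t - r) * inverse (real (Suc n))) \<longlonglongrightarrow> t" by simp
qed

section \<open>The integral of the excess and the vertices at which it grows\<close>

context paraboloid_contact
begin

text \<open>If the time derivative at the contact point lies below \<open>- L\<close>, then
  \<open>f\<close> falls faster than the level, so the excess was at least as large just before. The
  remaining vertices are images, under the map \<Theta>, of contact points where the Jacobian is at
  most \<open>J\<close>; the area formula covers them by a set of measure at most
  \<open>N'\<close>.\<close>

lemma contact_image_cover: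
  assumes t': "t1 < t" "t \<le> t0"
  shows "\<exists>E\<in>sets borel. emeasure lborel E \<le> ennreal N' \<and>
    (\<forall>y\<in>Y - E. \<exists>d>0. \<forall>s. t1 \<le> s \<and> s < t \<and> t - d < s \<longrightarrow> p t y \<le> p s y)"
proof -
  let ?\<Gamma> = "contact_set t"
  have t01: "t \<in> {0..1}" using t' t by auto
  let ?P = "\<lambda>x D. ((\<lambda>s. f s x) has_real_derivative D) (at t within {0..1}) \<and> D \<le> C' \<and>
      (- L \<le> D \<longrightarrow> \<bar>det (mat 1 - (1 / (2 * A)) *\<^sub>R hess (f t) x)\<bar> \<le> J t x)"
  have "\<forall>x\<in>?\<Gamma>. \<exists>D. ?P x D"
  proof
    fix x assume "x \<in> ?\<Gamma>"
    then obtain y where "x \<in> X" "y \<in> Y" "\<And>z. z \<in> X \<Longrightarrow> v t y z \<le> v t y x" "c0 + L * (t0 - t) \<le> v t y x"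
      by (auto simp: contact_set_def)
    then show "\<exists>D. ?P x D" using contact_point(3)[OF t', of y x] by blast
  qed
  then obtain D where D: "\<And>x. x \<in> ?\<Gamma> \<Longrightarrow> ?P x (D x)" by metis
  have td: "twice_differentiable_at (f t) x" if "x \<in> ?\<Gamma>" for x
    using that contact_point(1)[OF t'] by (auto simp: contact_set_def)
  have cl: "?\<Gamma> \<in> sets borel"
    using compact_contact_set[OF t01] by (intro borel_closed compact_imp_closed)
  obtain s where s: "\<And>n. t1 \<le> s n" "\<And>n. s n < t" and slim: "s \<longlonglongrightarrow> t"
    using left_sequence[OF t'(1)] by metis
  define u where "u n x = (if x \<in> ?\<Gamma> then (f t x - f (s n) x) / (t - s n) else 0)" for n x
  define W where "W x = (if x \<in> ?\<Gamma> then D x else 0)" for x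
  \<comment> \<open>The time derivative is chosen pointwise; its measurability comes from being a
    limit of left difference quotients along one sequence of times.\<close>
  have "W \<in> borel_measurable borel"
  proof (rule borel_measurable_LIMSEQ_real)
    fix n
    have fm: "f r \<in> borel_measurable borel" if "r \<in> {0..1}" for r
      using that by (intro borel_measurable_continuous_onI continuous_on_f)
    have "s n \<in> {0..1}" using s[of n] t t01 by auto
    then show "u n \<in> borel_measurable borel"
      unfolding u_def using fm[OF t01] fm[of "s n"] cl by measurable
  next
    fix x
    show "(\<lambda>n. u n x) \<longlonglongrightarrow> W x"
    proof (cases "x \<in> ?\<Gamma>")
      case True
      have Dx: "((\<lambda>s. f s x) has_real_derivative D x) (at t within {0..1})" using D[OF True] by blast
      show ?thesis
      proof (rule LIMSEQ_I)
        fix e :: real assume e: "0 < e"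
        then have e2: "0 < e / 2" by simp
        obtain d where d: "d > 0" "\<forall>r. 0 \<le> r \<and> r < t \<and> t - d < r \<and> t \<le> 1 \<longrightarrow>
            \<bar>(f t x - f r x) - D x * (t - r)\<bar> \<le> e / 2 * (t - r)"
          using left_quotient_eventually[OF Dx e2] by blast
        have "\<forall>\<^sub>F n in sequentially. t - d < s n"
          using slim d(1) by (intro order_tendstoD) auto
        then obtain N where N: "\<And>n. N \<le> n \<Longrightarrow> t - d < s n" by (auto simp: eventually_sequentially)
        show "\<exists>no. \<forall>n\<ge>no. norm (u n x - W x) < e"
        proof (intro exI[of _ N] allI impI)
          fix n assume "N \<le> n"
          have "\<bar>(f t x - f (s n) x) - D x * (t - s n)\<bar> \<le> e / 2 * (t - s n)"
            using d(2) N[OF \<open>N \<le> n\<close>] s[of n] t t01 by auto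
          moreover have "u n x - W x = ((f t x - f (s n) x) - D x * (t - s n)) / (t - s n)"
            using True s[of n] by (simp add: u_def W_def field_simps)
          ultimately have "\<bar>u n x - W x\<bar> \<le> e / 2"
            using s[of n] by (simp add: abs_divide divide_le_eq)
          then show "norm (u n x - W x) < e" using e by simp
        qed
      qed
    qed (simp add: u_def W_def)
  qed
  then have "{x. - L \<le> W x} \<in> sets borel" by measurable
  then have Z: "?\<Gamma> \<inter> {x. - L \<le> W x} \<in> sets borel" (is "?Z \<in> _") using cl by blast
  define \<Theta> where "\<Theta> x = x - (1 / (2 * A)) *\<^sub>R grad (f t) x" for x
  define \<Theta>' where "\<Theta>' x = (*v) (mat 1 - (1 / (2 * A)) *\<^sub>R hess (f t) x)" for x
  have der: "(\<Theta> has_derivative \<Theta>' x) (at x within ?Z)" if "x \<in> ?Z" for x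
  proof -
    note td = td[of x]
    have "(\<Theta> has_derivative (\<lambda>h. h - (1 / (2 * A)) *\<^sub>R (transpose (hess (f t) x) *v h))) (at x)"
      unfolding \<Theta>_def
      by (intro has_derivative_diff has_derivative_ident has_derivative_scaleR_right has_derivative_grad_hess td)
        (use that in auto)
    moreover have "(\<lambda>h. h - (1 / (2 * A)) *\<^sub>R (transpose (hess (f t) x) *v h)) = \<Theta>' x"
      using hess_symmetric[OF td] that
      by (auto simp: \<Theta>'_def fun_eq_iff matrix_vector_mult_diff_rdistrib scaleR_matrix_vector_assoc)
    ultimately show ?thesis using has_derivative_at_withinI by metis
  qed
  have "\<bar>det (matrix (\<Theta>' x))\<bar> \<le> J t x" if "x \<in> ?Z" for x
    using that D[of x] by (auto simp: \<Theta>'_def W_def)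
  from borel_superset_image[OF Z der J(1)[OF t'] J(2) J(3)[OF t'] N' this]
  obtain E where E: "E \<in> sets borel" "\<Theta> ` ?Z \<subseteq> E" "emeasure lborel E \<le> ennreal N'" by blast
  have "\<exists>d>0. \<forall>s. t1 \<le> s \<and> s < t \<and> t - d < s \<longrightarrow> p t y \<le> p s y" if y: "y \<in> Y - E" for y
  proof (cases "p t y = 0")
    case True
    then show ?thesis using p_nonneg by (intro exI[of _ 1]) auto
  next
    case False
    then have "0 < p t y" using p_nonneg[of t y] by simp
    then obtain x where x: "x \<in> X" "\<And>z. z \<in> X \<Longrightarrow> v t y z \<le> v t y x" "c0 + L * (t0 - t) \<le> v t y x"
      "p t y = v t y x - (c0 + L * (t0 - t))" using p_pos_contact[OF t01] by blast
    have x\<Gamma>: "x \<in> ?\<Gamma>" using x y by (auto simp: contact_set_def)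
    have "\<Theta> x = y" unfolding \<Theta>_def using contact_point(2)[OF t' _ x(1,2,3)] y by blast
    then have "x \<notin> ?Z" using y E(2) by blast
    then have "D x < - L" using x\<Gamma> by (simp add: W_def)
    then have e: "0 < - L - D x" by simp
    have Dx: "((\<lambda>s. f s x) has_real_derivative D x) (at t within {0..1})" using D[OF x\<Gamma>] by blast
    obtain d where d: "d > 0" "\<forall>s. 0 \<le> s \<and> s < t \<and> t - d < s \<and> t \<le> 1 \<longrightarrow>
        \<bar>(f t x - f s x) - D x * (t - s)\<bar> \<le> (- L - D x) * (t - s)"
      using left_quotient_eventually[OF Dx e] by blast
    have "p t y \<le> p s y" if st: "t1 \<le> s \<and> s < t \<and> t - d < s" for s
    proof -
      have s01: "s \<in> {0..1}" using st t t01 by auto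
      have "(f t x - f s x) - D x * (t - s) \<le> (- L - D x) * (t - s)"
        using d(2)[rule_format, of s] st s01 t01 by (auto simp: abs_le_iff)
      moreover have "p t y - p s y \<le> f t x - f s x + L * (t - s)" by (rule p_diff_le[OF s01 x(1,4)])
      ultimately show ?thesis by (simp add: algebra_simps)
    qed
    then show ?thesis using d(1) by blast
  qed
  then show ?thesis using E by blast
qed

definition F :: "real \<Rightarrow> real" where
  "F s = (\<integral>y. indicator Y y * p s y \<partial>lborel)"

lemma integrable_p: "s \<in> {0..1} \<Longrightarrow> integrable lborel (\<lambda>y. indicator Y y * p s y)"
  using borel_integrable_compact[OF Y continuous_on_subset[OF continuous_on_p_space]] by simp

lemma Y_finite: "emeasure lborel Y < \<infinity>" "Y \<in> sets borel"
  using Y emeasure_compact_finite[OF Y] by (auto intro: borel_closed compact_imp_closed)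

lemma integrable_indicator_Y: "integrable lborel (\<lambda>y. c * indicator Y y :: real)"
  using Y_finite by (intro integrable_mult_right integrable_real_indicator) auto

lemma F_diff: "s \<in> {0..1} \<Longrightarrow> r \<in> {0..1} \<Longrightarrow> F r - F s = (\<integral>y. indicator Y y * (p r y - p s y) \<partial>lborel)"
  unfolding F_def by (subst Bochner_Integration.integral_diff[symmetric]) (auto simp: integrable_p right_diff_distrib)

lemma F_modulus:
  assumes "s \<in> {0..1}" "r \<in> {0..1}" "\<And>y. \<bar>p r y - p s y\<bar> \<le> e"
  shows "F r - F s \<le> e * measure lborel Y"
proof -
  have "F r - F s \<le> (\<integral>y. e * indicator Y y \<partial>lborel)"
    unfolding F_diff[OF assms(1,2)]
  proof (rule integral_mono)
    show "integrable lborel (\<lambda>y. indicator Y y * (p r y - p s y))"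
      using Bochner_Integration.integrable_diff[OF integrable_p[OF assms(2)] integrable_p[OF assms(1)]]
      by (simp add: right_diff_distrib)
    show "indicator Y y * (p r y - p s y) \<le> e * indicator Y y" for y
      using assms(3)[of y] by (auto simp: indicator_def abs_le_iff)
  qed (rule integrable_indicator_Y)
  also have "\<dots> = e * measure lborel Y" using Y_finite by simp
  finally show ?thesis .
qed

lemma continuous_on_F: "continuous_on {t1..t0} F"
  unfolding continuous_on_iff
proof (intro ballI allI impI)
  fix r e :: real assume r: "r \<in> {t1..t0}" and e: "0 < e"
  define m where "m = measure lborel Y"
  have m: "0 \<le> m" by (simp add: m_def)
  have e2: "0 < e / (2 * (1 + m))" using e m by simp
  obtain d where d: "d > 0" "\<And>t s y. t \<in> {0..1} \<Longrightarrow> s \<in> {0..1} \<Longrightarrow> \<bar>t - s\<bar> < d \<Longrightarrow> \<bar>p t y - p s y\<bar> \<le> e / (2 * (1 + m))"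
    using p_time_modulus[OF e2] by blast
  have "e / (2 * (1 + m)) * m \<le> e / 2" using e m by (simp add: field_simps)
  then have "e / (2 * (1 + m)) * m < e" using e by linarith
  then have "dist (F q) (F r) < e" if "q \<in> {t1..t0}" "dist q r < d" for q
  proof -
    assume small: "e / (2 * (1 + m)) * m < e"
    have 01: "q \<in> {0..1}" "r \<in> {0..1}" using r that t by auto
    have "F q - F r \<le> e / (2 * (1 + m)) * m" "F r - F q \<le> e / (2 * (1 + m)) * m"
      unfolding m_def[symmetric]
      using F_modulus[OF 01, of "e / (2 * (1 + m))"] F_modulus[OF 01(2,1), of "e / (2 * (1 + m))"]
        d(2)[OF 01] d(2)[OF 01(2,1)] that(2) by (auto simp: m_def dist_real_def abs_minus_commute)
    then show ?thesis using small by (simp add: dist_real_def abs_less_iff)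
  qed
  then show "\<exists>d>0. \<forall>q\<in>{t1..t0}. dist q r < d \<longrightarrow> dist (F q) (F r) < e" using d(1) by blast
qed

text \<open>Off the covering set \<open>E\<close> the positive parts of the quotients of
  \<open>p\<close> are eventually zero at each vertex, so their integral tends to zero by dominated
  convergence. On \<open>E\<close> the bound \<open>L + C'\<close> of \<open>p_growth\<close> is
  multiplied by a measure of at most \<open>N'\<close>.\<close>

lemma F_left_quotient:
  assumes t': "t1 < t" "t \<le> t0" and e: "0 < e"
  shows "\<exists>s\<ge>t1. s < t \<and> F t - F s \<le> ((L + C') * N' + e) * (t - s)"
proof -
  have t01: "t \<in> {0..1}" using t' t by auto
  obtain E where E: "E \<in> sets borel" "emeasure lborel E \<le> ennreal N'"
    and off: "\<And>y. y \<in> Y - E \<Longrightarrow> \<exists>d>0. \<forall>s. t1 \<le> s \<and> s < t \<and> t - d < s \<longrightarrow> p t y \<le> p s y"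
    using contact_image_cover[OF t'] by blast
  obtain s where s: "\<And>n. t1 \<le> s n" "\<And>n. s n < t" and slim: "s \<longlonglongrightarrow> t"
    using left_sequence[OF t'(1)] by metis
  have s01: "s n \<in> {0..1}" for n using s[of n] t t01 by auto
  define q where "q n y = max 0 ((p t y - p (s n) y) / (t - s n))" for n y
  have qb: "0 \<le> q n y" "y \<in> Y \<Longrightarrow> q n y \<le> L + C'" for n y
  proof -
    show "0 \<le> q n y" by (simp add: q_def)
    assume "y \<in> Y"
    then have "p t y - p (s n) y \<le> (L + C') * (t - s n)" using p_growth s[of n] t'(2) by (simp add: less_imp_le)
    then show "q n y \<le> L + C'" using s[of n] L C' by (simp add: q_def divide_le_eq)
  qed
  have pm: "p r \<in> borel_measurable borel" if "r \<in> {0..1}" for r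
    using that by (intro borel_measurable_continuous_onI continuous_on_p_space)
  have qm: "q n \<in> borel_measurable borel" for n
    unfolding q_def using pm[OF t01] pm[OF s01[of n]] by measurable
  have YE: "Y - E \<in> sets borel" "Y \<inter> E \<in> sets borel" using Y_finite(2) E(1) by auto
  have "(\<lambda>n. \<integral>y. indicator (Y - E) y * q n y \<partial>lborel) \<longlonglongrightarrow> (\<integral>y. 0 \<partial>(lborel :: (real^'n) measure))"
  proof (rule integral_dominated_convergence[where w = "\<lambda>y. (L + C') * indicator Y y"])
    show "(\<lambda>y. indicator (Y - E) y * q n y) \<in> borel_measurable lborel" for n
      using qm[of n] YE(1) by measurable
    show "integrable lborel (\<lambda>y. (L + C') * indicator Y y)" by (rule integrable_indicator_Y)
    show "AE y in lborel. norm (indicator (Y - E) y * q n y) \<le> (L + C') * indicator Y y" for n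
      using qb(1)[of n] qb(2)[where n=n] L C' by (auto simp: indicator_def)
    show "AE y in lborel. (\<lambda>n. indicator (Y - E) y * q n y) \<longlonglongrightarrow> 0"
    proof (intro AE_I2)
      fix y :: "real^'n"
      show "(\<lambda>n. indicator (Y - E) y * q n y) \<longlonglongrightarrow> 0"
      proof (cases "y \<in> Y - E")
        case True
        obtain d where d: "d > 0" "\<And>r. t1 \<le> r \<Longrightarrow> r < t \<Longrightarrow> t - d < r \<Longrightarrow> p t y \<le> p r y"
          using off[OF True] by blast
        have "\<forall>\<^sub>F n in sequentially. t - d < s n" using slim d(1) by (intro order_tendstoD) auto
        then have "\<forall>\<^sub>F n in sequentially. indicator (Y - E) y * q n y = 0"
        proof eventually_elim
          case (elim n)
          then have "p t y \<le> p (s n) y" using d(2) s[of n] by blast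
          then have "(p t y - p (s n) y) / (t - s n) \<le> 0"
            using s[of n] by (intro divide_nonpos_pos) auto
          then show ?case by (simp add: q_def)
        qed
        then show ?thesis by (rule tendsto_eventually)
      qed simp
    qed
  qed simp
  then have "(\<lambda>n. \<integral>y. indicator (Y - E) y * q n y \<partial>lborel) \<longlonglongrightarrow> 0" by simp
  from order_tendstoD(2)[OF this e]
  obtain n where n: "(\<integral>y. indicator (Y - E) y * q n y \<partial>lborel) < e"
    by (auto simp: eventually_sequentially)
  have i1: "integrable lborel (\<lambda>y. indicator (Y - E) y * q n y)"
  proof (rule Bochner_Integration.integrable_bound[OF integrable_indicator_Y[of "L + C'"]])
    show "(\<lambda>y. indicator (Y - E) y * q n y) \<in> borel_measurable lborel"
      using qm[of n] YE(1) by measurable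
    show "AE y in lborel. norm (indicator (Y - E) y * q n y) \<le> norm ((L + C') * indicator Y y)"
      using qb(1)[of n] qb(2)[where n=n] L C' by (auto simp: indicator_def)
  qed
  have "emeasure lborel (Y \<inter> E) \<le> emeasure lborel E" by (rule emeasure_mono) (use E in auto)
  then have em: "emeasure lborel (Y \<inter> E) \<le> ennreal N'" using E(2) by simp
  then have fin: "emeasure lborel (Y \<inter> E) < \<infinity>" using le_less_trans by fastforce
  have mE: "measure lborel (Y \<inter> E) \<le> N'" using em N' by (simp add: measure_def enn2real_leI)
  have i2: "integrable lborel (\<lambda>y. (L + C') * indicator (Y \<inter> E) y :: real)"
    using fin YE by (intro integrable_mult_right integrable_real_indicator) auto
  have "F t - F (s n) \<le> (\<integral>y. (t - s n) * (indicator (Y - E) y * q n y + (L + C') * indicator (Y \<inter> E) y) \<partial>lborel)"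
    unfolding F_diff[OF s01 t01]
  proof (rule integral_mono)
    show "integrable lborel (\<lambda>y. indicator Y y * (p t y - p (s n) y))"
      using Bochner_Integration.integrable_diff[OF integrable_p[OF t01] integrable_p[OF s01]]
      by (simp add: right_diff_distrib)
    show "integrable lborel (\<lambda>y. (t - s n) * (indicator (Y - E) y * q n y + (L + C') * indicator (Y \<inter> E) y))"
      by (intro integrable_mult_right Bochner_Integration.integrable_add i1 i2)
    fix y
    have pq: "p t y - p (s n) y \<le> (t - s n) * q n y"
    proof -
      have "(p t y - p (s n) y) / (t - s n) \<le> q n y" by (simp add: q_def)
      then show ?thesis using s[of n] by (simp add: divide_le_eq mult.commute)
    qed
    show "indicator Y y * (p t y - p (s n) y) \<le>
        (t - s n) * (indicator (Y - E) y * q n y + (L + C') * indicator (Y \<inter> E) y)"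
    proof (cases "y \<in> Y")
      case True
      have "(t - s n) * q n y \<le> (t - s n) * (L + C')"
        using qb(2)[OF True] s[of n] by (intro mult_left_mono) auto
      then show ?thesis using True pq by (auto simp: indicator_def)
    qed simp
  qed
  also have "\<dots> = (t - s n) * ((\<integral>y. indicator (Y - E) y * q n y \<partial>lborel) + (L + C') * measure lborel (Y \<inter> E))"
    using i1 i2 YE fin by simp
  also have "\<dots> \<le> (t - s n) * (e + (L + C') * N')"
    using n mE L C' s[of n] by (intro mult_left_mono add_mono) auto
  finally show ?thesis using s[of n] by (intro exI[of _ "s n"]) (auto simp: algebra_simps)
qed

text \<open>At the initial time the level lies above every paraboloid value, so \<open>F\<close>
  vanishes. At \<open>t0\<close> the single point \<open>x0\<close> gives excess at least \<sigma>
  for all vertices at once, because \<open>v t0 y x0\<close> does not depend on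
  \<open>y\<close>.\<close>

theorem measure_bound:
  assumes init: "\<And>x y. x \<in> X \<Longrightarrow> y \<in> Y \<Longrightarrow>
      f t1 x - A * (norm (x - y))\<^sup>2 + A * (norm (x0 - y))\<^sup>2 \<le> c0 + L * (t0 - t1)"
    and final: "c0 + \<sigma> \<le> f t0 x0" and x0: "x0 \<in> X"
  shows "\<sigma> * measure lborel Y \<le> (L + C') * N' * (t0 - t1)"
proof -
  have "F t0 - F t1 \<le> (L + C') * N' * (t0 - t1)"
    by (rule le_of_left_quotients[OF _ continuous_on_F]) (use t F_left_quotient in auto)
  moreover have "F t1 = 0"
  proof -
    have zero: "indicator Y y * p t1 y = (0 :: real)" for y
    proof (cases "y \<in> Y")
      case True
      have "t1 \<in> {0..1}" using t by auto
      then obtain x where "x \<in> X" "g t1 y = v t1 y x" using g_attained by metis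
      then show ?thesis using init[of x y] True by (simp add: p_def v_def)
    qed simp
    show ?thesis unfolding F_def zero by simp
  qed
  moreover have "\<sigma> * measure lborel Y \<le> F t0"
  proof -
    have t0: "t0 \<in> {0..1}" using t by auto
    have "(\<integral>y. \<sigma> * indicator Y y \<partial>lborel) \<le> F t0"
      unfolding F_def
    proof (rule integral_mono[OF integrable_indicator_Y integrable_p[OF t0]])
      fix y
      have "v t0 y x0 \<le> g t0 y" by (rule v_le_g[OF t0 x0])
      then have "\<sigma> \<le> p t0 y" using final by (simp add: p_def v_def)
      then show "\<sigma> * indicator Y y \<le> indicator Y y * p t0 y" by (simp add: indicator_def)
    qed
    then show ?thesis using Y_finite by simp
  qed
  ultimately show ?thesis by linarith
qed

end

section \<open>The parabolic inequality\<close>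

text \<open>For a continuous function the essential supremum dominates every value: a set where it
  were exceeded would be open and null, hence empty.\<close>

lemma Linf_norm_bounds:
  fixes g :: "'a::euclidean_space \<Rightarrow> real"
  assumes cont: "continuous_on UNIV g" and g: "\<And>x. 0 \<le> g x" "\<And>x. g x \<le> c"
  shows "g x \<le> Linf_norm g" "Linf_norm g \<le> c"
proof -
  let ?e = "esssup lborel (\<lambda>x. ereal \<bar>g x\<bar>)"
  have gm: "g \<in> borel_measurable borel" using cont by (rule borel_measurable_continuous_onI)
  have up: "?e \<le> ereal c"
    using gm g by (intro esssup_I) auto
  have lo: "ereal (g x) \<le> ?e" for x
  proof (rule ccontr)
    assume "\<not> ereal (g x) \<le> ?e"
    then have lt: "?e < ereal (g x)" by simp
    define U where "U = {y. ?e < ereal (g y)}"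
    have oU: "open U"
      unfolding U_def by (intro open_Collect_less continuous_on_const continuous_on_ereal cont)
    have "emeasure lborel {y \<in> space lborel. ereal \<bar>g y\<bar> > ?e} = 0" by (rule esssup_zero_measure)
    then have "emeasure lborel U = 0" using g(1) by (simp add: U_def)
    then have "U \<in> null_sets lborel" using oU by (simp add: null_sets_def)
    then have "U = {}" using open_not_negligible[OF oU]
      by (metis null_sets_completionI negligible_iff_null_sets)
    then show False using lt by (auto simp: U_def)
  qed
  have "\<bar>?e\<bar> \<noteq> \<infinity>" using up lo[of undefined] by (cases ?e) auto
  then have "ereal (Linf_norm g) = ?e" by (simp add: Linf_norm_def ereal_real')
  then show "g x \<le> Linf_norm g" "Linf_norm g \<le> c" using up lo[of x] by (metis ereal_less_eq(3))+
qed

lemma exp_two_less_nine: "exp 2 < (9 :: real)"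
proof -
  have "exp (1 :: real) < 3" using exp_le e_less_272 by linarith
  then have "exp (1 :: real) * exp 1 < 3 * 3" by (intro mult_strict_mono) auto
  then show ?thesis by (simp add: exp_add[symmetric])
qed

text \<open>The bound on \<open>t\<close> says \<open>Z powr (1/\<epsilon>) \<le> ln m\<close>,
  where \<open>Z\<close> is the desired lower bound for the power of the logarithm times
  \<open>exp B\<close>. The reserve \<open>exp B\<close> pays for replacing \<open>m\<close> by the
  nearby value \<open>s\<close>, uniformly in \<epsilon>; this is the origin of the factor
  \<open>exp (2 * (2 + c))\<close>.\<close>

lemma reaction_bound:
  fixes C c n t K m \<Lambda> \<epsilon> s :: real
  assumes n: "1 \<le> n" and t: "0 < t" "t \<le> 1" and pos: "0 < K" "0 < \<Lambda>" "0 < \<epsilon>"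
    and c: "c = max 1 C" and m: "m = K * t powr (- (n / 2))"
    and T: "t \<le> K powr (2 / n) * exp (- (2 / n) * (c * exp (2 * (2 + c)) * K powr (2 / n) / (1 + \<Lambda>)) powr (1 / \<epsilon>))"
    and s: "19 / 20 * m \<le> s" "s \<le> 21 / 20 * m"
  shows "C * (s powr (2 / n) / ln (1 + s) powr \<epsilon>) \<le> 4 * (1 + \<Lambda>) / t"
proof -
  define k where "k = K powr (2 / n)"
  define B where "B = 2 * (2 + c)"
  define Z where "Z = c * exp B * k / (1 + \<Lambda>)"
  have c1: "1 \<le> c" "C \<le> c" using c by auto
  have k: "0 < k" using pos by (simp add: k_def)
  have Z: "0 < Z" using c1 k pos by (simp add: Z_def)
  have m0: "0 < m" using pos t by (simp add: m)
  have mk: "m powr (2 / n) = k / t"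
  proof -
    have "m powr (2 / n) = K powr (2 / n) * (t powr (- (n / 2))) powr (2 / n)"
      using pos t unfolding m by (subst powr_mult) auto
    also have "(t powr (- (n / 2))) powr (2 / n) = t powr (- 1)"
      unfolding powr_powr using n by simp
    also have "t powr (- 1) = 1 / t" using t by (simp add: powr_neg_one)
    finally show ?thesis by (simp add: k_def)
  qed
  have lnm: "Z powr (1 / \<epsilon>) \<le> ln m"
  proof -
    have "t \<le> k * exp (- (2 / n) * Z powr (1 / \<epsilon>))" using T by (simp add: k_def Z_def B_def)
    then have "exp ((2 / n) * Z powr (1 / \<epsilon>)) \<le> k / t"
      using t k by (simp add: exp_minus field_simps)
    then have "(2 / n) * Z powr (1 / \<epsilon>) \<le> ln (m powr (2 / n))"
      using mk m0 k t by (subst ln_ge_iff) auto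
    then have "(2 / n) * Z powr (1 / \<epsilon>) \<le> (2 / n) * ln m" using m0 by (simp add: ln_powr)
    then show ?thesis using n by (simp add: divide_le_cancel)
  qed
  have lnm0: "0 < ln m" using lnm Z by (smt (verit) powr_gt_zero)
  then have m1: "1 < m" using m0 by (simp add: ln_gt_zero_iff)
  have Zl: "Z \<le> ln m powr \<epsilon>"
  proof -
    have "(Z powr (1 / \<epsilon>)) powr \<epsilon> \<le> ln m powr \<epsilon>"
      using lnm pos by (intro powr_mono2) auto
    then show ?thesis using Z pos by (simp add: powr_powr)
  qed
  have s0: "0 < s" using s m0 by linarith
  then have ls: "0 < ln (1 + s)" by simp
  have main: "c * k / (1 + \<Lambda>) \<le> ln (1 + s) powr \<epsilon>"
  \<comment> \<open>Exactly for these \<open>m\<close> the summand 1 compensates the factor 19/20,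
    since \<open>1 + 19/20 * m \<ge> m\<close>.\<close>
  proof (cases "m \<le> 20")
    case True
    then have "ln m \<le> ln (1 + s)" using s m0 by (subst ln_le_cancel_iff) auto
    then have "ln m powr \<epsilon> \<le> ln (1 + s) powr \<epsilon>" using lnm0 pos by (intro powr_mono2) auto
    moreover have "c * k / (1 + \<Lambda>) \<le> Z"
    proof -
      have "1 \<le> exp B" using c1 by (simp add: B_def)
      then have "c * k / (1 + \<Lambda>) * 1 \<le> c * k / (1 + \<Lambda>) * exp B"
        using c1 k pos by (intro mult_left_mono) auto
      then show ?thesis by (simp add: Z_def algebra_simps)
    qed
    ultimately show ?thesis using Zl by linarith
  next
    case False
    define l where "l = ln m"
    have big: "2 \<le> ln (19 / 20 * m)"
      using False exp_two_less_nine by (subst ln_ge_iff) auto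
    have "ln (19 / 20 * m) = l + ln (19 / 20)" using m0 unfolding l_def by (subst ln_mult_pos) auto
    moreover have "ln (19 / 20 :: real) \<ge> - (1 / 19)"
      using ln_le_minus_one[of "20 / 19 :: real"] by (simp add: ln_div)
    moreover have "ln (19 / 20 * m) \<le> ln (1 + s)" using s m0 by (subst ln_le_cancel_iff) auto
    moreover have "ln (19 / 20 :: real) < 0" by simp
    ultimately have lb: "l - 1 / 19 \<le> ln (1 + s)" "2 \<le> ln (1 + s)" "2 \<le> l" using big by linarith+
    show ?thesis
    \<comment> \<open>The logarithm loses at most 1/19, a relative loss of
      \<open>u = 1 / (19 * l)\<close>, which the power \<epsilon> turns into a factor of at least
      \<open>exp (- 2 * u * \<epsilon>)\<close>. As long as \<epsilon> is at most
      \<open>B * l\<close>, this factor is at least \<open>exp (- B)\<close>.\<close>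
    proof (cases "\<epsilon> \<le> B * l")
      case True
      define u where "u = 1 / (19 * l)"
      have u: "0 < u" "u \<le> 1 / 2" using lb by (auto simp: u_def field_simps)
      have "exp (- (2 * u)) \<le> 1 - u"
      proof -
        have "1 + 2 * u \<le> exp (2 * u)" by (rule exp_ge_add_one_self)
        then have "exp (- (2 * u)) \<le> 1 / (1 + 2 * u)" using u by (simp add: exp_minus field_simps)
        also have "\<dots> \<le> 1 - u"
        proof -
          have "u * u \<le> u * (1 / 2)" using u by (intro mult_left_mono) auto
          then have "1 \<le> (1 - u) * (1 + 2 * u)" by (simp add: algebra_simps)
          then show ?thesis using u by (simp add: divide_le_eq)
        qed
        finally show ?thesis .
      qed
      then have "l * exp (- (2 * u)) \<le> l * (1 - u)" using lb by (intro mult_left_mono) auto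
      also have "l * (1 - u) = l - 1 / 19" using lb by (simp add: u_def field_simps)
      also note lb(1)
      finally have "(l * exp (- (2 * u))) powr \<epsilon> \<le> ln (1 + s) powr \<epsilon>"
        using lb pos by (intro powr_mono2) auto
      moreover have "(l * exp (- (2 * u))) powr \<epsilon> = l powr \<epsilon> * exp (- (2 * u) * \<epsilon>)"
        using lb by (simp add: powr_mult) (simp add: powr_def mult.commute)
      moreover have "exp (- B) \<le> exp (- (2 * u) * \<epsilon>)"
      proof -
        have "2 * u * \<epsilon> \<le> 2 * u * (B * l)" using u True by (intro mult_left_mono) auto
        also have "\<dots> = 2 * B / 19" using lb by (simp add: u_def)
        also have "\<dots> \<le> B" using c1 by (simp add: B_def)
        finally show ?thesis by simp
      qed
      then have "Z * exp (- B) \<le> l powr \<epsilon> * exp (- (2 * u) * \<epsilon>)"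
        using Zl Z by (intro mult_mono) (auto simp: l_def)
      moreover have "Z * exp (- B) = c * k / (1 + \<Lambda>)" by (simp add: Z_def exp_minus)
      ultimately show ?thesis by linarith
    next
      case False
      have ln2: "1 / 2 \<le> ln (2 :: real)" using ln_le_minus_one[of "1 / 2 :: real"] by (simp add: ln_div)
      \<comment> \<open>For larger \<epsilon> the comparison with \<open>m\<close> is abandoned: the
        logarithm is at least 2, and \<open>2 powr \<epsilon>\<close> already exceeds
        \<open>c * m powr 2\<close>, which dominates \<open>c * k\<close> because
        \<open>t \<le> 1\<close>.\<close>
      have "(2 + c) * l \<le> ln 2 * \<epsilon>"
      proof -
        have "(2 + c) * l = 1 / 2 * (B * l)" by (simp add: B_def)
        also have "\<dots> \<le> ln 2 * \<epsilon>" using ln2 False lb c1 by (intro mult_mono) (auto simp: B_def)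
        finally show ?thesis .
      qed
      then have "exp ((2 + c) * l) \<le> 2 powr \<epsilon>" by (simp add: powr_def mult.commute)
      also have "\<dots> \<le> ln (1 + s) powr \<epsilon>" using lb pos by (intro powr_mono2) auto
      finally have e1: "exp ((2 + c) * l) \<le> ln (1 + s) powr \<epsilon>" .
      have "c * 1 \<le> c * l" using c1 lb by (intro mult_left_mono) auto
      then have "c \<le> exp (c * l)" using exp_ge_add_one_self[of "c * l"] by linarith
      moreover have "k / (1 + \<Lambda>) \<le> exp (2 * l)"
      proof -
        have "k / (1 + \<Lambda>) \<le> k" using k pos by (simp add: divide_le_eq)
        also have "k = m powr (2 / n) * t" using mk t by simp
        also have "\<dots> \<le> m powr (2 / n) * 1" using t by (intro mult_left_mono) auto
        also have "m powr (2 / n) \<le> m powr 2"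
          using m1 n by (intro powr_mono) (auto simp: divide_le_eq)
        also have "m powr 2 = exp (2 * l)" using m0 by (simp add: powr_def l_def)
        finally show ?thesis by simp
      qed
      ultimately have "c * (k / (1 + \<Lambda>)) \<le> exp (c * l) * exp (2 * l)"
        using c1 k pos by (intro mult_mono) auto
      then show ?thesis using e1 by (simp add: exp_add[symmetric] algebra_simps)
    qed
  qed
  have sp: "s powr (2 / n) \<le> 4 * (k / t)"
  proof -
    have 21: "(21 / 20 :: real) powr (2 / n) \<le> 4"
    proof -
      have "(21 / 20 :: real) powr (2 / n) \<le> (21 / 20) powr 2"
        using n by (intro powr_mono) (auto simp: divide_le_eq)
      also have "\<dots> \<le> 4" by (simp add: power2_eq_square)
      finally show ?thesis .
    qed
    have "s powr (2 / n) \<le> (21 / 20 * m) powr (2 / n)" using s s0 n by (intro powr_mono2) auto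
    also have "\<dots> = (21 / 20) powr (2 / n) * m powr (2 / n)" by (rule powr_mult)
    also note mk
    also have "(21 / 20) powr (2 / n) * (k / t) \<le> 4 * (k / t)" using 21 k t by (intro mult_right_mono) auto
    finally show ?thesis .
  qed
  have lp: "0 < ln (1 + s) powr \<epsilon>" using ls by simp
  have "C * (s powr (2 / n) / ln (1 + s) powr \<epsilon>) \<le> c * (s powr (2 / n) / ln (1 + s) powr \<epsilon>)"
    using c1 by (intro mult_right_mono) auto
  also have "\<dots> \<le> c * (4 * (k / t) / ln (1 + s) powr \<epsilon>)"
    using c1 sp lp by (intro mult_left_mono divide_right_mono) auto
  also have "\<dots> = (c * k) * (4 / t) / ln (1 + s) powr \<epsilon>" by simp
  also have "\<dots> \<le> (1 + \<Lambda>) * (4 / t)"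
  proof -
    have "c * k \<le> (1 + \<Lambda>) * ln (1 + s) powr \<epsilon>" using main pos by (simp add: divide_le_eq mult.commute)
    then have "c * k * (4 / t) \<le> (1 + \<Lambda>) * ln (1 + s) powr \<epsilon> * (4 / t)" using t by (intro mult_right_mono) auto
    then show ?thesis unfolding pos_divide_le_eq[OF lp] by (simp only: mult_ac)
  qed
  finally show ?thesis by (simp add: mult.commute)
qed

text \<open>A box with one axis along \<open>e\<close>, of half-length \<open>U\<close> there and
  \<open>V / n\<close> in the other directions, so that the sum of the transverse coordinates stays
  below \<open>V\<close>. The direction \<open>e\<close> will be the radial one when the paraboloids
  are tilted.\<close>

lemma oriented_box:
  fixes e y0 :: "real^'n"
  assumes e: "norm e = 1" and UV: "0 < U" "0 < V"
  shows "\<exists>Y. compact Y \<and> (\<forall>y\<in>Y. \<bar>(y - y0) \<bullet> e\<bar> \<le> U \<and> norm (y - y0 - ((y - y0) \<bullet> e) *\<^sub>R e) \<le> V) \<and>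
    2 ^ CARD('n) * U * (V / real CARD('n)) ^ (CARD('n) - 1) \<le> measure lborel Y"
proof -
  let ?n = "CARD('n)"
  obtain k :: 'n where True by simp
  obtain P :: "real^'n^'n" where P: "orthogonal_matrix P" "P *v axis k 1 = e"
    using orthogonal_matrix_exists_basis[OF e] by blast
  have PT: "transpose P ** P = mat 1" "P ** transpose P = mat 1" using P(1) by (auto simp: orthogonal_matrix_def)
  define l where "l i = (if i = k then U else V / ?n)" for i
  have l: "0 < l i" for i using UV by (simp add: l_def)
  define M where "M = P ** diag_mat l"
  define M' where "M' = diag_mat (\<lambda>i. 1 / l i) ** transpose P"
  have dd: "diag_mat (\<lambda>i. 1 / l i) ** diag_mat l = mat 1"
  proof -
    have "1 / l i * l i = 1" for i using l[of i] by simp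
    then show ?thesis unfolding diag_mat_mult by (simp add: diag_mat_def mat_def)
  qed
  have M'M: "M' ** M = mat 1"
  proof -
    have "M' ** M = diag_mat (\<lambda>i. 1 / l i) ** (transpose P ** P) ** diag_mat l"
      by (simp add: M_def M'_def matrix_mul_assoc)
    then show ?thesis by (simp add: PT dd)
  qed
  let ?Q = "cbox (\<chi> i. - 1) (\<chi> i. 1) :: (real^'n) set"
  define Y where "Y = (\<lambda>w. y0 + M *v w) ` ?Q"
  have cY: "compact Y"
    unfolding Y_def by (intro compact_continuous_image continuous_intros matrix_vector_mult_linear_continuous_on) auto
  have inY: "\<bar>(y - y0) \<bullet> e\<bar> \<le> U \<and> norm (y - y0 - ((y - y0) \<bullet> e) *\<^sub>R e) \<le> V" if y: "y \<in> Y" for y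
  proof -
    obtain w where w: "y = y0 + M *v w" "\<And>i. \<bar>w $ i\<bar> \<le> 1"
      using y by (auto simp: Y_def mem_box_cart abs_le_iff)
    define z where "z = diag_mat l *v w"
    have z: "z $ i = l i * w $ i" for i
      by (simp add: z_def diag_mat_def matrix_vector_mult_def if_distrib[of "\<lambda>x. x * _"] cong: if_cong)
    have yz: "y - y0 = P *v z" by (simp add: w(1) M_def z_def matrix_vector_mul_assoc)
    have iso: "(P *v x) \<bullet> (P *v x') = x \<bullet> x'" for x x'
      by (metis PT(1) dot_lmul_matrix matrix_vector_mul_assoc matrix_vector_mul_lid vector_transpose_matrix transpose_transpose)
    have ze: "(y - y0) \<bullet> e = z $ k"
      unfolding yz P(2)[symmetric] iso by (simp add: inner_axis)
    have "\<bar>U * w $ k\<bar> \<le> U * 1" using w(2)[of k] UV unfolding abs_mult by (intro mult_mono) auto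
    then have 1: "\<bar>(y - y0) \<bullet> e\<bar> \<le> U" by (simp add: ze z l_def)
    have "y - y0 - ((y - y0) \<bullet> e) *\<^sub>R e = P *v (z - (z $ k) *\<^sub>R axis k 1)"
      unfolding ze by (simp add: yz P(2)[symmetric] matrix_vector_mult_diff_distrib matrix_vector_mult_scaleR)
    then have "norm (y - y0 - ((y - y0) \<bullet> e) *\<^sub>R e) = norm (z - (z $ k) *\<^sub>R axis k 1)"
      by (simp add: norm_eq_sqrt_inner iso)
    also have "\<dots> \<le> (\<Sum>i\<in>UNIV. \<bar>(z - (z $ k) *\<^sub>R axis k 1) $ i\<bar>)" by (rule norm_le_l1_cart)
    also have "\<dots> \<le> (\<Sum>i\<in>(UNIV :: 'n set). V / ?n)"
    proof (rule sum_mono)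
      fix i
      have "\<bar>V / ?n * w $ i\<bar> \<le> V / ?n * 1" using w(2)[of i] UV unfolding abs_mult by (intro mult_mono) auto
      then show "\<bar>(z - (z $ k) *\<^sub>R axis k 1) $ i\<bar> \<le> V / ?n" using UV by (auto simp: z l_def axis_def)
    qed
    also have "\<dots> = V" by simp
    finally show ?thesis using 1 by blast
  qed
  define D where "D = U * (V / ?n) ^ (?n - 1)"
  have D: "0 < D" using UV by (simp add: D_def)
  have "det (diag_mat (\<lambda>i. 1 / l i)) = 1 / D"
  proof -
    have "(\<Prod>i\<in>UNIV. l i) = l k * (\<Prod>i\<in>UNIV - {k}. l i)" by (rule prod.remove) auto
    also have "(\<Prod>i\<in>UNIV - {k}. l i) = (\<Prod>i\<in>UNIV - {k}. V / ?n)" by (rule prod.cong) (auto simp: l_def)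
    also have "\<dots> = (V / ?n) ^ (?n - 1)" by (simp add: card_Diff_singleton)
    finally show ?thesis by (simp add: det_diag_mat prod_dividef D_def l_def)
  qed
  moreover have "\<bar>det (transpose P)\<bar> = 1" using det_orthogonal_matrix[OF P(1)] by auto
  ultimately have detM': "\<bar>det M'\<bar> = 1 / D" using D by (simp add: M'_def det_mul abs_mult)
  have Yb: "Y \<in> sets borel" using cY by (intro borel_closed compact_imp_closed)
  have fin: "emeasure lborel Y = ennreal (measure lborel Y)"
    using emeasure_compact_finite[OF cY] by (simp add: emeasure_eq_ennreal_measure less_top)
  have "(\<integral>\<^sup>+ x. ennreal (1 / D * indicator Y x) \<partial>lborel) = ennreal (1 / D) * emeasure lborel Y"
  proof -
    have "ennreal (1 / D * indicator Y x) = ennreal (1 / D) * indicator Y x" for x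
      by (auto simp: indicator_def)
    then show ?thesis using Yb by (simp only: nn_integral_cmult_indicator sets_lborel)
  qed
  also have "\<dots> = ennreal (1 / D * measure lborel Y)" using D by (simp only: fin) (subst ennreal_mult, auto)
  finally have int: "(\<integral>\<^sup>+ x. ennreal (1 / D * indicator Y x) \<partial>lborel) \<le> ennreal (1 / D * measure lborel Y)" by simp
  have der: "((\<lambda>y. M' *v (y - y0)) has_derivative (*v) M') (at y within Y)" for y
    by (auto intro!: derivative_eq_intros has_derivative_compose[of _ _ _ _ "(*v) M'"] bounded_linear_imp_has_derivative
        simp: matrix_vector_mult_diff_distrib linear_conv_bounded_linear[symmetric])
  \<comment> \<open>The volume is bounded from below by mapping the box back to the unit cube: the
    covering lemma for images replaces a separate change of variables.\<close>
  have "\<exists>E\<in>sets borel. (\<lambda>y. M' *v (y - y0)) ` Y \<subseteq> E \<and> emeasure lborel E \<le> ennreal (1 / D * measure lborel Y)"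
    by (rule borel_superset_image[OF Yb der _ _ int]) (use D Yb detM' in auto)
  then obtain E where E: "E \<in> sets borel" "(\<lambda>y. M' *v (y - y0)) ` Y \<subseteq> E"
    "emeasure lborel E \<le> ennreal (1 / D * measure lborel Y)" by blast
  have "?Q \<subseteq> E"
  proof
    fix w assume w: "w \<in> ?Q"
    have "M' *v (M *v w) = w" by (simp add: matrix_vector_mul_assoc M'M)
    then have "w = (\<lambda>y. M' *v (y - y0)) (y0 + M *v w)" by simp
    then show "w \<in> E" using E(2) w unfolding Y_def by blast
  qed
  then have "emeasure lborel ?Q \<le> emeasure lborel E" by (rule emeasure_mono) (use E in auto)
  also note E(3)
  also have "emeasure lborel ?Q = ennreal (2 ^ ?n)"
    by (subst emeasure_lborel_cbox) (auto simp: prod_Basis_vec inner_axis dest!: axis_in_Basis_D)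
  finally have "2 ^ ?n \<le> 1 / D * measure lborel Y" using D by (simp add: ennreal_le_iff)
  then have "2 ^ ?n * D \<le> measure lborel Y" using D by (simp add: field_simps)
  then show ?thesis using cY inY by (intro exI[of _ Y]) (auto simp: D_def mult.assoc)
qed

section \<open>The standing assumptions and the mass estimate over one time interval\<close>

lemma one_plus_norm: "1 \<le> 1 + norm (x :: 'a::real_normed_vector)" "0 < 1 + norm x"
  using norm_ge_zero[of x] by linarith+

text \<open>Here \<beta> is at most 1, so that \<open>min (2 * \<beta>) 2\<close> is simply
  \<open>2 * \<beta>\<close>; the general case enters with \<open>min \<beta> 1\<close>.\<close>

locale parabolic_setting =
  fixes f :: "real \<Rightarrow> real^'n \<Rightarrow> real" and a :: "real \<Rightarrow> real^'n \<Rightarrow> real^'n^'n"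
    and C \<epsilon> \<delta> \<Lambda> N \<beta> \<kappa> :: real
  assumes bdd: "bounded ((\<lambda>(t, x). f t x) ` ({0..1} \<times> UNIV))"
    and cont: "continuous_on ({0..1} \<times> UNIV) (\<lambda>(t, x). f t x)"
    and pos: "0 < \<epsilon>" "0 < \<delta>" "0 < \<Lambda>" "0 < N" and \<beta>1: "\<beta> \<le> 1"
    and ineq: "satisfies_inequality a C \<epsilon> f"
    and ell: "locally_uniformly_elliptic a"
    and det_ge: "\<And>t x. t \<in> {0..1} \<Longrightarrow> \<delta> * (1 + norm x) powr (\<beta> * real CARD('n) - \<kappa>) \<le> det (a t x)"
    and a_le: "\<And>t x. t \<in> {0..1} \<Longrightarrow> mat_le (a t x) ((\<Lambda> * (1 + norm x) powr (2 * \<beta>)) *\<^sub>R mat 1)"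
    and mass: "\<And>t. t \<in> {0..1} \<Longrightarrow>
      (\<integral>\<^sup>+ x. ennreal ((1 + norm x) powr \<kappa> * max 0 (f t x)) \<partial>lborel) \<le> ennreal N"
begin

definition growth :: "real \<Rightarrow> real" where
  "growth t = C * (Linf_norm (\<lambda>y. max 0 (f t y)) powr (2 / real CARD('n))
     / ln (1 + Linf_norm (\<lambda>y. max 0 (f t y))) powr \<epsilon>)"

lemma continuous_on_slice: "t \<in> {0..1} \<Longrightarrow> continuous_on S (f t)"
proof -
  assume "t \<in> {0..1}"
  then have "continuous_on S (\<lambda>x. (\<lambda>(t, x). f t x) (t, x))"
    by (intro continuous_on_compose2[OF cont] continuous_on_Pair continuous_on_const continuous_on_id) auto
  then show ?thesis by simp
qed

lemma a_elliptic:
  assumes "t \<in> {0..1}"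
  shows "transpose (a t x) = a t x" "0 \<le> \<xi> \<bullet> (a t x *v \<xi>)" "0 < det (a t x)"
proof -
  have "compact {(t, x)}" "{(t, x)} \<subseteq> {0..1} \<times> UNIV" using assms by auto
  then have "\<exists>l u. 0 < l \<and> l \<le> u \<and> (\<forall>(t, x)\<in>{(t, x)}. mat_le (l *\<^sub>R mat 1) (a t x) \<and> mat_le (a t x) (u *\<^sub>R mat 1))"
    using ell unfolding locally_uniformly_elliptic_def by blast
  then obtain l where l: "0 < l" "mat_le (l *\<^sub>R mat 1) (a t x)" by auto
  then show "transpose (a t x) = a t x" by (simp add: mat_le_def)
  have "\<xi> \<bullet> ((l *\<^sub>R mat 1) *v \<xi>) \<le> \<xi> \<bullet> (a t x *v \<xi>)" using l(2) by (simp add: mat_le_def)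
  moreover have "\<xi> \<bullet> ((l *\<^sub>R mat 1) *v \<xi>) = l * (\<xi> \<bullet> \<xi>)"
    by (simp add: scaleR_matrix_vector_assoc[symmetric])
  moreover have "0 \<le> l * (\<xi> \<bullet> \<xi>)" using l(1) by simp
  ultimately show "0 \<le> \<xi> \<bullet> (a t x *v \<xi>)" by linarith
  have "0 < \<delta> * (1 + norm x) powr (\<beta> * real CARD('n) - \<kappa>)" using pos one_plus_norm(2)[of x] by simp
  then show "0 < det (a t x)" using det_ge[OF assms, of x] by linarith
qed

lemma trace_a_le:
  assumes "t \<in> {0..1}"
  shows "trace (a t x) \<le> real CARD('n) * (\<Lambda> * (1 + norm x) powr (2 * \<beta>))"
proof -
  have "a t x $ i $ i \<le> \<Lambda> * (1 + norm x) powr (2 * \<beta>)" for i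
  proof -
    have "\<xi> \<bullet> (a t x *v \<xi>) \<le> \<xi> \<bullet> (((\<Lambda> * (1 + norm x) powr (2 * \<beta>)) *\<^sub>R mat 1) *v \<xi>)" for \<xi>
      using a_le[OF assms, of x] by (simp add: mat_le_def)
    from this[of "axis i 1"] show ?thesis
      by (simp add: scaleR_matrix_vector_assoc[symmetric] matrix_vector_mult_basis inner_axis' column_def mat_def)
  qed
  then have "trace (a t x) \<le> (\<Sum>i\<in>(UNIV :: 'n set). \<Lambda> * (1 + norm x) powr (2 * \<beta>))"
    unfolding trace_def by (intro sum_mono)
  then show ?thesis by simp
qed

lemma pointwise_inequality:
  assumes "t \<in> {0..1}" "0 < f t x"
  shows "twice_differentiable_at (f t) x"
    "\<exists>D. ((\<lambda>s. f s x) has_real_derivative D) (at t within {0..1}) \<and>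
       D \<le> trace (a t x ** hess (f t) x) + growth t * f t x"
proof -
  note point = ineq[unfolded satisfies_inequality_def, rule_format, OF assms, folded growth_def]
  show td: "twice_differentiable_at (f t) x" using point by (rule conjunct1)
  obtain D where D: "((\<lambda>s. f s x) has_real_derivative D) (at t within {0..1})"
    "D \<le> (\<Sum>i\<in>UNIV. \<Sum>j\<in>UNIV. a t x $ i $ j * partial_deriv i (partial_deriv j (f t)) x) + growth t * f t x"
    using conjunct2[OF point] by (elim exE conjE)
  have sym: "hess (f t) x $ i $ j = hess (f t) x $ j $ i" for i j
  proof -
    have "transpose (hess (f t) x) $ i $ j = hess (f t) x $ i $ j" by (simp only: hess_symmetric[OF td])
    then show ?thesis by (simp add: transpose_def)
  qed
  have "trace (a t x ** hess (f t) x) = (\<Sum>i\<in>UNIV. \<Sum>j\<in>UNIV. a t x $ i $ j * hess (f t) x $ j $ i)"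
    by (simp only: trace_def matrix_matrix_mult_def vec_lambda_beta)
  also have "\<dots> = (\<Sum>i\<in>UNIV. \<Sum>j\<in>UNIV. a t x $ i $ j * partial_deriv i (partial_deriv j (f t)) x)"
  proof (intro sum.cong refl)
    fix i j
    show "a t x $ i $ j * hess (f t) x $ j $ i = a t x $ i $ j * partial_deriv i (partial_deriv j (f t)) x"
      by (subst sym) (simp add: hess_def)
  qed
  finally show "\<exists>D. ((\<lambda>s. f s x) has_real_derivative D) (at t within {0..1}) \<and>
       D \<le> trace (a t x ** hess (f t) x) + growth t * f t x" using D by metis
qed

text \<open>The weighted mass \<open>N\<close> applied to \<open>measure_bound\<close> on a time
  interval of relative length \<open>e0 * E\<close>, with final excess \<open>w0 * E * m\<close>.
  \<open>q\<close> stands for \<open>(1 + |x0|) powr (-\<beta>)\<close>, and \<theta> measures how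
  far the weight at a contact point may differ from it. All choices of lengths are left to the two
  cases in which it is used.\<close>

lemma mass_step:
  fixes t0 m E e0 w0 g \<theta> q :: real
  defines "n \<equiv> real CARD('n)"
  defines "A \<equiv> g * m * q\<^sup>2 / t0" and "t1 \<equiv> t0 * (1 - e0 * E)"
    and "c1 \<equiv> 9 / e0 + 2 * g * n * \<theta>\<^sup>2 + 8"
  assumes t0: "0 < t0" "t0 \<le> 1" and m: "0 < m" and E: "0 < E" "E \<le> 1" and e0: "0 < e0" "e0 \<le> 1"
    and w0: "0 < w0" "w0 \<le> 1" and g: "0 < g" and \<theta>: "0 < \<theta>" and q: "0 < q"
    and X: "compact X" "x0 \<in> X" and Y: "compact Y"
    and contact: "\<And>t x y. t1 < t \<Longrightarrow> t \<le> t0 \<Longrightarrow> x \<in> X \<Longrightarrow> y \<in> Y \<Longrightarrow>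
        f t0 x0 - w0 * E * m \<le> f t x - A * (norm (x - y))\<^sup>2 + A * (norm (x0 - y))\<^sup>2 \<Longrightarrow>
        x \<in> interior X \<and> (1 + norm x) powr (- \<beta>) \<le> \<theta> * q \<and> q \<le> \<theta> * (1 + norm x) powr (- \<beta>) \<and>
        m / 2 \<le> f t x \<and> f t x \<le> 2 * m \<and> growth t \<le> 4 * (1 + \<Lambda>) / t0"
    and init: "\<And>x y. x \<in> X \<Longrightarrow> y \<in> Y \<Longrightarrow>
        f t1 x - A * (norm (x - y))\<^sup>2 + A * (norm (x0 - y))\<^sup>2 \<le> f t0 x0 + 8 * E * m"
  shows "w0 * m * measure lborel Y \<le>
    2 * e0 * c1 * (c1 * \<theta> / (2 * g * n)) ^ CARD('n) * ((1 + \<Lambda>) ^ (CARD('n) + 1) * N / \<delta>) / q ^ CARD('n)"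
proof -
  let ?n = "CARD('n)"
  have n: "0 < n" by (simp add: n_def)
  define h where "h = e0 * E"
  have "e0 * E \<le> 1 * 1" using E e0 by (intro mult_mono) auto
  then have h: "0 < h" "h \<le> 1" using E e0 by (auto simp: h_def)
  have t1: "0 \<le> t1" "t1 < t0" "t0 - t1 = h * t0"
  proof -
    have t1h: "t1 = t0 - h * t0" by (simp add: t1_def h_def algebra_simps)
    have "0 < h * t0" "h * t0 \<le> 1 * t0" using t0 h by (simp, intro mult_right_mono) auto
    then show "0 \<le> t1" "t1 < t0" "t0 - t1 = h * t0" unfolding t1h by linarith+
  qed
  have A: "0 < A" using g m q t0 by (simp add: A_def)
  \<comment> \<open>The total rate \<open>L + C'\<close>. The summands of \<open>c1\<close> come
    from the falling level (\<open>9 / e0\<close>), from \<open>2 * A * trace a\<close>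
    (\<open>2 * g * n * \<theta>\<^sup>2\<close>) and from the reaction, which is at most
    \<open>4 * (1 + \<Lambda>) / t0\<close> times \<open>2 * m\<close> (the 8).\<close>
  define S where "S = c1 * (1 + \<Lambda>) * (m / t0)"
  \<comment> \<open>Over the interval the level falls by \<open>9 * E * m\<close>: eight parts for
    the initial bound, one to absorb \<open>w0 * E * m\<close>.\<close>
  define L where "L = 9 * m / (e0 * t0)"
  define C' where "C' = S - L"
  have L: "0 \<le> L" using m e0 t0 by (simp add: L_def)
  have mt: "0 < m / t0" using m t0 by simp
  have C'ge: "(2 * g * n * \<theta>\<^sup>2 + 8) * (1 + \<Lambda>) * (m / t0) \<le> C'"
  proof -
    have "9 / e0 * 1 * (m / t0) \<le> 9 / e0 * (1 + \<Lambda>) * (m / t0)"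
      using e0 pos mt by (intro mult_right_mono mult_left_mono) auto
    moreover have "L = 9 / e0 * 1 * (m / t0)" by (simp add: L_def)
    ultimately show ?thesis by (simp only: C'_def S_def c1_def) (simp add: algebra_simps)
  qed
  have C': "0 \<le> C'"
  proof -
    have "0 \<le> (2 * g * n * \<theta>\<^sup>2 + 8) * (1 + \<Lambda>) * (m / t0)"
      using g n pos mt by (intro mult_nonneg_nonneg add_nonneg_nonneg) auto
    then show ?thesis using C'ge by linarith
  qed
  have LC: "L + C' = S" by (simp add: C'_def)
  have S: "0 < S" using L C' LC m e0 t0 by (smt (verit) L_def divide_pos_pos mult_pos_pos)
  \<comment> \<open>The first factor is the bound of the inequality of means divided by
    \<open>(2 * A) ^ n\<close>. The second dominates \<open>1 / det a\<close> relative to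
    \<open>(1 + |x|) powr \<kappa> * f\<close>, by \<open>f \<ge> m / 2\<close> and the comparison
    of weights.\<close>
  define P where "P = (S / (2 * A * n)) ^ ?n * (2 * \<theta> ^ ?n * q ^ ?n / (\<delta> * m))"
  have P: "0 < P" using S A n \<theta> q pos m by (simp add: P_def)
  define J where "J t x = P * ((1 + norm x) powr \<kappa> * max 0 (f t x))" for t and x :: "real^'n"
  interpret pc: paraboloid_contact f a J X Y x0 t1 t0 A "f t0 x0 - w0 * E * m" L C' "P * N"
  proof
    show "0 \<le> t1" "t1 < t0" "t0 \<le> 1" using t1 t0 by auto
    show "compact X" "X \<noteq> {}" "compact Y" using X Y by auto
    show "0 \<le> P * N" using P pos by simp
    show "0 \<le> J t x" for t x using P by (simp add: J_def)
    show Jm: "J t \<in> borel_measurable borel" if "t1 < t" "t \<le> t0" for t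
    proof -
      have "t \<in> {0..1}" using that t1 t0 by auto
      then have "f t \<in> borel_measurable borel"
        by (intro borel_measurable_continuous_onI continuous_on_slice)
      then show ?thesis unfolding J_def by measurable
    qed
    show "(\<integral>\<^sup>+ x. ennreal (J t x) \<partial>lborel) \<le> ennreal (P * N)" if "t1 < t" "t \<le> t0" for t
    proof -
      have t: "t \<in> {0..1}" using that t1 t0 by auto
      then have "f t \<in> borel_measurable borel"
        by (intro borel_measurable_continuous_onI continuous_on_slice)
      then have "(\<integral>\<^sup>+ x. ennreal (J t x) \<partial>lborel) =
          ennreal P * (\<integral>\<^sup>+ x. ennreal ((1 + norm x) powr \<kappa> * max 0 (f t x)) \<partial>lborel)"
        unfolding J_def using P by (subst nn_integral_cmult[symmetric]) (auto simp: ennreal_mult)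
      also have "\<dots> \<le> ennreal P * ennreal N" by (intro mult_left_mono mass t) auto
      also have "\<dots> = ennreal (P * N)" using P pos by (simp add: ennreal_mult)
      finally show ?thesis .
    qed
    fix t :: real and x y :: "real^'n"
    assume tt: "t1 < t" "t \<le> t0" and xy: "x \<in> X" "y \<in> Y"
      and c: "f t0 x0 - w0 * E * m + L * (t0 - t) \<le> f t x - A * (norm (x - y))\<^sup>2 + A * (norm (x0 - y))\<^sup>2"
    have t: "t \<in> {0..1}" using tt t1 t0 by auto
    have "0 \<le> L * (t0 - t)" using L tt by simp
    then have "f t0 x0 - w0 * E * m \<le> f t x - A * (norm (x - y))\<^sup>2 + A * (norm (x0 - y))\<^sup>2" using c by linarith
    from contact[OF tt xy this]
    have con: "x \<in> interior X" "(1 + norm x) powr (- \<beta>) \<le> \<theta> * q" "q \<le> \<theta> * (1 + norm x) powr (- \<beta>)"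
      "m / 2 \<le> f t x" "f t x \<le> 2 * m" "growth t \<le> 4 * (1 + \<Lambda>) / t0" by auto
    have fp: "0 < f t x" using con(4) m by linarith
    define r where "r = (1 + norm x) powr \<beta>"
    have r: "0 < r" using one_plus_norm(2)[of x] by (simp add: r_def)
    have ri: "(1 + norm x) powr (- \<beta>) = 1 / r" by (simp add: r_def powr_minus_divide)
    have qr: "q * r \<le> \<theta>" "1 \<le> \<theta> * q * r"
      using con(2,3) r by (simp_all add: ri field_simps)
    have tr: "2 * A * trace (a t x) \<le> 2 * g * n * \<theta>\<^sup>2 * \<Lambda> * (m / t0)"
    proof -
      have r2: "(1 + norm x) powr (2 * \<beta>) = r\<^sup>2"
        using one_plus_norm(2)[of x] by (simp add: r_def powr_power mult.commute)
      have "2 * A * trace (a t x) \<le> 2 * A * (n * (\<Lambda> * r\<^sup>2))"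
        using trace_a_le[OF t, of x] A by (intro mult_left_mono) (auto simp: n_def r2)
      also have "\<dots> = 2 * g * n * (q * r)\<^sup>2 * \<Lambda> * (m / t0)"
        by (simp add: A_def power_mult_distrib)
      also have "\<dots> \<le> 2 * g * n * \<theta>\<^sup>2 * \<Lambda> * (m / t0)"
        using qr(1) q r g n pos mt by (intro mult_right_mono mult_left_mono power_mono) auto
      finally show ?thesis .
    qed
    have gr: "growth t * f t x \<le> 8 * (1 + \<Lambda>) * (m / t0)"
    proof -
      have "growth t * f t x \<le> 4 * (1 + \<Lambda>) / t0 * f t x" using con(6) fp by (intro mult_right_mono) auto
      also have "\<dots> \<le> 4 * (1 + \<Lambda>) / t0 * (2 * m)" using con(5) pos t0 by (intro mult_left_mono) auto
      also have "\<dots> = 8 * (1 + \<Lambda>) * (m / t0)" by (simp add: field_simps)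
      finally show ?thesis .
    qed
    have "2 * A * trace (a t x) + growth t * f t x \<le> C'"
    proof -
      have "2 * g * n * \<theta>\<^sup>2 * \<Lambda> * (m / t0) \<le> 2 * g * n * \<theta>\<^sup>2 * (1 + \<Lambda>) * (m / t0)"
        using g n pos mt by (intro mult_right_mono mult_left_mono) auto
      then have "2 * A * trace (a t x) + growth t * f t x \<le> (2 * g * n * \<theta>\<^sup>2 + 8) * (1 + \<Lambda>) * (m / t0)"
        using tr gr by (simp only: distrib_right)
      then show ?thesis using C'ge by linarith
    qed
    moreover have "(S / n) ^ ?n \<le> det (a t x) * ((2 * A) ^ ?n * J t x)"
    proof -
      have rn: "(1 + norm x) powr (\<beta> * real ?n - \<kappa>) * (1 + norm x) powr \<kappa> = r ^ ?n"
        using one_plus_norm(2)[of x] by (simp add: powr_add[symmetric] r_def powr_power mult.commute)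
      have 1: "1 \<le> \<theta> ^ ?n * q ^ ?n * r ^ ?n"
        using qr(2) by (simp add: power_mult_distrib[symmetric] one_le_power)
      have "1 \<le> (2 * \<theta> ^ ?n * q ^ ?n / (\<delta> * m)) * (\<delta> * r ^ ?n * (m / 2))"
        using 1 pos m by simp
      also have "\<dots> \<le> (2 * \<theta> ^ ?n * q ^ ?n / (\<delta> * m)) * (\<delta> * r ^ ?n * f t x)"
        using con(4) pos m \<theta> q r by (intro mult_left_mono) auto
      also have "\<dots> \<le> (2 * \<theta> ^ ?n * q ^ ?n / (\<delta> * m)) * (det (a t x) * ((1 + norm x) powr \<kappa> * f t x))"
      proof (rule mult_left_mono)
        have "\<delta> * (1 + norm x) powr (\<beta> * real ?n - \<kappa>) * ((1 + norm x) powr \<kappa> * f t x)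
            \<le> det (a t x) * ((1 + norm x) powr \<kappa> * f t x)"
          using det_ge[OF t, of x] fp by (intro mult_right_mono) auto
        then show "\<delta> * r ^ ?n * f t x \<le> det (a t x) * ((1 + norm x) powr \<kappa> * f t x)"
          by (simp add: rn[symmetric] mult_ac)
      qed (use pos m \<theta> q in auto)
      finally have 2: "1 \<le> (2 * \<theta> ^ ?n * q ^ ?n / (\<delta> * m)) * (det (a t x) * ((1 + norm x) powr \<kappa> * f t x))" .
      have "(S / n) ^ ?n * 1 \<le> (S / n) ^ ?n * ((2 * \<theta> ^ ?n * q ^ ?n / (\<delta> * m)) * (det (a t x) * ((1 + norm x) powr \<kappa> * f t x)))"
        using 2 S n by (intro mult_left_mono) auto
      also have "\<dots> = det (a t x) * ((2 * A) ^ ?n * J t x)"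
      proof -
        have "(S / n) ^ ?n = (2 * A * (S / (2 * A * n))) ^ ?n" using A by simp
        then have eqS: "(S / n) ^ ?n = (2 * A) ^ ?n * (S / (2 * A * n)) ^ ?n" by (simp only: power_mult_distrib)
        have mx: "max 0 (f t x) = f t x" using fp by simp
        show ?thesis by (simp only: eqS J_def P_def mx mult_ac)
      qed
      finally show ?thesis by simp
    qed
    ultimately show "x \<in> interior X \<and> twice_differentiable_at (f t) x \<and> transpose (a t x) = a t x \<and>
        (\<forall>\<xi>. 0 \<le> \<xi> \<bullet> (a t x *v \<xi>)) \<and> 0 < det (a t x) \<and>
        ((L + C') / real CARD('n)) ^ CARD('n) \<le> det (a t x) * ((2 * A) ^ CARD('n) * J t x) \<and>
        (\<exists>D G. ((\<lambda>s. f s x) has_real_derivative D) (at t within {0..1}) \<and>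
           D \<le> trace (a t x ** hess (f t) x) + G \<and> 2 * A * trace (a t x) + G \<le> C')"
      using con(1) pointwise_inequality[OF t fp] a_elliptic[OF t] unfolding LC n_def by blast
  qed (use A L C' cont in auto)
  have "w0 * E * m * measure lborel Y \<le> (L + C') * (P * N) * (t0 - t1)"
  proof (rule pc.measure_bound)
    fix x y assume "x \<in> X" "y \<in> Y"
    have "w0 * E * m \<le> 1 * E * m" using w0 E m by (intro mult_right_mono) auto
    moreover have "L * (t0 - t1) = 9 * E * m" using e0 t0 by (simp add: t1(3) L_def h_def)
    ultimately show "f t1 x - A * (norm (x - y))\<^sup>2 + A * (norm (x0 - y))\<^sup>2
        \<le> f t0 x0 - w0 * E * m + L * (t0 - t1)"
      using init[OF \<open>x \<in> X\<close> \<open>y \<in> Y\<close>] by linarith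
  qed (use X in auto)
  also have "\<dots> = E * (S * t0 * e0 * (P * N))" by (simp add: LC t1(3) h_def)
  \<comment> \<open>Excess and elapsed time are both proportional to \<open>E\<close>, so a thin
    excess costs nothing.\<close>
  finally have "E * (w0 * m * measure lborel Y) \<le> E * (S * t0 * e0 * (P * N))" by (simp add: mult_ac)
  then have "w0 * m * measure lborel Y \<le> S * t0 * e0 * (P * N)" using E by simp
  also have "S * t0 = c1 * (1 + \<Lambda>) * m" using t0 by (simp add: S_def)
  also have "c1 * (1 + \<Lambda>) * m * e0 * (P * N) =
     2 * e0 * c1 * (c1 * \<theta> / (2 * g * n)) ^ ?n * ((1 + \<Lambda>) ^ (?n + 1) * N / \<delta>) / q ^ ?n"
  proof -
    have "S / (2 * A * n) = c1 * (1 + \<Lambda>) / (2 * g * n) / q\<^sup>2"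
      using m t0 g q n by (simp add: S_def A_def field_simps)
    then have "(S / (2 * A * n)) ^ ?n * (\<theta> ^ ?n * q ^ ?n) = (c1 * (1 + \<Lambda>) / (2 * g * n) / q\<^sup>2 * (\<theta> * q)) ^ ?n"
      by (simp only: power_mult_distrib)
    also have "c1 * (1 + \<Lambda>) / (2 * g * n) / q\<^sup>2 * (\<theta> * q) = c1 * \<theta> / (2 * g * n) * (1 + \<Lambda>) / q"
      using q by (simp add: power2_eq_square mult_ac)
    also have "\<dots> ^ ?n = (c1 * \<theta> / (2 * g * n)) ^ ?n * (1 + \<Lambda>) ^ ?n / q ^ ?n"
      by (simp only: power_divide power_mult_distrib)
    finally have *: "(S / (2 * A * n)) ^ ?n * (\<theta> ^ ?n * q ^ ?n) =
        (c1 * \<theta> / (2 * g * n)) ^ ?n * (1 + \<Lambda>) ^ ?n / q ^ ?n" .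
    have "P = (S / (2 * A * n)) ^ ?n * (\<theta> ^ ?n * q ^ ?n) * (2 / (\<delta> * m))" by (simp add: P_def)
    then have "P = (c1 * \<theta> / (2 * g * n)) ^ ?n * (1 + \<Lambda>) ^ ?n / q ^ ?n * (2 / (\<delta> * m))" unfolding * .
    moreover have "c1 * (1 + \<Lambda>) * m * e0 * (W * V / Q * (2 / (\<delta> * m)) * N) =
        2 * e0 * c1 * W * ((1 + \<Lambda>) * V * N / \<delta>) / Q" for W V Q
      using m by (simp add: mult_ac)
    moreover have "(1 + \<Lambda>) ^ (?n + 1) = (1 + \<Lambda>) * (1 + \<Lambda>) ^ ?n" by simp
    ultimately show ?thesis by (simp only:)
  qed
  finally show ?thesis .
qed

end

section \<open>Contact where the weight is nearly constant on the diffusion length\<close>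

lemma time_factor:
  fixes K t t0 h :: real and k :: nat
  assumes "0 < t0" "0 \<le> h" "2 * real k * h \<le> 1" "1 \<le> k" "t0 * (1 - h) \<le> t" "t \<le> t0" "0 < K"
  shows "K * t powr (- (real k / 2)) \<le> K * t0 powr (- (real k / 2)) * (1 + 2 * real k * h)"
proof -
  let ?k = "real k"
  have "?k * h \<ge> 1 * h" using assms by (intro mult_right_mono) auto
  then have h1: "h \<le> 1 / 2" "?k * h \<le> 1 / 2" using assms by linarith+
  have "0 < t0 * (1 - h)" using h1 assms by (intro mult_pos_pos) auto
  then have t: "0 < t" using assms by linarith
  \<comment> \<open>Bernoulli's inequality is used for the integer exponent \<open>k\<close>;
    halving the exponent afterwards only increases a power of a base below 1.\<close>
  have "1 - ?k * h \<le> (1 - h) ^ k" using Bernoulli_inequality[of "- h" k] h1 by simp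
  also have "\<dots> = (1 - h) powr ?k" using h1 by (simp add: powr_realpow)
  also have "\<dots> \<le> (1 - h) powr (?k / 2)" using h1 assms by (intro powr_mono') auto
  also have "\<dots> \<le> (t / t0) powr (?k / 2)" using h1 assms by (intro powr_mono2) (auto simp: field_simps)
  also have "\<dots> = t powr (?k / 2) / t0 powr (?k / 2)" using t assms by (simp add: powr_divide)
  finally have 1: "(1 - ?k * h) * t0 powr (?k / 2) \<le> t powr (?k / 2)" using assms by (simp add: field_simps)
  have "1 \<le> (1 - ?k * h) * (1 + 2 * ?k * h)"
  proof -
    have "(?k * h) * (?k * h) \<le> (?k * h) * (1 / 2)" using h1 assms by (intro mult_left_mono) auto
    then show ?thesis by (simp add: algebra_simps)
  qed
  then have "t0 powr (?k / 2) * 1 \<le> t0 powr (?k / 2) * ((1 - ?k * h) * (1 + 2 * ?k * h))"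
    by (intro mult_left_mono) auto
  also have "\<dots> = (1 - ?k * h) * t0 powr (?k / 2) * (1 + 2 * ?k * h)" by simp
  also have "\<dots> \<le> t powr (?k / 2) * (1 + 2 * ?k * h)" using 1 assms by (intro mult_right_mono) auto
  finally have "1 / t powr (?k / 2) \<le> 1 / t0 powr (?k / 2) * (1 + 2 * ?k * h)"
    using t assms by (simp add: field_simps)
  then have "K * (1 / t powr (?k / 2)) \<le> K * (1 / t0 powr (?k / 2) * (1 + 2 * ?k * h))"
    using assms by (intro mult_left_mono) auto
  then show ?thesis by (simp add: powr_minus_divide)
qed

text \<open>Since \<open>m * sqrt t ^ k = K\<close>, a set of vertices of measure
  \<open>v * (sqrt t / q) ^ k\<close> turns the mass estimate into one in which \<open>t\<close> and
  \<open>q\<close> have cancelled.\<close>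

lemma volume_conclusion:
  fixes K t q w v B M m :: real and k :: nat
  assumes "w * m * M \<le> B / q ^ k" "v * (sqrt t / q) ^ k \<le> M" "m = K * t powr (- (real k / 2))"
    "0 < q" "0 < t" "0 < K" "0 < w"
  shows "w * v * K \<le> B"
proof -
  have "sqrt t ^ k = t powr (real k / 2)"
    using assms by (simp add: powr_half_sqrt[symmetric] powr_power)
  then have mt: "m * sqrt t ^ k = K" using assms by (simp add: powr_minus_divide)
  have "w * m * (v * (sqrt t / q) ^ k) \<le> w * m * M" using assms by (intro mult_left_mono) auto
  also note assms(1)
  finally have "w * v * (m * sqrt t ^ k) / q ^ k \<le> B / q ^ k" by (simp add: power_divide mult_ac)
  then have "w * v * K / q ^ k \<le> B / q ^ k" unfolding mt .
  moreover have "0 < q ^ k" using assms by simp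
  ultimately show ?thesis by (simp add: divide_le_cancel)
qed

text \<open>The logarithms differ by at most \<open>2 * d / R\<close>, hence by at most 1 after
  multiplication by \<open>|\<beta>|\<close>; the power changes by a factor of at most
  \<open>exp 1 \<le> 3\<close>. This is the origin of \<open>\<theta> = 3\<close> in the near
  case.\<close>

lemma comparable_weight:
  fixes \<beta> r R :: real
  assumes "0 < R" "\<bar>r - R\<bar> \<le> d" "2 * d \<le> R" "\<bar>\<beta>\<bar> * (2 * d) \<le> R"
  shows "r powr (- \<beta>) \<le> 3 * R powr (- \<beta>)" "R powr (- \<beta>) \<le> 3 * r powr (- \<beta>)"
proof -
  have r: "0 < r" "R \<le> 2 * r" using assms by linarith+
  have ln1: "\<bar>ln r - ln R\<bar> * \<bar>\<beta>\<bar> \<le> 1"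
  proof -
    have "ln r - ln R \<le> r / R - 1" using ln_le_minus_one[of "r / R"] r assms by (simp add: ln_div)
    also have "\<dots> = (r - R) / R" using assms by (simp add: field_simps)
    also have "\<dots> \<le> 2 * d / R" using assms by (intro divide_right_mono) auto
    finally have 1: "ln r - ln R \<le> 2 * d / R" .
    have "ln R - ln r \<le> R / r - 1" using ln_le_minus_one[of "R / r"] r assms by (simp add: ln_div)
    also have "\<dots> = (R - r) / r" using r by (simp add: field_simps)
    also have "\<dots> \<le> d / r" using assms r by (intro divide_right_mono) auto
    also have "\<dots> \<le> d / (R / 2)" using assms r by (intro divide_left_mono) auto
    finally have "ln R - ln r \<le> 2 * d / R" by (simp add: mult.commute)
    then have "\<bar>ln r - ln R\<bar> \<le> 2 * d / R" using 1 unfolding abs_le_iff by linarith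
    then have "\<bar>ln r - ln R\<bar> * \<bar>\<beta>\<bar> \<le> 2 * d / R * \<bar>\<beta>\<bar>" by (intro mult_right_mono) auto
    also have "\<dots> \<le> 1" using assms by (simp add: field_simps)
    finally show ?thesis .
  qed
  have e3: "exp (1 :: real) \<le> 3" by (rule exp_le)
  have *: "a powr (- \<beta>) \<le> 3 * c powr (- \<beta>)" if "0 < a" "0 < c" "\<bar>ln a - ln c\<bar> * \<bar>\<beta>\<bar> \<le> 1" for a c
  proof -
    have "- \<beta> * (ln a - ln c) \<le> \<bar>- \<beta> * (ln a - ln c)\<bar>" by (rule abs_ge_self)
    also have "\<dots> = \<bar>ln a - ln c\<bar> * \<bar>\<beta>\<bar>" by (simp add: abs_mult mult.commute)
    also note that(3)
    finally have "- \<beta> * ln a \<le> 1 + - \<beta> * ln c" by (simp add: algebra_simps)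
    then have "a powr (- \<beta>) \<le> exp 1 * c powr (- \<beta>)" using that by (simp add: powr_def exp_add[symmetric])
    also have "\<dots> \<le> 3 * c powr (- \<beta>)" using e3 by (intro mult_right_mono) auto
    finally show ?thesis .
  qed
  show "r powr (- \<beta>) \<le> 3 * R powr (- \<beta>)" by (rule *[OF r(1) assms(1) ln1])
  show "R powr (- \<beta>) \<le> 3 * r powr (- \<beta>)" by (rule *[OF assms(1) r(1)]) (use ln1 in \<open>simp add: abs_minus_commute\<close>)
qed

abbreviation (input) decay :: "nat \<Rightarrow> real \<Rightarrow> real \<Rightarrow> real" where
  "decay n K t \<equiv> K * t powr (- (real n / 2))"

text \<open>The dimensional factor on the right of \<open>mass_step\<close> for
  \<open>g = 1\<close>; the literal factors 1 are that \<open>g\<close>, kept so that the two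
  expressions match after unfolding.\<close>

definition step_const :: "nat \<Rightarrow> real \<Rightarrow> real \<Rightarrow> real" where
  "step_const n e0 \<theta> = 2 * e0 * (9 / e0 + 2 * 1 * real n * \<theta>\<^sup>2 + 8) *
     ((9 / e0 + 2 * 1 * real n * \<theta>\<^sup>2 + 8) * \<theta> / (2 * 1 * real n)) ^ n"

lemma step_fraction:
  fixes n :: real
  assumes "1 \<le> n"
  shows "0 < 1 / (8 * n) * (1 / 100)" "1 / (8 * n) * (1 / 100) < 1" "0 < 1 / (8 * n)" "1 / (8 * n) \<le> 1"
  using assms by (simp_all add: field_simps)

context parabolic_setting
begin

definition time_bound :: "real \<Rightarrow> real" where
  "time_bound K = K powr (2 / real CARD('n)) * exp (- (2 / real CARD('n)) *
     (max 1 C * exp (2 * (2 + max 1 C)) * K powr (2 / real CARD('n)) / (1 + \<Lambda>)) powr (1 / \<epsilon>))"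

text \<open>The upper bound at all points and the lower bound at one point pin the supremum of
  \<open>f t\<close> within five percent of the decay function, the range covered by
  \<open>reaction_bound\<close>.\<close>

lemma growth_le:
  assumes t: "t \<in> {0..1}" and t0: "0 < t0" "t0 \<le> 1" "t0 \<le> time_bound K" and K: "0 < K"
    and up: "\<And>y. f t y \<le> 21 / 20 * decay CARD('n) K t0" and lo: "19 / 20 * decay CARD('n) K t0 \<le> f t x"
  shows "growth t \<le> 4 * (1 + \<Lambda>) / t0"
proof -
  let ?g = "\<lambda>y. max 0 (f t y)"
  have m: "0 < decay CARD('n) K t0" using K t0 by simp
  have cont: "continuous_on UNIV ?g" by (intro continuous_intros continuous_on_slice t)
  have g: "0 \<le> ?g y" "?g y \<le> 21 / 20 * decay CARD('n) K t0" for y using up[of y] m by auto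
  have "?g x \<le> Linf_norm ?g" "Linf_norm ?g \<le> 21 / 20 * decay CARD('n) K t0"
    by (rule Linf_norm_bounds[OF cont g])+
  then have "19 / 20 * decay CARD('n) K t0 \<le> Linf_norm ?g" using lo by linarith
  moreover have "1 \<le> real CARD('n)" by simp
  ultimately show ?thesis
    unfolding growth_def
    using reaction_bound[OF _ t0(1,2) K pos(3,1) refl refl, of "real CARD('n)" C "Linf_norm ?g"]
      t0(3) \<open>Linf_norm ?g \<le> _\<close> unfolding time_bound_def by blast
qed

text \<open>If the diffusion length \<open>l = sqrt t0 * (1 + |x0|) powr \<beta>\<close> does not
  exceed the scale of variation of the weight, an untilted family works: vertices within
  \<open>l / 8\<close> of \<open>x0\<close>, contact points in the ball of radius
  \<open>l / 2\<close>, and \<open>E = 1 / 100\<close> in \<open>mass_step\<close>.\<close>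

lemma near_case:
  assumes t0: "0 < t0" "t0 \<le> 1" "t0 \<le> time_bound K" and K: "0 < K"
    and up: "\<And>t x. 0 < t \<Longrightarrow> t \<le> t0 \<Longrightarrow> f t x \<le> 199 / 200 * decay CARD('n) K t"
    and lo: "989 / 1000 * decay CARD('n) K t0 \<le> f t0 x0"
    and near: "sqrt t0 * (1 + norm x0) powr \<beta> \<le> 1 + norm x0"
      "\<bar>\<beta>\<bar> * (sqrt t0 * (1 + norm x0) powr \<beta>) \<le> 1 + norm x0"
  shows "1 / 4 * (1 / (16 * real CARD('n))) ^ CARD('n) * K \<le>
    step_const CARD('n) (1 / (8 * real CARD('n))) 3 * ((1 + \<Lambda>) ^ (CARD('n) + 1) * N / \<delta>)"
proof -
  let ?n = "real CARD('n)"
  have n: "1 \<le> ?n" by simp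
  define m where "m = decay CARD('n) K t0"
  have m: "0 < m" using K t0 by (simp add: m_def)
  define R where "R = 1 + norm x0"
  have R: "1 \<le> R" by (simp add: R_def)
  define q where "q = R powr (- \<beta>)"
  have q: "0 < q" using R by (simp add: q_def)
  define l where "l = sqrt t0 / q"
  have l: "0 < l" using t0 q by (simp add: l_def)
  have lR: "l \<le> R" "\<bar>\<beta>\<bar> * l \<le> R" using near by (simp_all add: l_def q_def R_def powr_minus_divide)
  \<comment> \<open>Equals \<open>m / l\<^sup>2\<close>: the paraboloids drop by \<open>m\<close>
    over the distance \<open>l\<close>.\<close>
  define A where "A = 1 * m * q\<^sup>2 / t0"
  have A: "0 < A" using m q t0 by (simp add: A_def)
  have Al: "A * (c * l)\<^sup>2 = c\<^sup>2 * m" for c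
    using q t0 by (simp add: A_def l_def power_mult_distrib power_divide)
  define X where "X = cball x0 (l / 2)"
  define t1 where "t1 = t0 * (1 - 1 / (8 * ?n) * (1 / 100))"
  have t1: "0 < t1" "t1 < t0"
  proof -
    note h = step_fraction[OF n]
    show "0 < t1" using t0 h unfolding t1_def by (intro mult_pos_pos) auto
    have "t0 * (1 - 1 / (8 * ?n) * (1 / 100)) < t0 * 1" using h t0 by (intro mult_strict_left_mono) auto
    then show "t1 < t0" by (simp add: t1_def)
  qed
  define e :: "real^'n" where "e = axis undefined 1"
  have e: "norm e = 1" by (simp add: e_def norm_axis_1)
  have l16: "0 < l / 16" using l by simp
  obtain Y where Y: "compact Y"
    "\<And>y. y \<in> Y \<Longrightarrow> \<bar>(y - x0) \<bullet> e\<bar> \<le> l / 16 \<and> norm (y - x0 - ((y - x0) \<bullet> e) *\<^sub>R e) \<le> l / 16"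
    "2 ^ CARD('n) * (l / 16) * (l / 16 / ?n) ^ (CARD('n) - 1) \<le> measure lborel Y"
    using oriented_box[OF e l16 l16, of x0] by blast
  have Yx: "norm (x0 - y) \<le> l / 8" if "y \<in> Y" for y
  proof -
    have "norm (y - x0) \<le> norm (((y - x0) \<bullet> e) *\<^sub>R e) + norm (y - x0 - ((y - x0) \<bullet> e) *\<^sub>R e)"
      by (metis add.commute diff_add_cancel norm_triangle_ineq)
    also have "\<dots> \<le> l / 16 + l / 16" using Y(2)[OF that] e by (intro add_mono) auto
    finally show ?thesis by (simp add: norm_minus_commute)
  qed
  have AY: "A * (norm (x0 - y))\<^sup>2 \<le> 1 / 64 * m" if "y \<in> Y" for y
  proof -
    have "(norm (x0 - y))\<^sup>2 \<le> (1 / 8 * l)\<^sup>2" using Yx[OF that] by (intro power_mono) auto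
    then have "A * (norm (x0 - y))\<^sup>2 \<le> A * (1 / 8 * l)\<^sup>2" using A by (intro mult_left_mono) auto
    then show ?thesis unfolding Al by (simp add: power2_eq_square)
  qed
  have upt: "f t x \<le> 999 / 1000 * m" if "t1 \<le> t" "t \<le> t0" for t x
  proof -
    have t: "0 < t" using that t1 by linarith
    have "decay CARD('n) K t \<le> decay CARD('n) K t0 * (1 + 2 * ?n * (1 / (8 * ?n) * (1 / 100)))"
      by (rule time_factor) (use that t0 K in \<open>auto simp: t1_def\<close>)
    also have "\<dots> = 401 / 400 * m" by (simp add: m_def)
    finally have "199 / 200 * decay CARD('n) K t \<le> 199 / 200 * (401 / 400 * m)" by simp
    moreover have "199 / 200 * (401 / 400 * m) \<le> 999 / 1000 * m" using m by simp
    ultimately show ?thesis using up[OF t that(2), of x] by linarith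
  qed
  have S: "989 / 1000 * m \<le> f t0 x0" using lo by (simp add: m_def)
  have main: "1 / 4 * m * measure lborel Y \<le> step_const CARD('n) (1 / (8 * ?n)) 3 * ((1 + \<Lambda>) ^ (CARD('n) + 1) * N / \<delta>) / q ^ CARD('n)"
    unfolding step_const_def
  proof (rule mass_step[where E = "1 / 100" and X = X and ?x0.0 = x0 and ?t0.0 = t0 and ?e0.0 = "1 / (8 * ?n)"
        and ?w0.0 = "1 / 4" and g = 1 and \<theta> = 3 and m = m and q = q, folded A_def t1_def])
    show "x0 \<in> X" "compact X" using l by (auto simp: X_def)
    fix t x y
    assume t: "t1 < t" "t \<le> t0" and x: "x \<in> X" and y: "y \<in> Y"
      and c: "f t0 x0 - 1 / 4 * (1 / 100) * m \<le> f t x - A * (norm (x - y))\<^sup>2 + A * (norm (x0 - y))\<^sup>2"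
    have fx: "f t x \<le> 999 / 1000 * m" using upt[of t x] t by simp
    \<comment> \<open>The available height is 999/1000 - 989/1000 from the two bounds on
      \<open>f\<close>, 1/64 from the distance of \<open>x0\<close> to the vertex, and 1/400 from
      the threshold; together they are below 1/25.\<close>
    have "A * (norm (x - y))\<^sup>2 \<le> (1 / 5)\<^sup>2 * m"
      using c S fx AY[OF y] m by (simp add: power2_eq_square)
    then have "A * (norm (x - y))\<^sup>2 \<le> A * (1 / 5 * l)\<^sup>2" by (simp only: Al)
    then have "(norm (x - y))\<^sup>2 \<le> (1 / 5 * l)\<^sup>2" using A by simp
    then have "norm (x - y) \<le> 1 / 5 * l" by (rule power2_le_imp_le) (use l in auto)
    moreover have "norm (x - x0) \<le> norm (x - y) + norm (x0 - y)"
      using norm_triangle_ineq4[of "x - y" "x0 - y"] by simp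
    ultimately have xx: "norm (x - x0) \<le> 13 / 40 * l" using Yx[OF y] by linarith
    have int: "x \<in> interior X"
      using xx l by (simp add: X_def dist_norm norm_minus_commute)
    have "0 \<le> A * (norm (x - y))\<^sup>2" using A by simp
    then have fl: "19 / 20 * m \<le> f t x" using c S AY[OF y] m by linarith
    have d1: "\<bar>(1 + norm x) - R\<bar> \<le> 13 / 40 * l"
      using norm_triangle_ineq3[of x x0] xx by (simp add: R_def)
    have d2: "2 * (13 / 40 * l) \<le> R" using lR(1) R l by linarith
    have "\<bar>\<beta>\<bar> * (2 * (13 / 40 * l)) = 13 / 20 * (\<bar>\<beta>\<bar> * l)" by simp
    then have d3: "\<bar>\<beta>\<bar> * (2 * (13 / 40 * l)) \<le> R" using lR(2) R by linarith
    have "0 < R" using R by simp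
    note cmp = comparable_weight[OF this d1 d2 d3, folded q_def]
    have "growth t \<le> 4 * (1 + \<Lambda>) / t0"
    proof (rule growth_le[OF _ t0 K])
      show "t \<in> {0..1}" using t t0 t1 by auto
      show "19 / 20 * decay CARD('n) K t0 \<le> f t x" using fl by (simp add: m_def)
      show "f t y \<le> 21 / 20 * decay CARD('n) K t0" for y
        using upt[of t y] t m by (simp add: m_def[symmetric])
    qed
    then show "x \<in> interior X \<and> (1 + norm x) powr (- \<beta>) \<le> 3 * q \<and> q \<le> 3 * (1 + norm x) powr (- \<beta>) \<and>
        m / 2 \<le> f t x \<and> f t x \<le> 2 * m \<and> growth t \<le> 4 * (1 + \<Lambda>) / t0"
      using int cmp fl fx m by linarith
  next
    fix x y assume "x \<in> X" "y \<in> Y"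
    have "f t1 x \<le> 999 / 1000 * m" using upt[of t1 x] t1 by simp
    moreover have "0 \<le> A * (norm (x - y))\<^sup>2" using A by simp
    ultimately show "f t1 x - A * (norm (x - y))\<^sup>2 + A * (norm (x0 - y))\<^sup>2 \<le> f t0 x0 + 8 * (1 / 100) * m"
      using AY[OF \<open>y \<in> Y\<close>] S m by linarith
  qed (use t0 m q Y(1) step_fraction(3,4)[OF n] in simp_all)
  have vol: "(1 / (16 * ?n)) ^ CARD('n) * (sqrt t0 / q) ^ CARD('n) \<le> measure lborel Y"
  proof -
    have "(1 / (16 * ?n)) ^ CARD('n) * (sqrt t0 / q) ^ CARD('n) = (l / 16 / ?n) ^ CARD('n)"
      by (simp add: l_def power_mult_distrib[symmetric] mult_ac)
    also have "\<dots> = (l / 16 / ?n) * (l / 16 / ?n) ^ (CARD('n) - 1)"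
      by (simp add: power_eq_if)
    also have "\<dots> \<le> (2 ^ CARD('n) * (l / 16)) * (l / 16 / ?n) ^ (CARD('n) - 1)"
    proof (rule mult_right_mono)
      have "l / 16 / ?n \<le> l / 16 / 1" using l n by (intro divide_left_mono) auto
      also have "\<dots> = 1 * (l / 16)" by simp
      also have "\<dots> \<le> 2 ^ CARD('n) * (l / 16)" using l by (intro mult_right_mono) auto
      finally show "l / 16 / ?n \<le> 2 ^ CARD('n) * (l / 16)" by simp
    qed (use l in auto)
    also note Y(3)
    finally show ?thesis .
  qed
  show ?thesis
    by (rule volume_conclusion[OF main vol m_def q t0(1) K]) simp
qed

end

section \<open>A maximum principle outside a ball\<close>

context parabolic_setting
begin

lemma local_max_bound:
  assumes t: "t \<in> {0..1}" "0 < f t x" and A: "0 \<le> A"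
    and mx: "\<forall>\<^sub>F z in nhds x. f t z - A * (norm (z - y))\<^sup>2 \<le> f t x - A * (norm (x - y))\<^sup>2"
  shows "\<exists>D. ((\<lambda>s. f s x) has_real_derivative D) (at t within {0..1}) \<and>
     D \<le> 2 * A * (real CARD('n) * (\<Lambda> * (1 + norm x) powr (2 * \<beta>))) + growth t * f t x"
proof -
  note td = pointwise_inequality(1)[OF t]
  obtain D where D: "((\<lambda>s. f s x) has_real_derivative D) (at t within {0..1})"
    "D \<le> trace (a t x ** hess (f t) x) + growth t * f t x"
    using pointwise_inequality(2)[OF t] by blast
  have "trace (a t x ** hess (f t) x) \<le> 2 * A * trace (a t x)"
    by (rule trace_mult_le[OF a_elliptic(1,2)[OF t(1)] hess_symmetric[OF td] touching_paraboloid(2)[OF td mx]])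
  also have "\<dots> \<le> 2 * A * (real CARD('n) * (\<Lambda> * (1 + norm x) powr (2 * \<beta>)))"
    using A trace_a_le[OF t(1)] by (intro mult_left_mono) auto
  finally show ?thesis using D by (intro exI[of _ D]) auto
qed

lemma f_bounded: "\<exists>B>0. \<forall>t\<in>{0..1}. \<forall>x. f t x \<le> B"
proof -
  obtain B where B: "0 < B" "\<forall>z\<in>(\<lambda>(t, x). f t x) ` ({0..1} \<times> UNIV). norm z \<le> B"
    using bdd unfolding bounded_pos by blast
  have "f t x \<le> B" if "t \<in> {0..1}" for t x
  proof -
    have "f t x \<in> (\<lambda>(t, x). f t x) ` ({0..1} \<times> UNIV)" using that by (auto intro!: image_eqI[of _ _ "(t, x)"])
    then have "norm (f t x) \<le> B" using B(2) by blast
    then show ?thesis by simp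
  qed
  then show ?thesis using B(1) by blast
qed

text \<open>The lower bound on \<open>f\<close> keeps the logarithm in the denominator of the rate
  away from zero; boundedness of \<open>f\<close> controls the numerator.\<close>

lemma growth_bounded:
  assumes c: "0 < c"
  shows "\<exists>G\<ge>0. \<forall>t\<in>{0..1}. \<forall>x. c \<le> f t x \<longrightarrow> growth t * f t x \<le> G"
proof -
  obtain B where B: "0 < B" "\<And>t x. t \<in> {0..1} \<Longrightarrow> f t x \<le> B" using f_bounded by blast
  let ?p = "2 / real CARD('n)"
  define G where "G = \<bar>C\<bar> * (B powr ?p / ln (1 + c) powr \<epsilon>) * B"
  have "growth t * f t x \<le> G" if t: "t \<in> {0..1}" and x: "c \<le> f t x" for t x
  proof -
    let ?g = "\<lambda>y. max 0 (f t y)"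
    define M where "M = Linf_norm ?g"
    have cont: "continuous_on UNIV ?g" by (intro continuous_intros continuous_on_slice t)
    have g: "0 \<le> ?g y" "?g y \<le> B" for y using B(1) B(2)[OF t, of y] by auto
    have "?g x \<le> M" "M \<le> B" unfolding M_def by (rule Linf_norm_bounds[OF cont g])+
    then have M: "c \<le> M" "M \<le> B" using x by auto
    have lc: "0 < ln (1 + c)" using c by simp
    have "M powr ?p / ln (1 + M) powr \<epsilon> \<le> B powr ?p / ln (1 + c) powr \<epsilon>"
    proof (rule frac_le)
      show "M powr ?p \<le> B powr ?p" using M c by (intro powr_mono2) auto
      show "ln (1 + c) powr \<epsilon> \<le> ln (1 + M) powr \<epsilon>" using M c lc pos by (intro powr_mono2) auto
    qed (use lc in auto)
    moreover have "growth t = C * (M powr ?p / ln (1 + M) powr \<epsilon>)" by (simp add: growth_def M_def)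
    moreover have "C * (M powr ?p / ln (1 + M) powr \<epsilon>) \<le> \<bar>C\<bar> * (M powr ?p / ln (1 + M) powr \<epsilon>)"
      by (intro mult_right_mono) auto
    moreover have "\<bar>C\<bar> * (M powr ?p / ln (1 + M) powr \<epsilon>) \<le> \<bar>C\<bar> * (B powr ?p / ln (1 + c) powr \<epsilon>)"
      using calculation(1) by (intro mult_left_mono) auto
    ultimately have gr: "growth t \<le> \<bar>C\<bar> * (B powr ?p / ln (1 + c) powr \<epsilon>)" by linarith
    have "growth t * f t x \<le> \<bar>C\<bar> * (B powr ?p / ln (1 + c) powr \<epsilon>) * f t x"
      using gr x c by (intro mult_right_mono) auto
    also have "\<dots> \<le> G" unfolding G_def using B(2)[OF t, of x] by (intro mult_left_mono) auto
    finally show ?thesis .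
  qed
  moreover have "0 \<le> G" using B by (simp add: G_def)
  ultimately show ?thesis by blast
qed

text \<open>Concavity of the logarithm in the variable \<open>|z|\<^sup>2\<close>: the penalization
  lies below a paraboloid with vertex 0, so a maximum of \<open>f\<close> minus the penalization is
  also a contact with that paraboloid.\<close>

lemma ln_tangent:
  fixes z x :: "real^'n"
  shows "ln (1 + (norm z)\<^sup>2) \<le> ln (1 + (norm x)\<^sup>2) + ((norm z)\<^sup>2 - (norm x)\<^sup>2) / (1 + (norm x)\<^sup>2)"
proof -
  let ?u = "1 + (norm z)\<^sup>2" and ?v = "1 + (norm x)\<^sup>2"
  have p: "0 < ?u" "0 < ?v" by (simp_all add: add_pos_nonneg)
  have "ln (?u / ?v) \<le> ?u / ?v - 1" using p by (intro ln_le_minus_one) simp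
  moreover have "?u / ?v - 1 = ((norm z)\<^sup>2 - (norm x)\<^sup>2) / ?v" using p by (simp add: field_simps)
  ultimately show ?thesis using p by (simp add: ln_div)
qed

text \<open>The penalization by a multiple of \<open>ln (1 + |x|\<^sup>2)\<close> makes the maximum attained. Its Hessian
  decays like \<open>|x|\<^sup>-\<^sup>2\<close>, which compensates the quadratic growth of the coefficients.\<close>

lemma exterior_maximum_principle:
  assumes c: "0 < c" and ts: "0 \<le> t1" "t1 \<le> t2" "t2 \<le> 1" and r: "0 < r"
    and init: "\<And>x. r \<le> norm x \<Longrightarrow> f t1 x \<le> c"
    and bd: "\<And>t x. t1 \<le> t \<Longrightarrow> t \<le> t2 \<Longrightarrow> norm x = r \<Longrightarrow> f t x \<le> c"
  shows "\<exists>G\<ge>0. \<forall>t x. t1 \<le> t \<and> t \<le> t2 \<and> r \<le> norm x \<longrightarrow> f t x \<le> c + G * (t - t1)"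
proof -
  obtain G0 where G0: "0 \<le> G0" "\<And>t x. t \<in> {0..1} \<Longrightarrow> c \<le> f t x \<Longrightarrow> growth t * f t x \<le> G0"
    using growth_bounded[OF c] by blast
  obtain B where B: "0 < B" "\<And>t x. t \<in> {0..1} \<Longrightarrow> f t x \<le> B" using f_bounded by blast
  \<comment> \<open>The extra 1 absorbs the diffusion of the penalization, which is at most
    \<open>4 * n * \<Lambda> * s < 1\<close>.\<close>
  define G where "G = G0 + 1"
  have G: "0 < G" using G0 by (simp add: G_def)
  let ?n = "real CARD('n)"
  have pen: "f t x \<le> c + G * (t - t1) + s * ln (1 + (norm x)\<^sup>2)"
    if t: "t1 \<le> t" "t \<le> t2" and x: "r \<le> norm x" and s: "0 < s" "4 * ?n * \<Lambda> * s < 1" for t x s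
  proof (rule ccontr)
    assume neg: "\<not> f t x \<le> c + G * (t - t1) + s * ln (1 + (norm x)\<^sup>2)"
    define u where "u t x = c + G * (t - t1) + s * ln (1 + (norm x)\<^sup>2)" for t and x :: "real^'n"
    define S where "S = {(t, x). t1 \<le> t \<and> t \<le> t2 \<and> r \<le> norm x \<and> u t x \<le> f t x}"
    have lnp: "0 < ln (1 + (norm z)\<^sup>2)" if "r \<le> norm z" for z :: "real^'n"
    proof -
      have "0 < norm z" using that r by linarith
      then have "0 < (norm z)\<^sup>2" by (rule zero_less_power)
      then show ?thesis by (intro ln_gt_zero) simp
    qed
    have cu: "continuous_on ({0..1} \<times> UNIV) (\<lambda>z. u (fst z) (snd z))"
      unfolding u_def by (intro continuous_intros) (auto simp: add_pos_nonneg less_imp_neq[symmetric])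
    have cf: "continuous_on ({0..1} \<times> UNIV) (\<lambda>z. f (fst z) (snd z))"
      using cont by (simp add: case_prod_beta)
    have "closed (({0..1} \<times> UNIV) \<inter> (\<lambda>z. f (fst z) (snd z) - u (fst z) (snd z)) -` {0..})"
      by (intro continuous_closed_preimage continuous_on_diff cf cu closed_Times) auto
    moreover have "closed ({t1..t2} \<times> {x :: real^'n. r \<le> norm x})"
      by (intro closed_Times closed_Collect_le continuous_intros closed_real_atLeastAtMost)
    ultimately have "closed ((({0..1} \<times> UNIV) \<inter> (\<lambda>z. f (fst z) (snd z) - u (fst z) (snd z)) -` {0..}) \<inter>
       ({t1..t2} \<times> {x :: real^'n. r \<le> norm x}))" by (rule closed_Int)
    moreover have "(({0..1} \<times> UNIV) \<inter> (\<lambda>z. f (fst z) (snd z) - u (fst z) (snd z)) -` {0..}) \<inter>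
       ({t1..t2} \<times> {x :: real^'n. r \<le> norm x}) = S"
      using ts by (auto simp: S_def)
    ultimately have clS: "closed S" by simp
    have "S \<subseteq> {t1..t2} \<times> cball 0 (exp (B / s))"
    proof (clarsimp simp: S_def)
      fix t and x :: "real^'n" assume h: "t1 \<le> t" "t \<le> t2" "r \<le> norm x" "u t x \<le> f t x"
      have "f t x \<le> B" using B(2) h ts by auto
      moreover have "0 \<le> G * (t - t1)" using G h by simp
      ultimately have "s * ln (1 + (norm x)\<^sup>2) \<le> B" using h(4) c by (simp add: u_def)
      then have "ln (1 + (norm x)\<^sup>2) \<le> B / s" using s by (simp add: field_simps)
      then have "1 + (norm x)\<^sup>2 \<le> exp (B / s)"
        by (metis add_pos_nonneg exp_ln exp_le_cancel_iff zero_le_power2 zero_less_one)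
      moreover have "2 * norm x \<le> 1 + (norm x)\<^sup>2"
        using zero_le_power2[of "norm x - 1"] unfolding power2_diff by simp
      ultimately show "norm x \<le> exp (B / s)" using norm_ge_zero[of x] by linarith
    qed
    then have "bounded S" by (rule bounded_subset[rotated]) (intro bounded_Times bounded_closed_interval bounded_cball)
    then have cS: "compact S" using clS by (simp add: compact_eq_bounded_closed)
    have "(t, x) \<in> S" using neg t x by (simp add: S_def u_def)
    then have nS: "S \<noteq> {}" by blast
    have "compact (fst ` S)" by (intro compact_continuous_image continuous_intros cS)
    moreover have "fst ` S \<noteq> {}" using nS by simp
    ultimately have "\<exists>m\<in>fst ` S. \<forall>q\<in>fst ` S. m \<le> q" by (rule compact_attains_inf)
    then obtain t0 where t0S: "t0 \<in> fst ` S" and t0m: "\<And>q. q \<in> fst ` S \<Longrightarrow> t0 \<le> q" by blast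
    from t0S obtain x0 where S0: "(t0, x0) \<in> S" by auto
    have mn: "t0 \<le> t" if "(t, x) \<in> S" for t x using t0m[of t] that by force
    have t0: "t1 \<le> t0" "t0 \<le> t2" "r \<le> norm x0" "u t0 x0 \<le> f t0 x0" using S0 by (auto simp: S_def)
    have t01: "t0 \<in> {0..1}" using t0 ts by auto
    have "t0 \<noteq> t1"
    proof
      assume "t0 = t1"
      then have "u t1 x0 \<le> c" using init[OF t0(3)] t0(4) by simp
      moreover have "0 < s * ln (1 + (norm x0)\<^sup>2)" using lnp[OF t0(3)] s by simp
      ultimately show False by (simp add: u_def)
    qed
    then have t10: "t1 < t0" using t0 by simp
    have x0r: "r < norm x0"
    proof (rule ccontr)
      assume "\<not> r < norm x0"
      then have "f t0 x0 \<le> c" using bd[OF t0(1,2)] t0(3) by simp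
      moreover have "0 < s * ln (1 + (norm x0)\<^sup>2)" using lnp[OF t0(3)] s by simp
      moreover have "0 \<le> G * (t0 - t1)" using G t0 by simp
      ultimately show False using t0(4) by (simp add: u_def)
    qed
    have before: "f q z < u q z" if "t1 \<le> q" "q < t0" "r \<le> norm z" for q z
      using mn[of q z] that t0 by (force simp: S_def)
    obtain sq where sq: "\<And>n. t1 \<le> sq n" "\<And>n. sq n < t0" "sq \<longlonglongrightarrow> t0"
      using left_sequence[OF t10] by metis
    have sq01: "sq n \<in> {0..1}" for n using sq(1,2)[of n] t01 ts by auto
    have at: "f t0 z \<le> u t0 z" if z: "r \<le> norm z" for z
    proof (rule LIMSEQ_le)
      have pr: "(\<lambda>n. (sq n, z)) \<longlonglongrightarrow> (t0, z)" by (intro tendsto_intros sq(3))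
      show "(\<lambda>n. f (sq n) z) \<longlonglongrightarrow> f t0 z"
        using continuous_on_tendsto_compose[OF cf pr] t01 sq01 by simp
      show "(\<lambda>n. u (sq n) z) \<longlonglongrightarrow> u t0 z"
        using continuous_on_tendsto_compose[OF cu pr] t01 sq01 by simp
      show "\<exists>N. \<forall>n\<ge>N. f (sq n) z \<le> u (sq n) z"
        using before[OF sq(1,2) z] less_imp_le by blast
    qed
    have eq: "f t0 x0 = u t0 x0" using at[OF t0(3)] t0(4) by simp
    \<comment> \<open>The slope of the penalization in \<open>|x|\<^sup>2\<close> at the first
      contact.\<close>
    define A where "A = s / (1 + (norm x0)\<^sup>2)"
    have "0 < 1 + (norm x0)\<^sup>2" by (simp add: add_pos_nonneg)
    then have A: "0 < A" using s by (simp add: A_def)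
    have "\<forall>\<^sub>F z in nhds x0. z \<in> {z :: real^'n. r < norm z}"
      by (rule eventually_nhds_in_open) (use x0r in \<open>auto intro!: open_Collect_less continuous_intros\<close>)
    then have mx: "\<forall>\<^sub>F z in nhds x0. f t0 z - A * (norm (z - 0))\<^sup>2 \<le> f t0 x0 - A * (norm (x0 - 0))\<^sup>2"
    proof (rule eventually_mono)
      fix z :: "real^'n" assume "z \<in> {z. r < norm z}"
      then have "f t0 z \<le> u t0 z" using at[of z] by simp
      moreover have "s * ln (1 + (norm z)\<^sup>2) \<le> s * (ln (1 + (norm x0)\<^sup>2) + ((norm z)\<^sup>2 - (norm x0)\<^sup>2) / (1 + (norm x0)\<^sup>2))"
        using ln_tangent[of z x0] s by (intro mult_left_mono) auto
      moreover have "s * (ln (1 + (norm x0)\<^sup>2) + ((norm z)\<^sup>2 - (norm x0)\<^sup>2) / (1 + (norm x0)\<^sup>2)) =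
          s * ln (1 + (norm x0)\<^sup>2) + A * (norm z)\<^sup>2 - A * (norm x0)\<^sup>2"
        by (simp add: A_def diff_divide_distrib algebra_simps)
      ultimately show "f t0 z - A * (norm (z - 0))\<^sup>2 \<le> f t0 x0 - A * (norm (x0 - 0))\<^sup>2"
        unfolding eq by (simp add: u_def)
    qed
    have cf0: "c \<le> f t0 x0"
    proof -
      have "0 < s * ln (1 + (norm x0)\<^sup>2)" using lnp[OF t0(3)] s by simp
      moreover have "0 \<le> G * (t0 - t1)" using G t0 by simp
      ultimately show ?thesis using t0(4) by (simp add: u_def)
    qed
    then have fp: "0 < f t0 x0" using c by linarith
    obtain D where D: "((\<lambda>s. f s x0) has_real_derivative D) (at t0 within {0..1})"
      "D \<le> 2 * A * (?n * (\<Lambda> * (1 + norm x0) powr (2 * \<beta>))) + growth t0 * f t0 x0"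
      using local_max_bound[OF t01 fp less_imp_le[OF A] mx] by blast
    have "(1 + norm x0) powr (2 * \<beta>) \<le> (1 + norm x0) powr 2"
      using one_plus_norm(1)[of x0] \<beta>1 by (intro powr_mono) auto
    also have "\<dots> = (1 + norm x0)\<^sup>2" using one_plus_norm(2)[of x0] by simp
    also have "\<dots> \<le> 2 * (1 + (norm x0)\<^sup>2)"
      using zero_le_power2[of "1 - norm x0"] by (simp add: power2_eq_square algebra_simps)
    finally have "2 * A * (?n * (\<Lambda> * (1 + norm x0) powr (2 * \<beta>))) \<le> 2 * A * (?n * (\<Lambda> * (2 * (1 + (norm x0)\<^sup>2))))"
      using A pos by (intro mult_left_mono) auto
    also have "\<dots> = 4 * ?n * \<Lambda> * s"
    proof -
      have "A * (1 + (norm x0)\<^sup>2) = s" using \<open>0 < 1 + (norm x0)\<^sup>2\<close> unfolding A_def by simp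
      moreover have "2 * A * (?n * (\<Lambda> * (2 * w))) = 4 * ?n * \<Lambda> * (A * w)" for w by simp
      ultimately show ?thesis by (simp only:)
    qed
    also have "\<dots> < 1" by (rule s(2))
    finally have "D < G" using D(2) G0(2)[OF t01 cf0] by (simp add: G_def)
    then have e: "0 < G - D" by simp
    obtain d where d: "d > 0" "\<forall>q. 0 \<le> q \<and> q < t0 \<and> t0 - d < q \<and> t0 \<le> 1 \<longrightarrow>
        \<bar>(f t0 x0 - f q x0) - D * (t0 - q)\<bar> \<le> (G - D) * (t0 - q)"
      using left_quotient_eventually[OF D(1) e] by blast
    obtain q where q: "max t1 (t0 - d) < q" "q < t0" using dense[of "max t1 (t0 - d)" t0] t10 d(1) by auto
    have "(f t0 x0 - f q x0) - D * (t0 - q) \<le> (G - D) * (t0 - q)"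
      using d(2)[rule_format, of q] q ts t01 by (auto simp: abs_le_iff)
    moreover have "f q x0 < u q x0" using before[of q x0] q t0 by auto
    moreover have "u t0 x0 - u q x0 = G * (t0 - q)" by (simp add: u_def algebra_simps)
    ultimately show False using eq by (simp add: algebra_simps)
  qed
  have "f t x \<le> c + G * (t - t1)" if h: "t1 \<le> t" "t \<le> t2" "r \<le> norm x" for t x
  proof (rule field_le_epsilon)
    fix e :: real assume e: "0 < e"
    define s where "s = min (e / (1 + ln (1 + (norm x)\<^sup>2))) (1 / (8 * ?n * \<Lambda>))"
    have l0: "0 \<le> ln (1 + (norm x)\<^sup>2)" by simp
    have n: "0 < ?n" by simp
    have s: "0 < s" using e l0 n pos by (simp add: s_def add_pos_nonneg)
    have "s \<le> 1 / (8 * ?n * \<Lambda>)" by (simp add: s_def)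
    then have "s * (8 * ?n * \<Lambda>) \<le> 1" using n pos by (simp add: pos_le_divide_eq)
    then have s2: "4 * ?n * \<Lambda> * s < 1" by (simp add: mult_ac)
    have "s \<le> e / (1 + ln (1 + (norm x)\<^sup>2))" by (simp add: s_def)
    then have "s * (1 + ln (1 + (norm x)\<^sup>2)) \<le> e" using l0 by (simp add: pos_le_divide_eq add_pos_nonneg)
    then have "s * ln (1 + (norm x)\<^sup>2) \<le> e" using s by (simp add: distrib_left)
    then show "f t x \<le> c + G * (t - t1) + e" using pen[OF h s s2] by linarith
  qed
  then show ?thesis using G by (intro exI[of _ G]) auto
qed

end

text \<open>Localization of a contact point of a tilted paraboloid: \<open>e1\<close> is its radial
  and \<open>P\<close> its scaled transverse displacement. The radial tilt \<open>u\<close> costs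
  little outwards, where \<open>e1 \<le> w\<close>, but penalizes moves inwards by more than a
  multiple of \<open>w\<close>. The first conclusion will contradict the drop of the barrier further
  out.\<close>

lemma far_inequalities:
  fixes H0 Hx E \<mu> e1 P u w l :: real
  assumes key: "H0 - 3 * (\<mu> * E / 16) \<le> Hx - e1\<^sup>2 / l\<^sup>2 - P\<^sup>2 + u * e1 + P * sqrt (\<mu> * E)"
    and Hx: "Hx \<le> H0 + E" and e1: "e1 \<le> w" and u: "\<mu> * E / 4 / (2 * w) \<le> u" "u \<le> \<mu> * E / 4 / w"
    and pos: "0 < \<mu>" "\<mu> \<le> 1 / 3" "0 < E" "E \<le> 1 / 100" "0 < w" "0 \<le> P"
  shows "H0 - \<mu> * E < Hx" "- (16 / \<mu> * w) \<le> e1" "P \<le> 1"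
proof -
  define k where "k = \<mu> * E"
  have k: "0 < k" "k \<le> E / 3" using pos mult_right_mono[of \<mu> "1 / 3" E] by (auto simp: k_def)
  have u0: "0 < u" using u(1) pos by (smt (verit) divide_pos_pos mult_pos_pos)
  have sk: "sqrt k ^ 2 = k" using k by simp
  \<comment> \<open>The linear term in \<open>P\<close> is absorbed in two ways: either all of
    \<open>P\<^sup>2\<close> is spent, or half of it is kept in order to bound
    \<open>P\<close>.\<close>
  have P1: "P * sqrt k \<le> P\<^sup>2 + k / 4"
    using zero_le_power2[of "P - sqrt k / 2"] sk by (simp add: power2_diff power_divide)
  have P2: "P * sqrt k \<le> P\<^sup>2 / 2 + k / 2"
    using zero_le_power2[of "P - sqrt k"] sk by (simp add: power2_diff)
  have ue: "u * e1 \<le> k / 4"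
  proof -
    have "u * e1 \<le> u * w" using e1 u0 by (intro mult_left_mono) auto
    also have "\<dots> \<le> k / 4 / w * w" using u(2) pos by (intro mult_right_mono) (auto simp: k_def)
    finally show ?thesis using pos by simp
  qed
  have el: "0 \<le> e1\<^sup>2 / l\<^sup>2" by simp
  note key' = key[folded k_def]
  show "H0 - \<mu> * E < Hx" using key' P1 ue el k unfolding k_def[symmetric] by linarith
  have "P\<^sup>2 / 2 \<le> 2 * E" using key' P2 ue el k Hx by linarith
  then have "P\<^sup>2 \<le> 1\<^sup>2" using pos by simp
  then show "P \<le> 1" by (rule power2_le_imp_le) simp
  have "- (u * e1) \<le> 2 * E" using key' P1 el k Hx pos by linarith
  then have neg: "u * (- e1) \<le> 2 * E" by simp
  show "- (16 / \<mu> * w) \<le> e1"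
  proof (cases "0 \<le> e1")
    case True
    moreover have "0 < 16 / \<mu> * w" using pos by simp
    ultimately show ?thesis by linarith
  next
    case False
    have "k / 4 / (2 * w) * (- e1) \<le> u * (- e1)" using u(1) False by (intro mult_right_mono) (auto simp: k_def)
    then have "k / (8 * w) * (- e1) \<le> 2 * E" using neg by simp
    then have "\<mu> * E * (- e1) \<le> 2 * E * (8 * w)" using pos by (simp add: k_def field_simps)
    then have "E * (\<mu> * (- e1)) \<le> E * (16 * w)" by (simp add: mult_ac)
    then have "\<mu> * (- e1) \<le> 16 * w" using pos by (simp only: mult_le_cancel_left_pos)
    then show ?thesis using pos by (simp add: field_simps)
  qed
qed

lemma far_upper:
  fixes E \<mu> e1 P u w :: real
  assumes e1: "e1 \<le> w" and u: "0 \<le> u" "u \<le> \<mu> * E / 4 / w"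
    and pos: "0 < \<mu>" "\<mu> \<le> 1 / 3" "0 < E" "0 < w"
  shows "u * e1 + P * sqrt (\<mu> * E) - P\<^sup>2 \<le> E / 3"
proof -
  define k where "k = \<mu> * E"
  have k: "0 < k" "k \<le> E / 3" using pos mult_right_mono[of \<mu> "1 / 3" E] by (auto simp: k_def)
  have "P * sqrt k \<le> P\<^sup>2 + k / 4"
    using zero_le_power2[of "P - sqrt k / 2"] k by (simp add: power2_diff power_divide)
  moreover have "u * e1 \<le> k / 4"
  proof -
    have "u * e1 \<le> u * w" using e1 u by (intro mult_left_mono) auto
    also have "\<dots> \<le> k / 4 / w * w" using u(2) pos by (intro mult_right_mono) (auto simp: k_def)
    finally show ?thesis using pos by simp
  qed
  ultimately show ?thesis using k unfolding k_def[symmetric] by linarith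
qed

text \<open>Here the exponent \<open>1 / n\<close> in the barrier is justified. The box has length
  of order \<open>E * X0 * l\<close> along the radius and \<open>sqrt E * l\<close> across it, so
  its volume relative to \<open>l ^ n\<close> is of order \<open>X0 * E * sqrt E ^ (n - 1)\<close>.
  With \<open>E\<close> of order \<open>X0 powr (- 1 / n)\<close> the remaining power of
  \<open>X0\<close> is \<open>(n - 1) / (2 * n)\<close>, which is nonnegative.\<close>

lemma far_volume:
  fixes E \<mu> Z X0 l :: real and n :: nat
  assumes n: "1 \<le> n" and X0: "1 \<le> X0" and \<mu>: "0 < \<mu>" and E: "E = 1 / 200 * (1 + X0) powr (- (1 / real n))" and l: "0 < l"
    and U: "\<mu> * E * X0 * l / 64 \<le> U" and V: "V = sqrt (\<mu> * E) * l / 2"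
  shows "\<mu> / 64 / 400 * (sqrt \<mu> / (40 * real n)) ^ (n - 1) * l ^ n \<le> 2 ^ n * U * (V / real n) ^ (n - 1)"
proof -
  define Z where "Z = 1 + X0"
  have Z: "2 \<le> Z" "Z \<le> 2 * X0" using X0 by (auto simp: Z_def)
  have E0: "0 < E" using X0 by (simp add: E)
  have sE: "1 / 20 * Z powr (- (1 / (2 * real n))) \<le> sqrt E"
  proof (rule real_le_rsqrt)
    have "(Z powr (- (1 / (2 * real n))))\<^sup>2 = Z powr (- (1 / real n))"
      using Z n by (simp add: powr_power)
    then show "(1 / 20 * Z powr (- (1 / (2 * real n))))\<^sup>2 \<le> E"
      unfolding power_mult_distrib E Z_def[symmetric] by (simp add: power2_eq_square)
  qed
  have "1 / 400 * (1 / 20) ^ (n - 1) \<le> E * X0 * sqrt E ^ (n - 1)"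
  proof -
    have "Z powr (- 1) \<le> Z powr (- (1 / real n) - real (n - 1) / (2 * real n))"
    proof (rule powr_mono)
      have "1 / real n + real (n - 1) / (2 * real n) \<le> 1" using n by (simp add: field_simps of_nat_diff)
      then show "- 1 \<le> - (1 / real n) - real (n - 1) / (2 * real n)" by linarith
    qed (use Z in auto)
    then have "Z * Z powr (- 1) \<le> Z * Z powr (- (1 / real n) - real (n - 1) / (2 * real n))"
      using Z by (intro mult_left_mono) auto
    also have "\<dots> \<le> 2 * X0 * Z powr (- (1 / real n) - real (n - 1) / (2 * real n))"
      using Z by (intro mult_right_mono) auto
    also have "Z * Z powr (- 1) = 1" using Z by (simp add: powr_neg_one)
    also have "Z powr (- (1 / real n) - real (n - 1) / (2 * real n)) =
        Z powr (- (1 / real n)) * (Z powr (- (1 / (2 * real n)))) ^ (n - 1)"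
    proof -
      have "(Z powr (- (1 / (2 * real n)))) ^ (n - 1) = Z powr (- (real (n - 1) / (2 * real n)))"
        using Z by (simp add: powr_power)
      then show ?thesis by (simp add: powr_add[symmetric])
    qed
    finally have 1: "1 \<le> 2 * X0 * (Z powr (- (1 / real n)) * (Z powr (- (1 / (2 * real n)))) ^ (n - 1))" .
    have "1 / 400 * (1 / 20) ^ (n - 1) * 1 \<le> 1 / 400 * (1 / 20) ^ (n - 1) *
        (2 * X0 * (Z powr (- (1 / real n)) * (Z powr (- (1 / (2 * real n)))) ^ (n - 1)))"
      using 1 by (intro mult_left_mono) auto
    also have "\<dots> = E * X0 * (1 / 20 * Z powr (- (1 / (2 * real n)))) ^ (n - 1)"
      unfolding E Z_def[symmetric] power_mult_distrib by simp
    also have "\<dots> \<le> E * X0 * sqrt E ^ (n - 1)"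
      using sE E0 X0 Z by (intro mult_left_mono power_mono) auto
    finally show ?thesis by simp
  qed
  then have "\<mu> / 64 * (sqrt \<mu> / (2 * real n)) ^ (n - 1) * l ^ n * (1 / 400 * (1 / 20) ^ (n - 1))
     \<le> \<mu> / 64 * (sqrt \<mu> / (2 * real n)) ^ (n - 1) * l ^ n * (E * X0 * sqrt E ^ (n - 1))"
    using \<mu> l by (intro mult_left_mono) auto
  also have "\<dots> = \<mu> * E * X0 * l / 64 * (V / real n) ^ (n - 1)"
  proof -
    have "V / real n = sqrt \<mu> / (2 * real n) * sqrt E * l" by (simp add: V real_sqrt_mult)
    then have "(V / real n) ^ (n - 1) = (sqrt \<mu> / (2 * real n)) ^ (n - 1) * sqrt E ^ (n - 1) * l ^ (n - 1)"
      by (simp only: power_mult_distrib)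
    moreover have "l ^ n = l * l ^ (n - 1)" using n by (simp add: power_eq_if)
    ultimately show ?thesis by simp
  qed
  also have "\<dots> \<le> 2 ^ n * U * (V / real n) ^ (n - 1)"
  proof (rule mult_right_mono)
    have "0 \<le> \<mu> * E * X0 * l / 64" using \<mu> E0 X0 l by simp
    then have "0 \<le> U" using U by linarith
    then have "1 * U \<le> 2 ^ n * U" by (intro mult_right_mono) auto
    then show "\<mu> * E * X0 * l / 64 \<le> 2 ^ n * U" using U by linarith
  next
    have "0 \<le> V" unfolding V using \<mu> E0 l by simp
    then show "0 \<le> (V / real n) ^ (n - 1)" by simp
  qed
  also have "\<mu> / 64 * (sqrt \<mu> / (2 * real n)) ^ (n - 1) * l ^ n * (1 / 400 * (1 / 20) ^ (n - 1)) =
     \<mu> / 64 / 400 * (sqrt \<mu> / (40 * real n)) ^ (n - 1) * l ^ n"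
  proof -
    have "(sqrt \<mu> / (40 * real n)) ^ (n - 1) = (sqrt \<mu> / (2 * real n) * (1 / 20)) ^ (n - 1)" by simp
    then show ?thesis by (simp only: power_mult_distrib) simp
  qed
  finally show ?thesis .
qed

section \<open>The barrier\<close>

text \<open>For very negative \<open>\<beta>\<close> the weight \<open>(1 + |x|) powr \<beta>\<close> varies on the length \<open>1 / |\<beta>|\<close>, which
  may be smaller than the diffusion length \<open>sqrt t * (1 + |x|) powr \<beta>\<close>. Their ratio is the
  quantity \<open>scale_ratio\<close>. The barrier is slightly lower where the ratio is small. Hence
  the points of contact cannot lie much further out than the centre of the paraboloids, and the paraboloids
  themselves are tilted so that they do not lie much further in.\<close>

definition scale_ratio :: "real \<Rightarrow> real \<Rightarrow> real^'n \<Rightarrow> real" where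
  "scale_ratio \<beta> t x = max 0 (- \<beta>) * (sqrt t * (1 + norm x) powr \<beta>)"

definition barrier :: "real \<Rightarrow> real \<Rightarrow> real^'n \<Rightarrow> real" where
  "barrier \<beta> t x = 199 / 200 - 1 / 200 * (1 + scale_ratio \<beta> t x) powr (- (1 / real CARD('n)))"

lemma scale_ratio_nonneg: "0 \<le> t \<Longrightarrow> 0 \<le> scale_ratio \<beta> t x"
  by (simp add: scale_ratio_def)

lemma scale_ratio_mono: "0 \<le> s \<Longrightarrow> s \<le> t \<Longrightarrow> scale_ratio \<beta> s x \<le> scale_ratio \<beta> t x"
  unfolding scale_ratio_def by (intro mult_left_mono mult_right_mono) auto

lemma barrier_mono:
  fixes x y :: "real^'n"
  assumes "0 \<le> s" "0 \<le> t" "scale_ratio \<beta> s x \<le> scale_ratio \<beta> t y"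
  shows "barrier \<beta> s x \<le> barrier \<beta> t y"
proof -
  have "(1 + scale_ratio \<beta> t y) powr (- (1 / real CARD('n))) \<le> (1 + scale_ratio \<beta> s x) powr (- (1 / real CARD('n)))"
    using assms scale_ratio_nonneg[of s \<beta> x] by (intro powr_mono2') auto
  then show ?thesis by (simp add: barrier_def)
qed

lemma barrier_bounds:
  assumes "0 \<le> t"
  shows "99 / 100 \<le> barrier \<beta> t x" "barrier \<beta> t (x :: real^'n) \<le> 199 / 200"
proof -
  have "(1 + scale_ratio \<beta> t x) powr (- (1 / real CARD('n))) \<le> (1 + scale_ratio \<beta> t x) powr 0"
    using scale_ratio_nonneg[OF assms, of \<beta> x] by (intro powr_mono) auto
  then have "(1 + scale_ratio \<beta> t x) powr (- (1 / real CARD('n))) \<le> 1"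
    using scale_ratio_nonneg[OF assms, of \<beta> x] by simp
  then show "99 / 100 \<le> barrier \<beta> t x" by (simp add: barrier_def)
  show "barrier \<beta> t x \<le> 199 / 200" by (simp add: barrier_def)
qed

text \<open>When a scale ratio that is at least 1 is halved, one plus it shrinks at least by the
  factor 3/4. The gap is the resulting relative increase of its power with exponent
  \<open>- 1 / n\<close>, the quantity subtracted in the barrier.\<close>

definition barrier_gap :: "nat \<Rightarrow> real" where
  "barrier_gap n = (4 / 3) powr (1 / real n) - 1"

lemma barrier_gap_bounds:
  assumes "1 \<le> n"
  shows "0 < barrier_gap n" "barrier_gap n \<le> 1 / 3"
proof -
  have "(4 / 3 :: real) powr 0 < (4 / 3) powr (1 / real n)" using assms by (intro powr_less_mono) auto
  then show "0 < barrier_gap n" by (simp add: barrier_gap_def)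
  have "(4 / 3 :: real) powr (1 / real n) \<le> (4 / 3) powr 1" using assms by (intro powr_mono) auto
  then show "barrier_gap n \<le> 1 / 3" by (simp add: barrier_gap_def)
qed

lemma barrier_drop:
  fixes x y :: "real^'n"
  assumes "0 \<le> t" "1 \<le> scale_ratio \<beta> t x" "scale_ratio \<beta> t y \<le> scale_ratio \<beta> t x / 2"
  shows "barrier \<beta> t y \<le> barrier \<beta> t x
    - barrier_gap CARD('n) * (1 / 200 * (1 + scale_ratio \<beta> t x) powr (- (1 / real CARD('n))))"
proof -
  let ?p = "- (1 / real CARD('n))"
  let ?X = "scale_ratio \<beta> t x" and ?Y = "scale_ratio \<beta> t y"
  have Y: "0 \<le> ?Y" by (rule scale_ratio_nonneg[OF assms(1)])
  have "1 + ?Y \<le> 3 / 4 * (1 + ?X)" using assms by simp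
  then have "(3 / 4 * (1 + ?X)) powr ?p \<le> (1 + ?Y) powr ?p" using Y by (intro powr_mono2') auto
  also have "(3 / 4 * (1 + ?X)) powr ?p = (3 / 4) powr ?p * (1 + ?X) powr ?p" by (rule powr_mult)
  also have "(3 / 4 :: real) powr ?p = (4 / 3) powr (1 / real CARD('n))"
  proof -
    have "ln (3 / 4 :: real) = - ln (4 / 3)" by (simp add: ln_div)
    then show ?thesis unfolding powr_def by simp
  qed
  finally have "(1 + barrier_gap CARD('n)) * (1 + ?X) powr ?p \<le> (1 + ?Y) powr ?p" by (simp add: barrier_gap_def)
  then show ?thesis by (simp add: barrier_def algebra_simps)
qed

lemma powr_ge_one_plus:
  fixes b u :: real
  assumes "1 \<le> b" "0 \<le> u"
  shows "1 + b * u \<le> (1 + u) powr b"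
proof -
  have "(1 + u) powr b = exp (b * ln (1 + u))" using assms by (simp add: powr_def)
  let ?h = "\<lambda>u. (1 + u) powr b - b * u"
  have "?h 0 \<le> ?h u"
  proof (rule DERIV_nonneg_imp_nondecreasing[OF assms(2)])
    fix x :: real assume x: "0 \<le> x" "x \<le> u"
    have "1 \<le> (1 + x) powr (b - 1)" using x assms by (intro ge_one_powr_ge_zero) auto
    then have "0 \<le> b * (1 + x) powr (b - 1) - b" using assms mult_left_mono[of 1 "(1 + x) powr (b - 1)" b] by simp
    moreover have "(?h has_real_derivative (b * (1 + x) powr (b - 1) - b)) (at x)"
      using x by (auto intro!: derivative_eq_intros)
    ultimately show "\<exists>y. (?h has_real_derivative y) (at x) \<and> 0 \<le> y" by blast
  qed
  then show ?thesis by simp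
qed

text \<open>With \<open>b = - \<beta>\<close>, enlarging \<open>1 + |x|\<close> by the factor
  \<open>1 + 1 / b\<close> divides the weight by \<open>(1 + 1 / b) powr b\<close>, which is at
  least 2 by Bernoulli's inequality for real exponents.\<close>

lemma scale_ratio_outer:
  fixes x y :: "real^'n"
  assumes "\<beta> \<le> - 1" "0 \<le> t" "(1 + norm x) * (1 + 1 / (- \<beta>)) \<le> 1 + norm y"
  shows "scale_ratio \<beta> t y \<le> scale_ratio \<beta> t x / 2"
proof -
  let ?b = "- \<beta>"
  have b: "1 \<le> ?b" using assms by simp
  have r: "0 < 1 + norm x" "0 < 1 + norm y" using one_plus_norm(2) by auto
  have B: "2 \<le> (1 + 1 / ?b) powr ?b"
  proof -
    have "1 + 1 / ?b > 0" using b by (simp add: add_pos_pos)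
    have "1 + ?b * (1 / ?b) \<le> (1 + 1 / ?b) powr ?b" using b by (intro powr_ge_one_plus) auto
    then show ?thesis using b by simp
  qed
  have "(1 + norm y) powr \<beta> \<le> ((1 + norm x) * (1 + 1 / ?b)) powr \<beta>"
    using assms r b by (intro powr_mono2') (auto simp: add_pos_pos)
  also have "\<dots> = (1 + norm x) powr \<beta> * (1 + 1 / ?b) powr \<beta>" by (rule powr_mult)
  also have "(1 + 1 / ?b) powr \<beta> \<le> 1 / 2"
  proof -
    have "(1 + 1 / ?b) powr \<beta> = 1 / (1 + 1 / ?b) powr ?b" using powr_minus_divide[of "1 + 1 / ?b" ?b] by simp
    also have "\<dots> \<le> 1 / 2" using B by (intro divide_left_mono) auto
    finally show ?thesis .
  qed
  finally have "(1 + norm y) powr \<beta> \<le> (1 + norm x) powr \<beta> / 2" by (simp add: mult_left_mono)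
  then have "max 0 ?b * (sqrt t * (1 + norm y) powr \<beta>) \<le> max 0 ?b * (sqrt t * ((1 + norm x) powr \<beta> / 2))"
    using assms by (intro mult_left_mono) auto
  then show ?thesis by (simp add: scale_ratio_def)
qed

text \<open>The lower bound of \<open>far_volume\<close> for the measure of the box relative to
  \<open>l ^ n\<close>.\<close>

definition far_const :: "nat \<Rightarrow> real" where
  "far_const n = barrier_gap n / 64 / 400 * (sqrt (barrier_gap n) / (40 * real n)) ^ (n - 1)"

text \<open>By \<open>1 + z \<le> exp z\<close>, a relative displacement of order
  \<open>1 / b\<close> changes the power with exponent \<open>b\<close> by a bounded factor only. In
  the far case \<open>c = 1\<close> is used outwards and \<open>c = 32 / \<mu>\<close>
  inwards.\<close>

lemma two_scale_weight:
  fixes b R r c :: real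
  assumes "1 \<le> b" "0 < r" "0 \<le> c" "R \<le> r * (1 + c / b)" "0 < R"
  shows "R powr b \<le> exp c * r powr b"
proof -
  have "R powr b \<le> (r * (1 + c / b)) powr b" using assms by (intro powr_mono2) auto
  also have "\<dots> \<le> (r * exp (c / b)) powr b"
    using assms exp_ge_add_one_self[of "c / b"] by (intro powr_mono2 mult_left_mono) auto
  also have "\<dots> = r powr b * exp (c / b) powr b" by (rule powr_mult)
  also have "exp (c / b) powr b = exp c" using assms by (simp add: powr_def)
  finally show ?thesis by (simp add: mult.commute)
qed

section \<open>Contact where the weight varies on a shorter length\<close>

context parabolic_setting
begin

text \<open>Now the weight varies on the length \<open>w = (1 + |x0|) / |\<beta>|\<close>, while the
  diffusion length \<open>l\<close> may be much larger. Contact points must stay within a multiple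
  of \<open>w\<close> radially: outwards by the drop of the barrier, inwards by tilting the
  paraboloids. Transversally a displacement of \<open>l\<close> is allowed, since only the norm
  matters for the weight.\<close>

lemma far_case:
  defines "\<mu> \<equiv> barrier_gap CARD('n)"
  assumes t0: "0 < t0" "t0 \<le> 1" "t0 \<le> time_bound K" and K: "0 < K"
    and up: "\<And>t x. 0 < t \<Longrightarrow> t \<le> t0 \<Longrightarrow> f t x \<le> decay CARD('n) K t * barrier \<beta> t x"
    and far: "1 < scale_ratio \<beta> t0 x0"
    and E: "E = 1 / 200 * (1 + scale_ratio \<beta> t0 x0) powr (- (1 / real CARD('n)))"
    and lo: "decay CARD('n) K t0 * (barrier \<beta> t0 x0 - \<mu> * E / 16) \<le> f t0 x0"
  shows "\<mu> / 16 * far_const CARD('n) * K \<le>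
    step_const CARD('n) (\<mu> / (32 * real CARD('n))) (exp (32 / \<mu>)) * ((1 + \<Lambda>) ^ (CARD('n) + 1) * N / \<delta>)"
proof -
  let ?n = "real CARD('n)"
  define \<theta> where "\<theta> = exp (32 / \<mu>)"
  have n1: "1 \<le> CARD('n)" by (simp add: Suc_le_eq)
  have \<mu>: "0 < \<mu>" "\<mu> \<le> 1 / 3" unfolding \<mu>_def using barrier_gap_bounds[OF n1] by auto
  define m where "m = decay CARD('n) K t0"
  have m: "0 < m" using K t0 by (simp add: m_def)
  define R where "R = 1 + norm x0"
  have R: "1 \<le> R" by (simp add: R_def)
  define b where "b = - \<beta>"
  define X0 where "X0 = scale_ratio \<beta> t0 x0"
  have X0: "1 < X0" using far by (simp add: X0_def)
  have b0: "0 < b" using X0 by (cases "0 < b") (auto simp: X0_def scale_ratio_def b_def)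
  define q where "q = R powr (- \<beta>)"
  have q: "0 < q" "1 \<le> q" using R b0 by (auto simp: q_def b_def[symmetric] ge_one_powr_ge_zero)
  define l where "l = sqrt t0 / q"
  have l: "0 < l" using t0 q by (simp add: l_def)
  have Xb: "X0 = b * l"
    using b0 R by (simp add: X0_def scale_ratio_def b_def l_def q_def R_def powr_minus_divide max_def)
  have l1: "l \<le> 1 / q" using t0 q by (simp add: l_def divide_right_mono)
  have bq: "q < b"
  proof -
    have "1 < b * (1 / q)" using X0 Xb l1 b0 by (smt (verit) mult_left_mono)
    then show ?thesis using q by (simp add: field_simps)
  qed
  have b: "1 \<le> b" using bq q by linarith
  \<comment> \<open>A scale ratio above 1 forces \<open>q = R powr b < b\<close>, whereas
    \<open>2 powr b\<close> is at least \<open>1 + b\<close>. So this case only concerns points near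
    the origin.\<close>
  have R2: "R < 2"
  proof (rule ccontr)
    assume "\<not> R < 2"
    then have "2 powr b \<le> R powr b" using b by (intro powr_mono2) auto
    moreover have "1 + b * 1 \<le> (1 + 1) powr b" by (rule powr_ge_one_plus) (use b in auto)
    ultimately show False using bq by (simp add: q_def b_def[symmetric])
  qed
  define w where "w = R / b"
  have w: "0 < w" "w \<le> 2 / b" using R R2 b by (auto simp: w_def divide_right_mono)
  have lw: "X0 / 2 * w \<le> l"
  proof -
    have "l = X0 / b" using Xb b0 by simp
    moreover have "X0 / 2 * w = X0 / b * (R / 2)" by (simp add: w_def)
    moreover have "X0 / b * (R / 2) \<le> X0 / b * 1" using R2 X0 b0 by (intro mult_left_mono) auto
    ultimately show ?thesis by simp
  qed
  have E0: "0 < E" "E \<le> 1 / 200"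
  proof -
    show "0 < E" using X0 unfolding E X0_def[symmetric] by simp
    have "(1 + X0) powr (- (1 / ?n)) \<le> (1 + X0) powr 0" using X0 by (intro powr_mono) auto
    then show "E \<le> 1 / 200" using X0 unfolding E X0_def[symmetric] by simp
  qed
  have \<mu>E: "0 < \<mu> * E" "\<mu> * E \<le> E / 3" using \<mu> E0 mult_right_mono[of \<mu> "1 / 3" E] by auto
  define H where "H x = barrier \<beta> t0 x" for x :: "real^'n"
  have H0: "H x0 = 199 / 200 - E" by (simp add: H_def barrier_def E)
  have Hle: "H x \<le> 199 / 200" for x unfolding H_def using barrier_bounds(2)[of t0] t0 by simp
  define e where "e = (if x0 = 0 then axis undefined 1 else (1 / norm x0) *\<^sub>R x0)"
  have e: "norm e = 1" by (simp add: e_def norm_axis_1)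
  have xe: "x0 \<bullet> e = norm x0" by (simp add: e_def power2_norm_eq_inner[symmetric] power2_eq_square)
  have ee: "e \<bullet> e = 1" using e by (simp add: dot_square_norm)
  define k where "k = \<mu> * E / 4"
  have k0: "0 < k" using \<mu>E by (simp add: k_def)
  \<comment> \<open>Chosen so that the tilt \<open>u\<close> of every vertex lies between
    \<open>k / (2 * w)\<close> and \<open>k / w\<close>: outward displacements up to
    \<open>w\<close> then gain at most \<open>k = \<mu> * E / 4\<close>.\<close>
  define U where "U = k * l\<^sup>2 / (8 * w)"
  define V where "V = sqrt (\<mu> * E) * l / 2"
  have UV: "0 < U" "0 < V" using k0 l w \<mu>E by (auto simp: U_def V_def)
  \<comment> \<open>Vertices shifted outwards tilt the paraboloids at \<open>x0\<close>; with
    half-length \<open>U\<close> the radial offset stays between \<open>2 * U\<close> and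
    \<open>4 * U\<close>.\<close>
  define y0 where "y0 = x0 + (3 * U) *\<^sub>R e"
  obtain Y where Y: "compact Y"
    "\<And>y. y \<in> Y \<Longrightarrow> \<bar>(y - y0) \<bullet> e\<bar> \<le> U \<and> norm (y - y0 - ((y - y0) \<bullet> e) *\<^sub>R e) \<le> V"
    "2 ^ CARD('n) * U * (V / ?n) ^ (CARD('n) - 1) \<le> measure lborel Y"
    using oriented_box[OF e UV, of y0] by blast
  define A where "A = 1 * m * q\<^sup>2 / t0"
  have A: "0 < A" using m q t0 by (simp add: A_def)
  have Al: "A = m / l\<^sup>2" using q t0 by (simp add: A_def l_def power_divide)
  \<comment> \<open>The relative length of the time interval, short enough that the decay function
    changes by at most the fraction \<open>\<mu> * E / 16\<close>.\<close>
  define h where "h = \<mu> / (32 * ?n) * E"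
  have hn: "2 * ?n * h = \<mu> * E / 16" by (simp add: h_def)
  have h0: "0 < h" using \<mu>E by (simp add: h_def)
  have h1: "h < 1"
  proof -
    have "1 * h \<le> ?n * h" using h0 n1 by (intro mult_right_mono) (auto simp: Suc_le_eq)
    then show ?thesis using hn \<mu>E E0 by linarith
  qed
  define t1 where "t1 = t0 * (1 - \<mu> / (32 * ?n) * E)"
  have t1h: "t1 = t0 * (1 - h)" by (simp add: t1_def h_def)
  have t1: "0 < t1" "t1 < t0"
  proof -
    show "0 < t1" unfolding t1h using t0 h1 by simp
    have "t0 * (1 - h) < t0 * 1" using t0 h0 by (intro mult_strict_left_mono) auto
    then show "t1 < t0" by (simp add: t1h)
  qed
  \<comment> \<open>The second ball bounds the radial displacement by \<open>w\<close> in advance;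
    the barrier then shows that contact stays strictly inside it. The first ball has room for the
    displacements allowed by \<open>far_inequalities\<close>.\<close>
  define X where "X = cball x0 ((16 / \<mu> + 2) * w + 2 * l) \<inter> cball 0 (norm x0 + w)"
  define e1 where "e1 x = (x - x0) \<bullet> e" for x
  define P where "P x = norm (x - x0 - e1 x *\<^sub>R e) / l" for x
  define u where "u y = 2 * ((y - x0) \<bullet> e) / l\<^sup>2" for y
  \<comment> \<open>An upper bound for the change of the paraboloid between \<open>x0\<close> and
    \<open>x\<close>, in units of \<open>m\<close>: its linear part splits into the radial tilt and
    a transverse part bounded by Cauchy-Schwarz with
    \<open>V = sqrt (\<mu> * E) * l / 2\<close>.\<close>
  define \<Phi> where "\<Phi> x y = - ((e1 x)\<^sup>2 / l\<^sup>2) - (P x)\<^sup>2 + u y * e1 x + P x * sqrt (\<mu> * E)" for x y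
  have P0: "0 \<le> P x" for x using l by (simp add: P_def)
  have u: "\<mu> * E / 4 / (2 * w) \<le> u y" "u y \<le> \<mu> * E / 4 / w" if "y \<in> Y" for y
  proof -
    have "(y - y0) \<bullet> e = (y - x0) \<bullet> e - 3 * U" by (simp add: y0_def inner_diff_left inner_add_left ee)
    then have "2 * U \<le> (y - x0) \<bullet> e" "(y - x0) \<bullet> e \<le> 4 * U" using Y(2)[OF that] by (auto simp: abs_le_iff)
    then have "2 * (2 * U) / l\<^sup>2 \<le> u y" "u y \<le> 2 * (4 * U) / l\<^sup>2"
      unfolding u_def by (auto intro!: divide_right_mono)
    moreover have "2 * (2 * U) / l\<^sup>2 = k / (2 * w)" "2 * (4 * U) / l\<^sup>2 = k / w"
      using l w by (simp_all add: U_def field_simps)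
    ultimately show "\<mu> * E / 4 / (2 * w) \<le> u y" "u y \<le> \<mu> * E / 4 / w" by (simp_all add: k_def)
  qed
  have u0: "0 \<le> u y" if "y \<in> Y" for y
    using u(1)[OF that] \<mu>E w by (smt (verit) divide_nonneg_pos)
  have geo: "F - A * (norm (x - y))\<^sup>2 + A * (norm (x0 - y))\<^sup>2 \<le> F + m * \<Phi> x y" if y: "y \<in> Y" for F x y
  proof -
    define zp where "zp = x - x0 - e1 x *\<^sub>R e"
    define y1 where "y1 = (y - x0) \<bullet> e"
    define dp where "dp = y - x0 - y1 *\<^sub>R e"
    have z: "x - x0 = e1 x *\<^sub>R e + zp" "zp \<bullet> e = 0"
      by (simp_all add: zp_def inner_diff_left ee e1_def)
    have d: "y - x0 = y1 *\<^sub>R e + dp" "dp \<bullet> e = 0"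
      by (simp_all add: dp_def inner_diff_left ee y1_def)
    have "y - y0 - ((y - y0) \<bullet> e) *\<^sub>R e = dp"
      by (simp add: dp_def y1_def y0_def inner_diff_left inner_add_left ee scaleR_diff_left scaleR_add_left)
    then have dV: "norm dp \<le> V" using Y(2)[OF y] by simp
    have zz: "(x - x0) \<bullet> (x - x0) = (e1 x)\<^sup>2 + (norm zp)\<^sup>2"
      unfolding z(1) power2_norm_eq_inner using z(2)
      by (simp add: inner_add_left inner_add_right inner_commute ee power2_eq_square)
    have zd: "(x - x0) \<bullet> (y - x0) = e1 x * y1 + zp \<bullet> dp"
      unfolding z(1) d(1) using z(2) d(2) by (simp add: inner_add_left inner_add_right inner_commute ee)
    have cs: "zp \<bullet> dp \<le> norm zp * V"
    proof -
      have "zp \<bullet> dp \<le> norm zp * norm dp" by (rule norm_cauchy_schwarz)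
      also have "\<dots> \<le> norm zp * V" using dV by (intro mult_left_mono) auto
      finally show ?thesis .
    qed
    have "(norm (x - y))\<^sup>2 = (x - x0) \<bullet> (x - x0) - 2 * ((x - x0) \<bullet> (y - x0)) + (norm (y - x0))\<^sup>2"
      unfolding power2_norm_eq_inner by (simp add: inner_diff_left inner_diff_right inner_commute algebra_simps)
    then have "(norm (x0 - y))\<^sup>2 - (norm (x - y))\<^sup>2 = 2 * (e1 x * y1 + zp \<bullet> dp) - ((e1 x)\<^sup>2 + (norm zp)\<^sup>2)"
      by (simp add: zz zd norm_minus_commute)
    also have "\<dots> \<le> 2 * (e1 x * y1 + norm zp * V) - ((e1 x)\<^sup>2 + (norm zp)\<^sup>2)" using cs by simp
    finally have "A * ((norm (x0 - y))\<^sup>2 - (norm (x - y))\<^sup>2) \<le> A * (2 * (e1 x * y1 + norm zp * V) - ((e1 x)\<^sup>2 + (norm zp)\<^sup>2))"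
      using A by (intro mult_left_mono) auto
    also have "\<dots> = m * \<Phi> x y"
    proof -
      have nz: "norm zp = P x * l" using l by (simp add: P_def zp_def)
      have "A * (2 * (e1 x * y1 + norm zp * V) - ((e1 x)\<^sup>2 + (norm zp)\<^sup>2)) =
         m * ((2 * (e1 x * y1 + P x * l * (sqrt (\<mu> * E) * l / 2)) - ((e1 x)\<^sup>2 + (P x * l)\<^sup>2)) / l\<^sup>2)"
        by (simp add: Al nz V_def)
      also have "(2 * (e1 x * y1 + P x * l * (sqrt (\<mu> * E) * l / 2)) - ((e1 x)\<^sup>2 + (P x * l)\<^sup>2)) / l\<^sup>2 = \<Phi> x y"
        using l by (simp add: \<Phi>_def u_def y1_def[symmetric] field_simps power2_eq_square)
      finally show ?thesis .
    qed
    finally show ?thesis by (simp add: algebra_simps)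
  qed
  have e1w: "e1 x \<le> w" if "x \<in> X" for x
  proof -
    have "x \<bullet> e \<le> norm x" using norm_cauchy_schwarz[of x e] e by simp
    moreover have "norm x \<le> norm x0 + w" using that by (simp add: X_def)
    ultimately show ?thesis by (simp add: e1_def inner_diff_left xe)
  qed
  have \<Phi>up: "\<Phi> x y \<le> E / 3" if "x \<in> X" "y \<in> Y" for x y
  proof -
    have "u y * e1 x + P x * sqrt (\<mu> * E) - (P x)\<^sup>2 \<le> E / 3"
      by (rule far_upper[OF e1w[OF that(1)] u0[OF that(2)] u(2)[OF that(2)] \<mu> E0(1) w(1)])
    moreover have "0 \<le> (e1 x)\<^sup>2 / l\<^sup>2" by simp
    ultimately show ?thesis unfolding \<Phi>_def by linarith
  qed
  have hn1: "2 * ?n * h \<le> 1" using hn \<mu>E E0 by linarith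
  have upt: "f t x \<le> m * (H x + \<mu> * E / 16)" if t: "t1 \<le> t" "t \<le> t0" for t x
  proof -
    have tp: "0 < t" using t t1 by linarith
    have "decay CARD('n) K t \<le> decay CARD('n) K t0 * (1 + 2 * ?n * h)"
      by (rule time_factor) (use t t0 K h0 hn1 n1 in \<open>auto simp: t1h\<close>)
    then have dk: "decay CARD('n) K t \<le> m * (1 + \<mu> * E / 16)" by (simp only: hn m_def)
    have bm: "barrier \<beta> t x \<le> H x"
      unfolding H_def using t tp t0 by (intro barrier_mono scale_ratio_mono) auto
    have b0: "0 \<le> barrier \<beta> t x" using barrier_bounds(1)[of t \<beta> x] tp by linarith
    have "f t x \<le> decay CARD('n) K t * barrier \<beta> t x" by (rule up[OF tp t(2)])
    also have "\<dots> \<le> m * (1 + \<mu> * E / 16) * H x"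
    proof (rule mult_mono[OF dk bm _ b0])
      show "0 \<le> m * (1 + \<mu> * E / 16)" using m \<mu>E by (intro mult_nonneg_nonneg) auto
    qed
    also have "\<dots> \<le> m * (H x + \<mu> * E / 16)"
    proof -
      have "\<mu> * E / 16 * H x \<le> \<mu> * E / 16 * 1" using Hle[of x] \<mu>E by (intro mult_left_mono) auto
      then have "(1 + \<mu> * E / 16) * H x \<le> H x + \<mu> * E / 16" by (simp add: distrib_right)
      from mult_left_mono[OF this, of m] show ?thesis using m by (simp only: mult.assoc)
    qed
    finally show ?thesis .
  qed
  have S: "m * (H x0 - \<mu> * E / 16) \<le> f t0 x0" using lo by (simp add: m_def H_def)
  have main: "\<mu> / 16 * m * measure lborel Y \<le> step_const CARD('n) (\<mu> / (32 * ?n)) \<theta> * ((1 + \<Lambda>) ^ (CARD('n) + 1) * N / \<delta>) / q ^ CARD('n)"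
    unfolding step_const_def
  proof (rule mass_step[where E = E and X = X and ?x0.0 = x0 and ?t0.0 = t0 and ?e0.0 = "\<mu> / (32 * ?n)"
        and ?w0.0 = "\<mu> / 16" and g = 1 and \<theta> = \<theta> and m = m and q = q, folded A_def t1_def])
    show "x0 \<in> X" "compact X" using l w \<mu> by (auto simp: X_def intro!: compact_Int add_nonneg_nonneg)
    fix t x y
    assume t: "t1 < t" "t \<le> t0" and x: "x \<in> X" and y: "y \<in> Y"
      and c: "f t0 x0 - \<mu> / 16 * E * m \<le> f t x - A * (norm (x - y))\<^sup>2 + A * (norm (x0 - y))\<^sup>2"
    have c2: "m * (H x0 - \<mu> * E / 16) - \<mu> / 16 * E * m \<le> f t x + m * \<Phi> x y"
      using c S geo[OF y, of "f t x" x] by linarith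
    have fx: "f t x \<le> m * (H x + \<mu> * E / 16)" using upt[of t x] t by simp
    \<comment> \<open>The three errors of size \<open>\<mu> * E / 16\<close> are the distance of
      \<open>f t0 x0\<close> from the barrier, the threshold of the excess, and the change of the
      decay function over the time interval.\<close>
    have "m * (H x0 - 3 * (\<mu> * E / 16)) \<le> m * (H x + \<Phi> x y)"
      using c2 fx by (simp add: algebra_simps)
    then have "H x0 - 3 * (\<mu> * E / 16) \<le> H x + \<Phi> x y" using m by simp
    then have key: "H x0 - 3 * (\<mu> * E / 16) \<le> H x - (e1 x)\<^sup>2 / l\<^sup>2 - (P x)\<^sup>2 + u y * e1 x + P x * sqrt (\<mu> * E)"
      by (simp add: \<Phi>_def)
    have "E \<le> 1 / 100" using E0 by simp
    moreover have "H x \<le> H x0 + E" using Hle[of x] H0 by simp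
    ultimately have far': "H x0 - \<mu> * E < H x" "- (16 / \<mu> * w) \<le> e1 x" "P x \<le> 1"
      using far_inequalities[OF key _ e1w[OF x] u[OF y] \<mu> E0(1) _ w(1) P0] by blast+
    have nx: "norm x < norm x0 + w"
    proof (rule ccontr)
      assume "\<not> norm x < norm x0 + w"
      then have "(1 + norm x0) * (1 + 1 / (- \<beta>)) \<le> 1 + norm x"
        by (simp add: w_def R_def b_def[symmetric] distrib_left)
      then have "scale_ratio \<beta> t0 x \<le> scale_ratio \<beta> t0 x0 / 2"
        using b t0 by (intro scale_ratio_outer) (auto simp: b_def)
      then have "H x \<le> H x0 - \<mu> * E"
        unfolding H_def \<mu>_def E using t0 far by (intro barrier_drop) auto
      then show False using far'(1) by simp
    qed
    have "norm (x - x0) < (16 / \<mu> + 2) * w + 2 * l"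
    proof -
      have "x - x0 = e1 x *\<^sub>R e + (x - x0 - e1 x *\<^sub>R e)" by simp
      then have "norm (x - x0) \<le> \<bar>e1 x\<bar> * norm e + norm (x - x0 - e1 x *\<^sub>R e)"
        using norm_triangle_ineq[of "e1 x *\<^sub>R e" "x - x0 - e1 x *\<^sub>R e"] by simp
      also have "norm (x - x0 - e1 x *\<^sub>R e) = P x * l" using l by (simp add: P_def)
      finally have "norm (x - x0) \<le> \<bar>e1 x\<bar> + P x * l" using e by simp
      moreover have "P x * l \<le> 1 * l" using far'(3) l by (intro mult_right_mono) auto
      moreover have "\<bar>e1 x\<bar> \<le> 16 / \<mu> * w + w"
        using far'(2) e1w[OF x] w \<mu> by (smt (verit) divide_pos_pos mult_pos_pos)
      ultimately show ?thesis using w l unfolding distrib_right by linarith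
    qed
    then have int: "x \<in> interior X"
      using nx by (simp add: X_def interior_Int dist_norm norm_minus_commute)
    have ge1: "1 + norm x0 + e1 x \<le> 1 + norm x"
      using norm_cauchy_schwarz[of x e] e by (simp add: e1_def inner_diff_left xe)
    have \<theta>1: "exp 1 \<le> \<theta>"
    proof -
      have "1 \<le> 32 / \<mu>" using \<mu> by (simp add: field_simps)
      then show ?thesis by (simp add: \<theta>_def)
    qed
    have "(1 + norm x) powr b \<le> exp 1 * R powr b"
    proof (rule two_scale_weight[OF b])
      show "1 + norm x \<le> R * (1 + 1 / b)" using nx by (simp add: w_def R_def distrib_left)
    qed (use R one_plus_norm(2)[of x] in auto)
    also have "\<dots> \<le> \<theta> * R powr b" using \<theta>1 by (intro mult_right_mono) auto
    finally have cmp1: "(1 + norm x) powr (- \<beta>) \<le> \<theta> * q" by (simp add: q_def b_def)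
    have "R powr b \<le> exp (32 / \<mu>) * (1 + norm x) powr b"
    proof (rule two_scale_weight[OF b one_plus_norm(2)])
      have "16 / \<mu> * w \<le> 16 / \<mu> * (2 / b)" using w \<mu> by (intro mult_left_mono) auto
      also have "\<dots> = 1 * (32 / \<mu> / b)" by simp
      also have "\<dots> \<le> (1 + norm x) * (32 / \<mu> / b)" using \<mu> b by (intro mult_right_mono) auto
      finally have "16 / \<mu> * w \<le> (1 + norm x) * (32 / \<mu> / b)" .
      then show "R \<le> (1 + norm x) * (1 + 32 / \<mu> / b)"
        using ge1 far'(2) by (simp add: R_def distrib_left)
    qed (use \<mu> R in auto)
    then have cmp2: "q \<le> \<theta> * (1 + norm x) powr (- \<beta>)" by (simp add: q_def b_def \<theta>_def)
    have fl: "19 / 20 * m \<le> f t x"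
    proof -
      have "m * \<Phi> x y \<le> m * (E / 3)" using \<Phi>up[OF x y] m by (intro mult_left_mono) auto
      then have "m * (H x0 - \<mu> * E / 16 - \<mu> * E / 16 - E / 3) \<le> f t x" using c2 by (simp add: algebra_simps)
      moreover have "m * (19 / 20) \<le> m * (H x0 - \<mu> * E / 16 - \<mu> * E / 16 - E / 3)"
      proof (rule mult_left_mono)
        show "19 / 20 \<le> H x0 - \<mu> * E / 16 - \<mu> * E / 16 - E / 3" using H0 E0 \<mu>E by linarith
      qed (use m in simp)
      ultimately have "m * (19 / 20) \<le> f t x" by linarith
      then show ?thesis by simp
    qed
    have fu: "f s z \<le> 21 / 20 * m" if "t1 < s" "s \<le> t0" for s z
    proof -
      have "f s z \<le> m * (H z + \<mu> * E / 16)" using upt[of s z] that by simp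
      also have "\<dots> \<le> m * (21 / 20)"
      proof (rule mult_left_mono)
        show "H z + \<mu> * E / 16 \<le> 21 / 20" using Hle[of z] E0 \<mu>E by linarith
      qed (use m in simp)
      finally show ?thesis by simp
    qed
    have "growth t \<le> 4 * (1 + \<Lambda>) / t0"
    proof (rule growth_le[OF _ t0 K])
      show "t \<in> {0..1}" using t t0 t1 by auto
      show "19 / 20 * decay CARD('n) K t0 \<le> f t x" using fl by (simp add: m_def)
      show "f t z \<le> 21 / 20 * decay CARD('n) K t0" for z using fu[OF t] by (simp add: m_def)
    qed
    then show "x \<in> interior X \<and> (1 + norm x) powr (- \<beta>) \<le> \<theta> * q \<and> q \<le> \<theta> * (1 + norm x) powr (- \<beta>) \<and>
        m / 2 \<le> f t x \<and> f t x \<le> 2 * m \<and> growth t \<le> 4 * (1 + \<Lambda>) / t0"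
      using int cmp1 cmp2 fl fu[OF t, of x] m by linarith
  next
    fix x y assume xy: "x \<in> X" "y \<in> Y"
    have "f t1 x \<le> m * (H x + \<mu> * E / 16)" using upt[of t1 x] t1 by simp
    also have "\<dots> \<le> m * (199 / 200 + \<mu> * E / 16)" using Hle[of x] m by (intro mult_left_mono) auto
    finally have 1: "f t1 x \<le> m * (199 / 200 + \<mu> * E / 16)" .
    have 2: "m * \<Phi> x y \<le> m * (E / 3)" using \<Phi>up[OF xy] m by (intro mult_left_mono) auto
    have "f t1 x - A * (norm (x - y))\<^sup>2 + A * (norm (x0 - y))\<^sup>2 \<le> f t1 x + m * \<Phi> x y" by (rule geo[OF xy(2)])
    also have "\<dots> \<le> m * (199 / 200 + \<mu> * E / 16 + E / 3)" using 1 2 by (simp add: distrib_left)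
    also have "\<dots> \<le> m * (H x0 - \<mu> * E / 16 + 8 * E)"
    proof (rule mult_left_mono)
      show "199 / 200 + \<mu> * E / 16 + E / 3 \<le> H x0 - \<mu> * E / 16 + 8 * E" using H0 E0 \<mu>E by linarith
    qed (use m in simp)
    also have "\<dots> \<le> f t0 x0 + 8 * E * m" using S by (simp add: algebra_simps)
    finally show "f t1 x - A * (norm (x - y))\<^sup>2 + A * (norm (x0 - y))\<^sup>2 \<le> f t0 x0 + 8 * E * m" .
  next
    have "1 \<le> ?n" using n1 by simp
    then show "\<mu> / (32 * ?n) \<le> 1" using \<mu> by (simp add: divide_le_eq, linarith)
  qed (use t0 m q Y(1) E0 \<mu> in \<open>auto simp: \<theta>_def\<close>)
  have vol: "far_const CARD('n) * (sqrt t0 / q) ^ CARD('n) \<le> measure lborel Y"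
  proof -
    have "\<mu> * E * X0 * l / 64 \<le> U"
    proof -
      have "k * l / (8 * w) * (X0 / 2 * w) \<le> k * l / (8 * w) * l"
        using lw k0 l w by (intro mult_left_mono) auto
      then show ?thesis using w by (simp add: U_def k_def power2_eq_square mult.assoc mult.left_commute[of X0 l] mult.commute[of X0 l])
    qed
    from far_volume[OF n1 less_imp_le[OF X0] \<mu>(1) E[folded X0_def] l this V_def]
    have "far_const CARD('n) * l ^ CARD('n) \<le> 2 ^ CARD('n) * U * (V / ?n) ^ (CARD('n) - 1)"
      by (simp add: far_const_def \<mu>_def)
    then show ?thesis using Y(3) by (simp add: l_def)
  qed
  have "0 < \<mu> / 16" using \<mu> by simp
  then show ?thesis
    unfolding \<theta>_def[symmetric]
    by (rule volume_conclusion[OF main vol m_def q(1) t0(1) K])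
qed

end

section \<open>The first time of contact\<close>

text \<open>The two quotients are the values above which \<open>near_case\<close> and
  \<open>far_case\<close> become contradictory; the summand 1 makes both contradictions
  strict.\<close>

definition final_const :: "nat \<Rightarrow> real" where
  "final_const n = 1 + step_const n (1 / (8 * real n)) 3 / (1 / 4 * (1 / (16 * real n)) ^ n)
     + step_const n (barrier_gap n / (32 * real n)) (exp (32 / barrier_gap n)) / (barrier_gap n / 16 * far_const n)"

lemma step_const_pos:
  assumes "1 \<le> n" "0 < e0" "0 < \<theta>"
  shows "0 < step_const n e0 \<theta>"
proof -
  have "0 < real n" using assms by simp
  then have "0 < 9 / e0 + 2 * 1 * real n * \<theta>\<^sup>2 + 8"
    using assms by (intro add_pos_nonneg add_nonneg_nonneg) auto
  then show ?thesis
    using assms \<open>0 < real n\<close> unfolding step_const_def by (intro mult_pos_pos zero_less_power divide_pos_pos) auto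
qed

lemma far_const_pos: "1 \<le> n \<Longrightarrow> 0 < far_const n"
  using barrier_gap_bounds[of n] by (auto simp: far_const_def intro!: mult_pos_pos zero_less_power divide_pos_pos)

lemma final_const:
  assumes n: "1 \<le> n" and k: "0 < k" and K: "K = final_const n * k"
  shows "0 < final_const n"
    "step_const n (1 / (8 * real n)) 3 * k < 1 / 4 * (1 / (16 * real n)) ^ n * K"
    "step_const n (barrier_gap n / (32 * real n)) (exp (32 / barrier_gap n)) * k < barrier_gap n / 16 * far_const n * K"
proof -
  define a b c d where "a = step_const n (1 / (8 * real n)) 3" and "b = 1 / 4 * (1 / (16 * real n)) ^ n"
    and "c = step_const n (barrier_gap n / (32 * real n)) (exp (32 / barrier_gap n))" and "d = barrier_gap n / 16 * far_const n"
  have dr: "0 < barrier_gap n" using barrier_gap_bounds[OF n] by simp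
  have nn: "0 < real n" using n by simp
  have p: "0 < a" "0 < b" "0 < c" "0 < d"
    using n nn dr far_const_pos[OF n] by (auto simp: a_def b_def c_def d_def intro!: step_const_pos mult_pos_pos)
  have C: "final_const n = 1 + a / b + c / d"
    by (simp add: final_const_def a_def b_def c_def d_def)
  have q: "0 < a / b" "0 < c / d" using p by simp_all
  then show "0 < final_const n" unfolding C by linarith
  have "a / b * b < final_const n * b" using p q unfolding C by (intro mult_strict_right_mono) linarith+
  then have "a * k < final_const n * b * k" using p k by simp
  then show "a * k < b * K" by (simp add: K mult_ac)
  have "c / d * d < final_const n * d" using p q unfolding C by (intro mult_strict_right_mono) linarith+
  then have "c * k < final_const n * d * k" using p k by simp
  then show "c * k < d * K" by (simp add: K mult_ac)
qed

text \<open>The scale ratio vanishes for nonnegative \<beta> and tends to zero at infinity for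
  negative \<beta>. The barrier thus approaches its lower bound 99/100, so a constant level can be
  compared with it at later times outside a large ball.\<close>

lemma barrier_at_infinity:
  fixes \<beta> t s :: real
  assumes "0 \<le> t" "t \<le> 1" "0 < s"
  shows "\<exists>r>0. \<forall>x::real^'n. r \<le> norm x \<longrightarrow> barrier \<beta> t x \<le> 99 / 100 + s"
proof (cases "0 \<le> \<beta>")
  case True
  then have "barrier \<beta> t x = 99 / 100" for x :: "real^'n" by (simp add: barrier_def scale_ratio_def)
  then have "barrier \<beta> t x \<le> 99 / 100 + s" for x :: "real^'n" using assms by (metis add_increasing2 less_imp_le order_refl)
  then show ?thesis by (intro exI[of _ 1]) auto
next
  case False
  let ?p = "- (1 / real CARD('n))"
  have "((\<lambda>z. 199 / 200 - 1 / 200 * (1 + - \<beta> * (sqrt t * (1 + z) powr \<beta>)) powr ?p) \<longlongrightarrow>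
      199 / 200 - 1 / 200 * (1 + - \<beta> * (sqrt t * 0)) powr ?p) at_top"
  proof (intro tendsto_intros)
    have "filterlim (\<lambda>z :: real. 1 + z) at_top at_top" by (rule filterlim_tendsto_add_at_top[OF tendsto_const filterlim_ident])
    then show "((\<lambda>z. (1 + z) powr \<beta>) \<longlongrightarrow> 0) at_top" using False by (intro tendsto_neg_powr) auto
  qed auto
  then have "\<forall>\<^sub>F z in at_top. 199 / 200 - 1 / 200 * (1 + - \<beta> * (sqrt t * (1 + z) powr \<beta>)) powr ?p < 99 / 100 + s"
    using assms by (intro order_tendstoD(2)) auto
  then obtain r where r: "\<And>z. r \<le> z \<Longrightarrow> 199 / 200 - 1 / 200 * (1 + - \<beta> * (sqrt t * (1 + z) powr \<beta>)) powr ?p < 99 / 100 + s"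
    by (auto simp: eventually_at_top_linorder)
  have "barrier \<beta> t x \<le> 99 / 100 + s" if "max 1 r \<le> norm x" for x :: "real^'n"
  proof -
    have "max 0 (- \<beta>) = - \<beta>" using False by simp
    then show ?thesis using r[of "norm x"] that by (simp add: barrier_def scale_ratio_def)
  qed
  then show ?thesis by (intro exI[of _ "max 1 r"]) auto
qed

lemma continuous_on_barrier: "continuous_on {0..} (\<lambda>t. barrier \<beta> t x)"
proof -
  have "1 + scale_ratio \<beta> t x \<noteq> 0" if "t \<in> {0..}" for t
    using scale_ratio_nonneg[of t \<beta> x] that by simp
  then show ?thesis
    unfolding barrier_def by (intro continuous_intros) (auto simp: scale_ratio_def intro!: continuous_intros)
qed

section \<open>Continuation in time and the final contradiction\<close>

context parabolic_setting
begin

text \<open>A relative gap \<open>s\<close> at time \<open>t1\<close> survives for a short time.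
  Inside a ball this is uniform continuity; outside, where \<open>f\<close> need not be
  equicontinuous in time, the exterior maximum principle limits the growth above a constant level
  \<open>c\<close>.\<close>

lemma no_jump:
  assumes ts: "0 < t1" "t1 < 1" and K: "0 < K" and s: "0 < s" "s < 1"
    and below: "\<And>x. f t1 x \<le> (1 - s) * (decay CARD('n) K t1 * barrier \<beta> t1 x)"
  shows "\<exists>d>0. \<forall>t x. t1 \<le> t \<and> t < t1 + d \<and> t \<le> 1 \<longrightarrow> f t x \<le> decay CARD('n) K t * barrier \<beta> t x"
proof -
  define m where "m = decay CARD('n) K t1"
  have m: "0 < m" using K ts by (simp add: m_def)
  have below': "f t1 x \<le> (1 - s) * (m * barrier \<beta> t1 x)" for x unfolding m_def by (rule below)
  have b99: "99 / 100 \<le> barrier \<beta> t x" if "0 \<le> t" for t and x :: "real^'n" using barrier_bounds(1)[OF that] .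
  obtain r where r: "0 < r" "\<And>x :: real^'n. r \<le> norm x \<Longrightarrow> barrier \<beta> t1 x \<le> 99 / 100 + s / 4"
    using barrier_at_infinity[of t1 "s / 4" \<beta>] ts s by auto
  \<comment> \<open>The factor lies between the initial \<open>1 - 5/8 * s\<close> outside the ball
    and the \<open>1 - s/8\<close> that the decay function still guarantees shortly afterwards,
    leaving room on both sides for the error \<open>e\<close>.\<close>
  define c where "c = (1 - s / 2) * (99 / 100 * m)"
  have c: "0 < c" using s m by (simp add: c_def)
  have far: "(1 - s) * (m * barrier \<beta> t1 x) \<le> (1 - 5 / 8 * s) * (99 / 100 * m)" if "r \<le> norm x" for x :: "real^'n"
  proof -
    have "(1 - s) * barrier \<beta> t1 x \<le> (1 - s) * (99 / 100 + s / 4)"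
      using r(2)[OF that] s by (intro mult_left_mono) auto
    also have "\<dots> = (1 - 5 / 8 * s) * (99 / 100) - (s * (97 / 800) + s * s / 4)" by (simp add: field_simps)
    also have "\<dots> \<le> (1 - 5 / 8 * s) * (99 / 100)"
    proof -
      have "0 \<le> s * (97 / 800) + s * s / 4" using s by simp
      then show ?thesis by linarith
    qed
    finally have "m * ((1 - s) * barrier \<beta> t1 x) \<le> m * ((1 - 5 / 8 * s) * (99 / 100))" using m by (intro mult_left_mono) auto
    then show ?thesis by (simp only: mult_ac)
  qed
  define e where "e = s * m / 100"
  have e: "0 < e" using s m by (simp add: e_def)
  have "compact ({0..1::real} \<times> cball (0 :: real^'n) r)" by (intro compact_Times) auto
  then have "uniformly_continuous_on ({0..1} \<times> cball 0 r) (\<lambda>(t, x). f t x)"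
    by (intro compact_uniformly_continuous continuous_on_subset[OF cont]) auto
  then obtain d1 where d1: "0 < d1" "\<And>z w. z \<in> {0..1} \<times> cball 0 r \<Longrightarrow> w \<in> {0..1} \<times> cball 0 r \<Longrightarrow> dist w z < d1 \<Longrightarrow>
      dist (case w of (t, x) \<Rightarrow> f t x) (case z of (t, x) \<Rightarrow> f t x) < e"
    using e unfolding uniformly_continuous_on_def by metis
  have near: "f t x \<le> f t1 x + e" if "t1 \<le> t" "t < t1 + d1" "t \<le> 1" "norm x \<le> r" for t x
    using d1(2)[of "(t1, x)" "(t, x)"] that ts by (simp add: dist_Pair_Pair dist_real_def abs_less_iff)
  have "((\<lambda>t. decay CARD('n) K t) \<longlongrightarrow> decay CARD('n) K t1) (at t1)"
    using ts by (intro tendsto_intros) auto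
  then have "\<forall>\<^sub>F t in at t1. (1 - s / 8) * m < decay CARD('n) K t"
    using s m by (intro order_tendstoD(1)) (auto simp: m_def[symmetric])
  then obtain d2 where d2: "0 < d2" "\<And>t. t \<noteq> t1 \<Longrightarrow> dist t t1 < d2 \<Longrightarrow> (1 - s / 8) * m < decay CARD('n) K t"
    unfolding eventually_at by auto
  have dec: "(1 - s / 8) * m \<le> decay CARD('n) K t" if "t1 \<le> t" "t < t1 + d2" for t
  proof (cases "t = t1")
    case True
    then show ?thesis using s m by (simp add: m_def[symmetric])
  next
    case False
    then show ?thesis using d2(2)[of t] that by (simp add: dist_real_def)
  qed
  define t2 where "t2 = min 1 (t1 + d1 / 2)"
  have t2: "t1 \<le> t2" "t2 \<le> 1" "t2 < t1 + d1" using ts d1(1) by (auto simp: t2_def)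
  have "\<exists>G\<ge>0. \<forall>t x. t1 \<le> t \<and> t \<le> t2 \<and> r \<le> norm x \<longrightarrow> f t x \<le> c + G * (t - t1)"
  proof (rule exterior_maximum_principle[OF c _ t2(1,2) r(1)])
    have "c = (1 - 5 / 8 * s) * (99 / 100 * m) + e + s * m * (91 / 800)"
      by (simp add: c_def e_def field_simps)
    then have ce: "(1 - 5 / 8 * s) * (99 / 100 * m) + e \<le> c" using s m by simp
    show "f t1 x \<le> c" if "r \<le> norm x" for x
      using below'[of x] far[OF that] ce e by linarith
    show "f t x \<le> c" if "t1 \<le> t" "t \<le> t2" "norm x = r" for t x
    proof -
      have "f t x \<le> f t1 x + e" using near[of t x] that t2 by simp
      then show ?thesis using below'[of x] far[of x] ce that by linarith
    qed
  qed (use ts in auto)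
  then obtain G where G: "0 \<le> G" "\<And>t x. t1 \<le> t \<Longrightarrow> t \<le> t2 \<Longrightarrow> r \<le> norm x \<Longrightarrow> f t x \<le> c + G * (t - t1)"
    by blast
  define d where "d = min (min (d1 / 2) d2) (e / (1 + G))"
  have dle: "d \<le> d1 / 2" "d \<le> d2" unfolding d_def by linarith+
  have d: "0 < d" "d \<le> d1 / 2" "d \<le> d2" "G * d \<le> e"
  proof -
    show "0 < d" using d1(1) d2(1) e G(1) by (simp add: d_def add_pos_nonneg)
    have "d \<le> e / (1 + G)" by (simp add: d_def)
    then have "d * (1 + G) \<le> e" using G(1) by (simp add: pos_le_divide_eq add_pos_nonneg)
    then show "G * d \<le> e" using \<open>0 < d\<close> by (simp add: algebra_simps)
  qed (use dle in auto)
  have "f t x \<le> decay CARD('n) K t * barrier \<beta> t x" if t: "t1 \<le> t" "t < t1 + d" "t \<le> 1" for t x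
  proof -
    have D: "(1 - s / 8) * m \<le> decay CARD('n) K t" using dec[of t] t d by simp
    have D0: "0 \<le> decay CARD('n) K t" using K by simp
    have B: "99 / 100 \<le> barrier \<beta> t x" using b99[of t x] t ts by simp
    show ?thesis
    proof (cases "r \<le> norm x")
      case True
      have "f t x \<le> c + G * (t - t1)" by (rule G(2)) (use t d True in \<open>auto simp: t2_def\<close>)
      also have "G * (t - t1) \<le> G * d" using G(1) t by (intro mult_left_mono) auto
      also note d(4)
      finally have "f t x \<le> c + e" by simp
      also have "\<dots> = (1 - s / 8) * m * (99 / 100) - s * m * (289 / 800)" by (simp add: c_def e_def field_simps)
      also have "\<dots> \<le> (1 - s / 8) * m * (99 / 100)" using s m by simp
      also have "\<dots> \<le> decay CARD('n) K t * barrier \<beta> t x" by (rule mult_mono[OF D B D0]) simp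
      finally show ?thesis .
    next
      case False
      have "f t x \<le> f t1 x + e" by (rule near) (use t d d1(1) False in auto)
      also have "\<dots> \<le> (1 - s) * (m * barrier \<beta> t1 x) + e" using below'[of x] by simp
      also have "\<dots> \<le> (1 - s / 8) * m * barrier \<beta> t1 x"
      proof -
        have "e \<le> s * (7 / 8) * m * (99 / 100)" unfolding e_def using s m by simp
        also have "\<dots> \<le> s * (7 / 8) * m * barrier \<beta> t1 x"
          using b99[of t1 x] ts s m by (intro mult_left_mono) auto
        finally show ?thesis by (simp add: algebra_simps)
      qed
      also have "\<dots> \<le> decay CARD('n) K t * barrier \<beta> t x"
      proof (rule mult_mono[OF D _ D0])
        show "barrier \<beta> t1 x \<le> barrier \<beta> t x" using t ts by (intro barrier_mono scale_ratio_mono) auto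
        show "0 \<le> barrier \<beta> t1 x" using b99[of t1 x] ts by simp
      qed
      finally show ?thesis .
    qed
  qed
  then show ?thesis using d(1) by (intro exI[of _ d]) blast
qed

text \<open>A point violating the asserted gap would nearly touch the barrier, which the choice of
  \<open>K\<close> excludes through \<open>near_case\<close> or \<open>far_case\<close> according to
  the scale ratio.\<close>

lemma contradiction_at_touching:
  assumes K: "K = final_const CARD('n) * ((1 + \<Lambda>) ^ (CARD('n) + 1) * N / \<delta>)"
    and t0: "0 < t0" "t0 \<le> 1" "t0 \<le> time_bound K"
    and up: "\<And>t x. 0 < t \<Longrightarrow> t \<le> t0 \<Longrightarrow> f t x \<le> decay CARD('n) K t * barrier \<beta> t x"
  shows "\<exists>s>0. s < 1 \<and> (\<forall>x. f t0 x \<le> (1 - s) * (decay CARD('n) K t0 * barrier \<beta> t0 x))"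
proof -
  let ?k = "(1 + \<Lambda>) ^ (CARD('n) + 1) * N / \<delta>"
  let ?p = "- (1 / real CARD('n))"
  have n: "1 \<le> CARD('n)" by (simp add: Suc_le_eq)
  have k: "0 < ?k" using pos by simp
  note fc = final_const[OF n k K]
  have K0: "0 < K" unfolding K using fc(1) k by (rule mult_pos_pos)
  define m where "m = decay CARD('n) K t0"
  have m: "0 < m" using K0 t0 by (simp add: m_def)
  define \<mu> where "\<mu> = barrier_gap CARD('n)"
  have \<mu>: "0 < \<mu>" "\<mu> \<le> 1 / 3" unfolding \<mu>_def using barrier_gap_bounds[OF n] by auto
  define Xm where "Xm = max 0 (- \<beta>)"
  have sr: "scale_ratio \<beta> t0 x \<le> Xm" for x :: "real^'n"
  proof (cases "0 \<le> \<beta>")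
    case True
    then show ?thesis by (simp add: scale_ratio_def Xm_def)
  next
    case False
    have "(1 + norm x) powr \<beta> \<le> (1 + norm x) powr 0" using one_plus_norm(1)[of x] False by (intro powr_mono) auto
    then have "(1 + norm x) powr \<beta> \<le> 1" using one_plus_norm(2)[of x] by simp
    moreover have "sqrt t0 \<le> 1" using t0 by simp
    ultimately have "sqrt t0 * (1 + norm x) powr \<beta> \<le> 1 * 1" using t0 by (intro mult_mono) auto
    then have "Xm * (sqrt t0 * (1 + norm x) powr \<beta>) \<le> Xm * 1" by (intro mult_left_mono) (auto simp: Xm_def)
    then show ?thesis by (simp add: scale_ratio_def Xm_def)
  qed
  define Em where "Em = 1 / 200 * (1 + Xm) powr ?p"
  have Em: "0 < Em" by (simp add: Em_def Xm_def add_pos_nonneg)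
  \<comment> \<open>The scale ratio never exceeds \<open>max 0 (- \<beta>)\<close>, so
    \<open>Em\<close> bounds every local \<open>E\<close> from below. This makes \<open>s\<close>
    independent of the point.\<close>
  define s where "s = min (1 / 1000) (\<mu> * Em / 16)"
  have s: "0 < s" "s \<le> 1 / 1000" "s \<le> \<mu> * Em / 16" using \<mu> Em by (auto simp: s_def)
  have "f t0 x \<le> (1 - s) * (m * barrier \<beta> t0 x)" for x
  proof (rule ccontr)
    assume "\<not> f t0 x \<le> (1 - s) * (m * barrier \<beta> t0 x)"
    then have fx: "(1 - s) * (m * barrier \<beta> t0 x) \<le> f t0 x" by simp
    have B: "99 / 100 \<le> barrier \<beta> t0 x" "barrier \<beta> t0 x \<le> 199 / 200"
      using barrier_bounds[of t0 \<beta> x] t0 by auto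
    show False
    proof (cases "1 < scale_ratio \<beta> t0 x")
      case True
      define E where "E = 1 / 200 * (1 + scale_ratio \<beta> t0 x) powr ?p"
      have "Em \<le> E" unfolding Em_def E_def using sr[of x] True by (intro mult_left_mono powr_mono2') auto
      then have "\<mu> * Em / 16 \<le> \<mu> * E / 16" using \<mu> by (simp add: mult_left_mono)
      then have sE: "s \<le> \<mu> * E / 16" using s by linarith
      have "s * barrier \<beta> t0 x \<le> s * 1" using B s by (intro mult_left_mono) auto
      then have "barrier \<beta> t0 x - \<mu> * E / 16 \<le> (1 - s) * barrier \<beta> t0 x" using sE by (simp add: algebra_simps)
      then have "m * (barrier \<beta> t0 x - \<mu> * E / 16) \<le> m * ((1 - s) * barrier \<beta> t0 x)" using m by (intro mult_left_mono) auto
      then have "m * (barrier \<beta> t0 x - \<mu> * E / 16) \<le> f t0 x" using fx by (simp add: mult_ac)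
      then have "\<mu> / 16 * far_const CARD('n) * K \<le>
          step_const CARD('n) (\<mu> / (32 * real CARD('n))) (exp (32 / \<mu>)) * ?k"
        unfolding \<mu>_def using far_case[OF t0 K0 up True E_def] by (simp add: m_def)
      then show False using fc(3) unfolding \<mu>_def by linarith
    next
      case False
      have R: "1 \<le> 1 + norm x" by simp
      have l: "sqrt t0 * (1 + norm x) powr \<beta> \<le> 1 + norm x"
      proof -
        have "(1 + norm x) powr \<beta> \<le> (1 + norm x) powr 1" using \<beta>1 R by (intro powr_mono) auto
        then have "sqrt t0 * (1 + norm x) powr \<beta> \<le> 1 * (1 + norm x)" using t0 one_plus_norm(2)[of x] by (intro mult_mono) auto
        then show ?thesis by simp
      qed
      have bl: "\<bar>\<beta>\<bar> * (sqrt t0 * (1 + norm x) powr \<beta>) \<le> 1 + norm x"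
      proof (cases "0 \<le> \<beta>")
        case True
        then have "\<bar>\<beta>\<bar> * (sqrt t0 * (1 + norm x) powr \<beta>) \<le> 1 * (sqrt t0 * (1 + norm x) powr \<beta>)"
          using \<beta>1 t0 by (intro mult_right_mono) auto
        then show ?thesis using l by linarith
      next
        case neg: False
        then have "\<bar>\<beta>\<bar> * (sqrt t0 * (1 + norm x) powr \<beta>) = scale_ratio \<beta> t0 x"
          by (simp add: scale_ratio_def)
        then show ?thesis using False R by linarith
      qed
      have "989 / 1000 * m \<le> f t0 x"
      proof -
        have "999 / 1000 * (m * (99 / 100)) \<le> (1 - s) * (m * barrier \<beta> t0 x)"
          using s B m by (intro mult_mono) auto
        then show ?thesis using fx m by linarith
      qed
      moreover have "f t y \<le> 199 / 200 * decay CARD('n) K t" if "0 < t" "t \<le> t0" for t y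
      proof -
        have "f t y \<le> decay CARD('n) K t * barrier \<beta> t y" by (rule up[OF that])
        also have "\<dots> \<le> decay CARD('n) K t * (199 / 200)"
          using barrier_bounds(2)[of t \<beta> y] that K0 by (intro mult_left_mono) auto
        finally show ?thesis by simp
      qed
      ultimately have "1 / 4 * (1 / (16 * real CARD('n))) ^ CARD('n) * K \<le>
          step_const CARD('n) (1 / (8 * real CARD('n))) 3 * ?k"
        by (intro near_case[OF t0 K0 _ _ l bl]) (auto simp: m_def)
      then show False using fc(2) by linarith
    qed
  qed
  then show ?thesis using s by (intro exI[of _ s]) (auto simp: m_def)
qed

text \<open>The infimum of the times at which the barrier is exceeded is positive, because
  \<open>f\<close> is bounded while the barrier blows up at time 0. At the infimum the bound still
  holds by continuity from the left; the uniform gap then persists for a short time, so the infimum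
  could be larger.\<close>

theorem decay_bound:
  assumes K: "K = final_const CARD('n) * ((1 + \<Lambda>) ^ (CARD('n) + 1) * N / \<delta>)"
    and t: "0 < t" "t \<le> 1" "t \<le> time_bound K"
  shows "f t x < decay CARD('n) K t"
proof -
  have n: "1 \<le> CARD('n)" by (simp add: Suc_le_eq)
  have K0: "0 < K" unfolding K using final_const(1)[OF n, of 1] pos by simp
  define T where "T = min 1 (time_bound K)"
  have tT: "t \<le> T" using t by (simp add: T_def)
  define W where "W t x = decay CARD('n) K t * barrier \<beta> t x" for t and x :: "real^'n"
  define Bad where "Bad = {q. 0 < q \<and> q \<le> T \<and> (\<exists>z. W q z < f q z)}"
  have "Bad = {}"
  proof (rule ccontr)
    assume ne: "Bad \<noteq> {}"
    have bb: "bdd_below Bad" by (rule bdd_belowI[of _ 0]) (auto simp: Bad_def)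
    define q0 where "q0 = Inf Bad"
    have low: "q0 \<le> q" if "q \<in> Bad" for q unfolding q0_def by (rule cInf_lower[OF that bb])
    obtain M where M: "0 < M" "\<And>t x. t \<in> {0..1} \<Longrightarrow> f t x \<le> M" using f_bounded by blast
    have "filterlim (\<lambda>q. q powr (- (real CARD('n) / 2))) at_top (at_right (0::real))"
      by real_asymp
    then have "\<forall>\<^sub>F q in at_right (0::real). M / (99 / 100 * K) < q powr (- (real CARD('n) / 2))"
      by (simp add: filterlim_at_top_dense)
    then obtain q1 where q1: "0 < q1" "\<And>q. 0 < q \<Longrightarrow> q < q1 \<Longrightarrow> M / (99 / 100 * K) < q powr (- (real CARD('n) / 2))"
      unfolding eventually_at_right_field by auto
    have "q1 \<le> q" if q: "q \<in> Bad" for q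
    proof (rule ccontr)
      assume "\<not> q1 \<le> q"
      then have "M / (99 / 100 * K) < q powr (- (real CARD('n) / 2))" using q1(2) q by (simp add: Bad_def)
      then have MD: "M < 99 / 100 * decay CARD('n) K q" using K0 by (simp add: divide_less_eq mult_ac)
      obtain z where z: "W q z < f q z" using q by (auto simp: Bad_def)
      have "99 / 100 * decay CARD('n) K q \<le> W q z"
        unfolding W_def using barrier_bounds(1)[of q \<beta> z] q K0 mult_left_mono[of "99 / 100" "barrier \<beta> q z" "decay CARD('n) K q"]
        by (simp add: Bad_def mult.commute)
      moreover have "f q z \<le> M" using M(2) q by (auto simp: Bad_def T_def)
      ultimately show False using MD z by linarith
    qed
    then have "q1 \<le> q0" unfolding q0_def by (intro cInf_greatest ne) auto
    then have q0: "0 < q0" using q1(1) by linarith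
    obtain qb where qb: "qb \<in> Bad" using ne by blast
    have q0T: "q0 \<le> T" using low[OF qb] qb by (simp add: Bad_def)
    have before: "f q z \<le> W q z" if "0 < q" "q < q0" for q z
    proof (rule ccontr)
      assume "\<not> f q z \<le> W q z"
      then have "q \<in> Bad" using that q0T by (auto simp: Bad_def not_le)
      then show False using low that(2) by fastforce
    qed
    have cW: "continuous_on {0<..} (\<lambda>q. W q z)" for z
      unfolding W_def
      by (intro continuous_intros continuous_on_subset[OF continuous_on_barrier]) auto
    have at: "f q0 z \<le> W q0 z" for z
    proof -
      obtain sq where sq: "\<And>n. q0 / 2 \<le> sq n" "\<And>n. sq n < q0" "sq \<longlonglongrightarrow> q0"
        using left_sequence[of "q0 / 2" q0] q0 by auto
      have sq0: "0 < sq n" for n using sq(1)[of n] q0 by linarith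
      show ?thesis
      proof (rule LIMSEQ_le)
        have "(\<lambda>n. (\<lambda>(t, x). f t x) (sq n, z)) \<longlonglongrightarrow> (\<lambda>(t, x). f t x) (q0, z)"
        proof (rule continuous_on_tendsto_compose[OF cont])
          show "(\<lambda>n. (sq n, z)) \<longlonglongrightarrow> (q0, z)" by (intro tendsto_intros sq(3))
          show "(q0, z) \<in> {0..1} \<times> UNIV" using q0 q0T by (simp add: T_def)
          show "\<forall>\<^sub>F n in sequentially. (sq n, z) \<in> {0..1} \<times> UNIV"
            using sq(2) sq0 q0T by (intro always_eventually allI) (smt (verit) SigmaI UNIV_I atLeastAtMost_iff T_def min.bounded_iff)
        qed
        then show "(\<lambda>n. f (sq n) z) \<longlonglongrightarrow> f q0 z" by simp
        show "(\<lambda>n. W (sq n) z) \<longlonglongrightarrow> W q0 z"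
          by (rule continuous_on_tendsto_compose[OF cW sq(3)]) (use q0 sq0 in auto)
        show "\<exists>N. \<forall>n\<ge>N. f (sq n) z \<le> W (sq n) z" using before[OF sq0 sq(2)] by blast
      qed
    qed
    have all: "f q z \<le> decay CARD('n) K q * barrier \<beta> q z" if "0 < q" "q \<le> q0" for q z
      using before[of q z] at[of z] that unfolding W_def by (cases "q = q0") auto
    obtain s where s: "0 < s" "s < 1" "\<And>z. f q0 z \<le> (1 - s) * (decay CARD('n) K q0 * barrier \<beta> q0 z)"
      using contradiction_at_touching[OF K q0 _ _ all] q0T by (auto simp: T_def)
    have "q0 \<notin> Bad" using at by (auto simp: Bad_def not_less)
    then have "q0 < qb" using low[OF qb] qb by (cases "q0 = qb") auto
    then have q01: "q0 < 1" using qb by (simp add: Bad_def T_def)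
    obtain d where d: "0 < d" "\<And>t x. q0 \<le> t \<Longrightarrow> t < q0 + d \<Longrightarrow> t \<le> 1 \<Longrightarrow> f t x \<le> decay CARD('n) K t * barrier \<beta> t x"
      using no_jump[OF q0 q01 K0 s] by blast
    have "q0 + d \<le> q" if q: "q \<in> Bad" for q
    proof (rule ccontr)
      assume "\<not> q0 + d \<le> q"
      then have "f q z \<le> W q z" for z
        unfolding W_def using d(2)[of q z] low[OF q] q by (simp add: Bad_def T_def)
      then show False using q by (auto simp: Bad_def not_less[symmetric])
    qed
    then have "q0 + d \<le> q0" unfolding q0_def by (intro cInf_greatest ne) auto
    then show False using d(1) by simp
  qed
  then have "f t x \<le> W t x" using t tT by (auto simp: Bad_def not_less)
  also have "W t x \<le> decay CARD('n) K t * (199 / 200)"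
    unfolding W_def using barrier_bounds(2)[of t \<beta> x] t K0 by (intro mult_left_mono) auto
  also have "\<dots> < decay CARD('n) K t * 1" using t K0 by (intro mult_strict_left_mono) auto
  finally show ?thesis by simp
qed

end

theorem theorem2p2:
  shows "\<exists>C\<^sub>1>0. \<forall>C. \<exists>C\<^sub>2>0.
    \<forall>(f :: real \<Rightarrow> real^'d \<Rightarrow> real) (a :: real \<Rightarrow> real^'d \<Rightarrow> real^'d^'d) \<epsilon> \<delta> \<Lambda> N \<beta> \<kappa>.
      bounded ((\<lambda>(t, x). f t x) ` ({0..1} \<times> UNIV)) \<longrightarrow>
      continuous_on ({0..1} \<times> UNIV) (\<lambda>(t, x). f t x) \<longrightarrow>
      \<epsilon> > 0 \<longrightarrow> \<delta> > 0 \<longrightarrow> \<Lambda> > 0 \<longrightarrow> N > 0 \<longrightarrow> \<kappa> > - \<beta> * real CARD('d) \<longrightarrow>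
      satisfies_inequality a C \<epsilon> f \<longrightarrow>
      locally_uniformly_elliptic a \<longrightarrow>
      (\<forall>t\<in>{0..1}. \<forall>x. det (a t x) \<ge> \<delta> * (1 + norm x) powr (\<beta> * real CARD('d) - \<kappa>)) \<longrightarrow>
      (\<forall>t\<in>{0..1}. \<forall>x. mat_le (a t x) ((\<Lambda> * (1 + norm x) powr (min (2 * \<beta>) 2)) *\<^sub>R mat 1)) \<longrightarrow>
      (\<forall>t\<in>{0..1}. (\<integral>\<^sup>+ x. ennreal ((1 + norm x) powr \<kappa> * max 0 (f t x)) \<partial>lborel) \<le> ennreal N) \<longrightarrow>
      (let K = C\<^sub>1 * (N * (1 + \<Lambda>) ^ (CARD('d) + 1) / \<delta>);
           T = K powr (2 / real CARD('d)) *
               exp (- (2 / real CARD('d)) *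
                      (C\<^sub>2 * K powr (2 / real CARD('d)) / (1 + \<Lambda>)) powr (1 / \<epsilon>))
       in \<forall>t\<in>{0..T}. \<forall>x. t \<le> 1 \<longrightarrow>
            ereal (f t x) < (if t = 0 then \<infinity> else ereal (K * t powr (- (real CARD('d) / 2)))))"
proof (intro exI conjI allI impI)
  have n: "1 \<le> CARD('d)" by (simp add: Suc_le_eq)
  show "0 < final_const CARD('d)" using final_const(1)[OF n, of 1] by simp
next
  fix C :: real
  \<comment> \<open>The witness is the constant of \<open>reaction_bound\<close>; it depends on
    \<open>C\<close> alone, in particular not on \<epsilon>.\<close>
  show "0 < max 1 C * exp (2 * (2 + max 1 C))" by simp
next
  fix C :: real and f :: "real \<Rightarrow> real^'d \<Rightarrow> real" and a :: "real \<Rightarrow> real^'d \<Rightarrow> real^'d^'d"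
    and \<epsilon> \<delta> \<Lambda> N \<beta> \<kappa> :: real
  assume bdd: "bounded ((\<lambda>(t, x). f t x) ` ({0..1} \<times> UNIV))"
    and cont: "continuous_on ({0..1} \<times> UNIV) (\<lambda>(t, x). f t x)"
    and pos: "0 < \<epsilon>" "0 < \<delta>" "0 < \<Lambda>" "0 < N"
    and ineq: "satisfies_inequality a C \<epsilon> f" and ell: "locally_uniformly_elliptic a"
    and det: "\<forall>t\<in>{0..1}. \<forall>x. \<delta> * (1 + norm x) powr (\<beta> * real CARD('d) - \<kappa>) \<le> det (a t x)"
    and le: "\<forall>t\<in>{0..1}. \<forall>x. mat_le (a t x) ((\<Lambda> * (1 + norm x) powr (min (2 * \<beta>) 2)) *\<^sub>R mat 1)"
    and mass: "\<forall>t\<in>{0..1}. (\<integral>\<^sup>+ x. ennreal ((1 + norm x) powr \<kappa> * max 0 (f t x)) \<partial>lborel) \<le> ennreal N"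
  \<comment> \<open>Replacing \<beta> by its minimum with 1 leaves the upper bound for
    \<open>a\<close> unchanged and only weakens the lower bound for the determinant, as
    \<open>1 + |x|\<close> is at least 1.\<close>
  interpret parabolic_setting f a C \<epsilon> \<delta> \<Lambda> N "min \<beta> 1" \<kappa>
  proof
    show "min \<beta> 1 \<le> 1" by simp
    fix t :: real and x :: "real^'d" assume t: "t \<in> {0..1}"
    have "(1 + norm x) powr (min \<beta> 1 * real CARD('d) - \<kappa>) \<le> (1 + norm x) powr (\<beta> * real CARD('d) - \<kappa>)"
      by (intro powr_mono) (auto intro!: mult_right_mono)
    then have "\<delta> * (1 + norm x) powr (min \<beta> 1 * real CARD('d) - \<kappa>) \<le> \<delta> * (1 + norm x) powr (\<beta> * real CARD('d) - \<kappa>)"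
      using pos by (intro mult_left_mono) auto
    then show "\<delta> * (1 + norm x) powr (min \<beta> 1 * real CARD('d) - \<kappa>) \<le> det (a t x)"
      by (rule order_trans[OF _ det[rule_format, OF t]])
    have "min (2 * \<beta>) 2 = 2 * min \<beta> 1" by simp
    then show "mat_le (a t x) ((\<Lambda> * (1 + norm x) powr (2 * min \<beta> 1)) *\<^sub>R mat 1)" using le t by metis
  next
    show "\<And>t. t \<in> {0..1} \<Longrightarrow> (\<integral>\<^sup>+ x. ennreal ((1 + norm x) powr \<kappa> * max 0 (f t x)) \<partial>lborel) \<le> ennreal N"
      using mass by blast
  qed (use bdd cont pos ineq ell in auto)
  define K where "K = final_const CARD('d) * (N * (1 + \<Lambda>) ^ (CARD('d) + 1) / \<delta>)"
  have K: "K = final_const CARD('d) * ((1 + \<Lambda>) ^ (CARD('d) + 1) * N / \<delta>)" by (simp add: K_def mult_ac)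
  have "f t x < decay CARD('d) K t" if "t \<noteq> 0" "t \<in> {0..time_bound K}" "t \<le> 1" for t x
    using decay_bound[OF K, of t x] that by auto
  then show "let K = final_const CARD('d) * (N * (1 + \<Lambda>) ^ (CARD('d) + 1) / \<delta>);
           T = K powr (2 / real CARD('d)) *
               exp (- (2 / real CARD('d)) *
                      (max 1 C * exp (2 * (2 + max 1 C)) * K powr (2 / real CARD('d)) / (1 + \<Lambda>)) powr (1 / \<epsilon>))
       in \<forall>t\<in>{0..T}. \<forall>x. t \<le> 1 \<longrightarrow>
            ereal (f t x) < (if t = 0 then \<infinity> else ereal (K * t powr (- (real CARD('d) / 2))))"
    unfolding Let_def K_def[symmetric] time_bound_def[symmetric] by auto
qed

end
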